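(* Let $\mathcal{K}$ be a complete discrete valued field of characteristic zero whose residue field $\kappa$ has characteristic $p>0$ and finite $p$-rank. Then for every $\mathcal{L}\in\mathfrak{PP}(\mathcal{K})$ the natural restriction map on mod-$p$ Milnor $K$-groups $$\mathrm{Res}^i_{\mathcal{L}/\mathcal{K}}: K_i(\mathcal{K})/p\to K_i(\mathcal{L})/p$$ is zero for all $i\ge 3$. Moreover, $\mathrm{Res}^2_{\mathcal{L}/\mathcal{K}}$ is zero if either $p\neq 2$ or $H^2_{\acute{e}t}(\kappa,\mathbb{Z}/2(1))=0$.
   Context: Let $\mathcal{O}_{\mathcal{K}}$ be the valuation ring, $\pi$ a uniformizer. A pseudo-basis of $\mathcal{K}$ is a set $\Lambda=\{u_1,\dots,u_n,\pi\}$ where $\pi$ is a uniformizer of $\mathcal{K}$ and $u_1,\dots,u_n\in\mathcal{O}_{\mathcal{K}}$ are lifts of a $p$-basis $\{\bar u_1,\dots,\bar u_n\}$ of $\kappa$ (so $[\kappa:\kappa^p]=p^n$). $\mathfrak{PP}(\mathcal{K})$ denotes the collection of fields $\mathcal{K}(\Lambda^{1/p})$, obtained by adjoining to $\mathcal{K}$ a $p$-th root of each element of some pseudo-basis $\Lambda$ (pseudo-perfect extensions of level one). $K_i(\cdot)$ is the $i$-th Milnor $K$-group. For a field $\kappa$ of characteristic $2$, $H^2_{\acute{e}t}(\kappa,\mathbb{Z}/2(1))=H^1(\kappa,\Omega^1_{\kappa,\log})\cong \Omega^1_\kappa/((\mathrm{Fr}-1)\Omega^1_\kappa+d\kappa)\cong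 Br(\kappa)[2]$, where $\mathbb{Z}/2(1)$ is defined via the logarithmic de Rham–Witt sheaf. *)

theory Defs
  imports
    "HOL-Algebra.Algebra"
    "HOL-Algebra.Algebraic_Closure_Type"
    "HOL-Computational_Algebra.Computational_Algebra"
begin

section \<open>Complete discretely valued fields\<close>

text \<open>
  Valuations are additive, normalised and integer valued. The value \<open>v 0\<close> carries no
  information: it stands for infinity, and every clause treats \<open>0\<close> separately.
\<close>

definition val_ge :: "('k::field \<Rightarrow> int) \<Rightarrow> int \<Rightarrow> 'k \<Rightarrow> bool" where
  "val_ge v N x \<longleftrightarrow> x = 0 \<or> N \<le> v x"

definition valuation_ring :: "('k::field \<Rightarrow> int) \<Rightarrow> 'k set" where
  "valuation_ring v = {x. val_ge v 0 x}"

definition uniformizer :: "('k::field \<Rightarrow> int) \<Rightarrow> 'k \<Rightarrow> bool" where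
  "uniformizer v x \<longleftrightarrow> x \<noteq> 0 \<and> v x = 1"

definition val_Cauchy :: "('k::field \<Rightarrow> int) \<Rightarrow> (nat \<Rightarrow> 'k) \<Rightarrow> bool" where
  "val_Cauchy v s \<longleftrightarrow> (\<forall>N. \<exists>M. \<forall>m\<ge>M. \<forall>n\<ge>M. val_ge v N (s m - s n))"

definition val_tendsto :: "('k::field \<Rightarrow> int) \<Rightarrow> (nat \<Rightarrow> 'k) \<Rightarrow> 'k \<Rightarrow> bool" where
  "val_tendsto v s l \<longleftrightarrow> (\<forall>N. \<exists>M. \<forall>n\<ge>M. val_ge v N (s n - l))"

locale complete_discretely_valued_field =
  fixes v :: "'k::field \<Rightarrow> int"
  assumes val_mult: "\<And>x y. x \<noteq> 0 \<Longrightarrow> y \<noteq> 0 \<Longrightarrow> v (x * y) = v x + v y"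
    and val_add: "\<And>x y. x \<noteq> 0 \<Longrightarrow> y \<noteq> 0 \<Longrightarrow> x + y \<noteq> 0 \<Longrightarrow> min (v x) (v y) \<le> v (x + y)"
    and ex_uniformizer: "\<exists>x. uniformizer v x"
    and complete: "\<And>s. val_Cauchy v s \<Longrightarrow> \<exists>l. val_tendsto v s l"

text \<open>
  A type \<open>'r\<close> is a residue field of \<open>v\<close> by means of a reduction map from the valuation ring
  onto it whose kernel is the maximal ideal. The values of \<open>res\<close> outside the valuation ring are
  irrelevant.
\<close>

definition residue_map :: "('k::field \<Rightarrow> int) \<Rightarrow> ('k \<Rightarrow> 'r::field) \<Rightarrow> bool" where
  "residue_map v res \<longleftrightarrow>
     res \<in> ring_hom (ring_of_type_algebra\<lparr>carrier := valuation_ring v\<rparr>) ring_of_type_algebra \<and>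
     res ` valuation_ring v = UNIV \<and>
     (\<forall>x\<in>valuation_ring v. res x = 0 \<longleftrightarrow> val_ge v 1 x)"


section \<open>p-bases and pseudo-perfect extensions of level one\<close>

text \<open>
  A field \<open>\<kappa>\<close> of characteristic \<open>p\<close> is a vector space over its subfield \<open>\<kappa>\<^sup>p\<close>. The scalars are
  written as \<open>c ^ p\<close> with \<open>c\<close> in \<open>\<kappa>\<close>, so that \<open>\<kappa>\<close> is both the type of scalars and of vectors.
\<close>

definition pscale :: "nat \<Rightarrow> 'r::field \<Rightarrow> 'r \<Rightarrow> 'r" where
  "pscale p c x = c ^ p * x"

lemma vector_space_pscale:
  assumes "CHAR('r::field) = p" "p > 0"
  shows "vector_space (pscale p :: 'r \<Rightarrow> 'r \<Rightarrow> 'r)"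
proof -
  have "Factorial_Ring.prime CHAR('r)" using assms by (intro prime_CHAR_semidom) simp
  then have fd: "(a + b) ^ p = a ^ p + b ^ p" for a b :: 'r
    by (rule freshmans_dream) (use assms in simp)
  show ?thesis
    by unfold_locales
      (simp_all add: pscale_def distrib_left distrib_right fd power_mult_distrib mult.assoc)
qed

definition finite_p_rank :: "nat \<Rightarrow> 'r::field itself \<Rightarrow> bool" where
  "finite_p_rank p T \<longleftrightarrow> (\<exists>B :: 'r set. finite B \<and> module.span (pscale p) B = UNIV)"

definition p_monomial :: "'r::field set \<Rightarrow> ('r \<Rightarrow> nat) \<Rightarrow> 'r" where
  "p_monomial B e = (\<Prod>b\<in>B. b ^ e b)"

definition p_basis :: "nat \<Rightarrow> 'r::field set \<Rightarrow> bool" where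
  "p_basis p B \<longleftrightarrow>
     finite B \<and>
     inj_on (p_monomial B) (B \<rightarrow>\<^sub>E {..<p}) \<and>
     \<not> module.dependent (pscale p) (p_monomial B ` (B \<rightarrow>\<^sub>E {..<p})) \<and>
     module.span (pscale p) (p_monomial B ` (B \<rightarrow>\<^sub>E {..<p})) = UNIV"

definition pseudo_basis :: "nat \<Rightarrow> ('k::field \<Rightarrow> int) \<Rightarrow> ('k \<Rightarrow> 'r::field) \<Rightarrow> 'k set \<Rightarrow> bool" where
  "pseudo_basis p v res \<Lambda> \<longleftrightarrow>
     (\<exists>U \<pi>. \<Lambda> = insert \<pi> U \<and> uniformizer v \<pi> \<and>
        U \<subseteq> valuation_ring v \<and> inj_on res U \<and> p_basis p (res ` U))"

text \<open>
  A field \<open>'l\<close> with an embedding \<open>emb\<close> of \<open>'k\<close> is of the form \<open>K(\<Lambda>\<^sup>1\<^sup>/\<^sup>p)\<close>: the function \<open>r\<close>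
  chooses one \<open>p\<close>-th root of each element of \<open>\<Lambda>\<close>.
\<close>

definition pseudo_perfect_extension ::
    "nat \<Rightarrow> ('k::field \<Rightarrow> int) \<Rightarrow> ('k \<Rightarrow> 'r::field) \<Rightarrow> ('k \<Rightarrow> 'l::field) \<Rightarrow> bool" where
  "pseudo_perfect_extension p v res emb \<longleftrightarrow>
     emb \<in> ring_hom ring_of_type_algebra ring_of_type_algebra \<and>
     (\<exists>\<Lambda> r. pseudo_basis p v res \<Lambda> \<and> (\<forall>u\<in>\<Lambda>. r u ^ p = emb u) \<and>
        generate_field ring_of_type_algebra (range emb \<union> r ` \<Lambda>) = (UNIV :: 'l set))"


section \<open>Milnor K-groups modulo p\<close>

text \<open>The map from \<open>G Mod N\<close> to \<open>G' Mod N'\<close> induced by a homomorphism \<open>h\<close> from \<open>G\<close> to \<open>G'\<close>.\<close>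

definition quotient_map :: "('b, 'm) monoid_scheme \<Rightarrow> 'b set \<Rightarrow> ('a \<Rightarrow> 'b) \<Rightarrow> 'a set \<Rightarrow> 'b set" where
  "quotient_map G' N' h C = the_elem ((\<lambda>x. N' #>\<^bsub>G'\<^esub> h x) ` C)"

lemma quotient_map_coset:
  assumes h: "h \<in> hom G G'" and N: "N \<lhd> G" and N': "N' \<lhd> G'"
    and sub: "h ` N \<subseteq> N'" and x: "x \<in> carrier G"
  shows "quotient_map G' N' h (N #>\<^bsub>G\<^esub> x) = N' #>\<^bsub>G'\<^esub> h x"
proof -
  have G: "subgroup N G" "group G" and G': "subgroup N' G'" "group G'"
    using N N' by (simp_all add: normal_def)
  have hx: "h x \<in> carrier G'" using h x by (auto simp: hom_def)
  have "N' #>\<^bsub>G'\<^esub> h y = N' #>\<^bsub>G'\<^esub> h x" if y: "y \<in> N #>\<^bsub>G\<^esub> x" for y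
  proof -
    obtain n where n: "n \<in> N" "y = n \<otimes>\<^bsub>G\<^esub> x" using y unfolding r_coset_def by blast
    have "n \<in> carrier G" using n(1) G(1) by (rule subgroup.mem_carrier[rotated])
    then have "h y = h n \<otimes>\<^bsub>G'\<^esub> h x" using n(2) x hom_mult[OF h] by blast
    moreover have "h n \<in> N'" using n(1) sub by blast
    ultimately have "h y \<in> N' #>\<^bsub>G'\<^esub> h x" unfolding r_coset_def by blast
    then show ?thesis using group.repr_independence[OF G'(2) _ hx G'(1)] by simp
  qed
  moreover have "x \<in> N #>\<^bsub>G\<^esub> x" using group.rcos_self[OF G(2) x G(1)] .
  ultimately have "(\<lambda>y. N' #>\<^bsub>G'\<^esub> h y) ` (N #>\<^bsub>G\<^esub> x) = {N' #>\<^bsub>G'\<^esub> h x}" by blast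
  then show ?thesis by (simp add: quotient_map_def)
qed

text \<open>
  The \<open>i\<close>-th Milnor K-group is the degree \<open>i\<close> part of the tensor algebra of the multiplicative
  group modulo the two-sided ideal generated by the tensors of \<open>a\<close> and \<open>1 - a\<close>. It is
  presented by generators (the lists of \<open>i\<close> non-zero elements) and relations, and written
  additively inside the multiplicative group records of \<open>HOL-Algebra\<close>.
\<close>

definition milnor_tuples :: "nat \<Rightarrow> 'f::field list set" where
  "milnor_tuples i = {xs. length xs = i \<and> 0 \<notin> set xs}"

definition milnor_relations :: "nat \<Rightarrow> ('f::field list \<Rightarrow>\<^sub>0 int) set" where
  "milnor_relations i =
     {frag_of (xs @ [a * b] @ ys) - frag_of (xs @ [a] @ ys) - frag_of (xs @ [b] @ ys) | xs a b ys.
        xs @ [a] @ ys \<in> milnor_tuples i \<and> b \<noteq> 0} \<union>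
     {frag_of (xs @ [a, 1 - a] @ ys) | xs a ys. xs @ [a, 1 - a] @ ys \<in> milnor_tuples i}"

definition milnor_relation_group :: "nat \<Rightarrow> ('f::field list \<Rightarrow>\<^sub>0 int) set" where
  "milnor_relation_group i = generate (free_Abelian_group (milnor_tuples i)) (milnor_relations i)"

definition milnor_K :: "nat \<Rightarrow> ('f::field list \<Rightarrow>\<^sub>0 int) set monoid" where
  "milnor_K i = free_Abelian_group (milnor_tuples i) Mod milnor_relation_group i"

definition power_subgroup :: "('a, 'm) monoid_scheme \<Rightarrow> nat \<Rightarrow> 'a set" where
  "power_subgroup G p = (\<lambda>x. x [^]\<^bsub>G\<^esub> p) ` carrier G"

definition milnor_K_mod :: "nat \<Rightarrow> nat \<Rightarrow> ('f::field list \<Rightarrow>\<^sub>0 int) set set monoid" where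
  "milnor_K_mod p i = milnor_K i Mod power_subgroup (milnor_K i) p"

definition milnor_res ::
    "('k::field \<Rightarrow> 'l::field) \<Rightarrow> nat \<Rightarrow> ('k list \<Rightarrow>\<^sub>0 int) set \<Rightarrow> ('l list \<Rightarrow>\<^sub>0 int) set" where
  "milnor_res emb i =
     quotient_map (free_Abelian_group (milnor_tuples i)) (milnor_relation_group i)
       (frag_extend (\<lambda>xs. frag_of (map emb xs)))"

definition milnor_res_mod ::
    "('k::field \<Rightarrow> 'l::field) \<Rightarrow> nat \<Rightarrow> nat \<Rightarrow>
     ('k list \<Rightarrow>\<^sub>0 int) set set \<Rightarrow> ('l list \<Rightarrow>\<^sub>0 int) set set" where
  "milnor_res_mod emb p i =
     quotient_map (milnor_K i) (power_subgroup (milnor_K i) p) (milnor_res emb i)"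


section \<open>Etale cohomology of the residue field\<close>

text \<open>
  The etale site of the spectrum of a field \<open>\<kappa>\<close> is equivalent to discrete modules over its
  absolute Galois group, and the cohomology of a sheaf is the continuous Galois cohomology of its
  stalk at a separable closure.
\<close>

definition sep_closure :: "'r::field alg_closure set" where
  "sep_closure = {x. \<exists>f :: 'r poly. f \<noteq> 0 \<and> coprime f (pderiv f) \<and> poly (map_poly to_ac f) x = 0}"

definition sep_closure_ring :: "'r::field alg_closure ring" where
  "sep_closure_ring = ring_of_type_algebra\<lparr>carrier := sep_closure\<rparr>"

definition galois_group :: "('r::field alg_closure \<Rightarrow> 'r alg_closure) set" where
  "galois_group = {\<sigma> \<in> ring_iso sep_closure_ring sep_closure_ring.
     \<sigma> \<in> extensional sep_closure \<and> (\<forall>c. \<sigma> (to_ac c) = to_ac c)}"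

text \<open>
  Absolute Kaehler differentials of a subring \<open>A\<close> of a commutative ring, as an abelian group:
  the pair \<open>(a, b)\<close> represents \<open>a db\<close>.
\<close>

definition kaehler_relations :: "'a::comm_ring_1 set \<Rightarrow> ('a \<times> 'a \<Rightarrow>\<^sub>0 int) set" where
  "kaehler_relations A =
     {frag_of (a + a', b) - frag_of (a, b) - frag_of (a', b) | a a' b. a \<in> A \<and> a' \<in> A \<and> b \<in> A} \<union>
     {frag_of (a, b + b') - frag_of (a, b) - frag_of (a, b') | a b b'. a \<in> A \<and> b \<in> A \<and> b' \<in> A} \<union>
     {frag_of (a, b * c) - frag_of (a * b, c) - frag_of (a * c, b) | a b c. a \<in> A \<and> b \<in> A \<and> c \<in> A}"

definition kaehler_relation_group :: "'a::comm_ring_1 set \<Rightarrow> ('a \<times> 'a \<Rightarrow>\<^sub>0 int) set" where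
  "kaehler_relation_group A = generate (free_Abelian_group (A \<times> A)) (kaehler_relations A)"

definition kaehler :: "'a::comm_ring_1 set \<Rightarrow> ('a \<times> 'a \<Rightarrow>\<^sub>0 int) set monoid" where
  "kaehler A = free_Abelian_group (A \<times> A) Mod kaehler_relation_group A"

definition kaehler_form :: "'a::comm_ring_1 set \<Rightarrow> 'a \<Rightarrow> 'a \<Rightarrow> ('a \<times> 'a \<Rightarrow>\<^sub>0 int) set" where
  "kaehler_form A a b = kaehler_relation_group A #>\<^bsub>free_Abelian_group (A \<times> A)\<^esub> frag_of (a, b)"

definition kaehler_map ::
    "'a::comm_ring_1 set \<Rightarrow> ('a \<Rightarrow> 'a) \<Rightarrow> ('a \<times> 'a \<Rightarrow>\<^sub>0 int) set \<Rightarrow> ('a \<times> 'a \<Rightarrow>\<^sub>0 int) set" where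
  "kaehler_map A \<sigma> =
     quotient_map (free_Abelian_group (A \<times> A)) (kaehler_relation_group A)
       (frag_extend (\<lambda>(a, b). frag_of (\<sigma> a, \<sigma> b)))"

text \<open>
  The stalk at the separable closure of the sheaf of logarithmic differential one-forms (the
  logarithmic de Rham-Witt sheaf at the first level of the Witt tower): it is generated by the
  forms \<open>x\<^sup>-\<^sup>1 dx\<close>.
\<close>

definition log_forms :: "('r::field alg_closure \<times> 'r alg_closure \<Rightarrow>\<^sub>0 int) set monoid" where
  "log_forms = subgroup_generated (kaehler sep_closure)
     {kaehler_form sep_closure (inverse x) x | x. x \<in> sep_closure \<and> x \<noteq> 0}"

text \<open>
  Continuity of a cocycle refers to the Krull topology on the Galois group, whose basic
  neighbourhoods of \<open>\<sigma>\<close> consist of the automorphisms agreeing with \<open>\<sigma>\<close> on a finite set, and to the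
  discrete topology on the module \<open>M\<close>, on which \<open>\<sigma>\<close> acts by \<open>act \<sigma>\<close>.
\<close>

definition galois_cocycles ::
    "('m, 'b) monoid_scheme \<Rightarrow> (('r::field alg_closure \<Rightarrow> 'r alg_closure) \<Rightarrow> 'm \<Rightarrow> 'm) \<Rightarrow>
     (('r alg_closure \<Rightarrow> 'r alg_closure) \<Rightarrow> 'm) set" where
  "galois_cocycles M act =
     {c \<in> galois_group \<rightarrow>\<^sub>E carrier M.
        (\<forall>\<sigma>\<in>galois_group. \<forall>\<tau>\<in>galois_group.
           c (compose sep_closure \<sigma> \<tau>) = c \<sigma> \<otimes>\<^bsub>M\<^esub> act \<sigma> (c \<tau>)) \<and>
        (\<forall>\<sigma>\<in>galois_group. \<exists>F. finite F \<and> F \<subseteq> sep_closure \<and>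
           (\<forall>\<tau>\<in>galois_group. (\<forall>x\<in>F. \<tau> x = \<sigma> x) \<longrightarrow> c \<tau> = c \<sigma>))}"

definition galois_coboundaries ::
    "('m, 'b) monoid_scheme \<Rightarrow> (('r::field alg_closure \<Rightarrow> 'r alg_closure) \<Rightarrow> 'm \<Rightarrow> 'm) \<Rightarrow>
     (('r alg_closure \<Rightarrow> 'r alg_closure) \<Rightarrow> 'm) set" where
  "galois_coboundaries M act =
     {\<lambda>\<sigma>\<in>galois_group. act \<sigma> m \<otimes>\<^bsub>M\<^esub> inv\<^bsub>M\<^esub> m | m. m \<in> carrier M}"

definition galois_H1 ::
    "('m, 'b) monoid_scheme \<Rightarrow> (('r::field alg_closure \<Rightarrow> 'r alg_closure) \<Rightarrow> 'm \<Rightarrow> 'm) \<Rightarrow>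
     (('r alg_closure \<Rightarrow> 'r alg_closure) \<Rightarrow> 'm) set monoid" where
  "galois_H1 M act =
     \<lparr>carrier = galois_cocycles M act,
      monoid.mult = (\<lambda>c d. \<lambda>\<sigma>\<in>galois_group. c \<sigma> \<otimes>\<^bsub>M\<^esub> d \<sigma>),
      one = (\<lambda>\<sigma>\<in>galois_group. \<one>\<^bsub>M\<^esub>)\<rparr> Mod galois_coboundaries M act"

text \<open>
  For a field \<open>'r\<close> of characteristic \<open>p > 0\<close>, the group \<open>H\<^sup>2('r, \<int>/p(1))\<close>, where \<open>\<int>/p(1)\<close> is the
  sheaf of logarithmic one-forms placed in degree one.
\<close>

definition etale_H2_Zmodp1 ::
    "'r::field itself \<Rightarrow>
     (('r alg_closure \<Rightarrow> 'r alg_closure) \<Rightarrow>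
      ('r alg_closure \<times> 'r alg_closure \<Rightarrow>\<^sub>0 int) set) set monoid" where
  "etale_H2_Zmodp1 T =
     galois_H1 (log_forms :: ('r alg_closure \<times> 'r alg_closure \<Rightarrow>\<^sub>0 int) set monoid)
       (kaehler_map (sep_closure :: 'r alg_closure set))"

end

(*
  Put a p-th root in L on every element of the pseudo-basis, and let R be the valuation ring of K
  with these roots adjoined. Frobenius maps R/p onto the image of the valuation ring of K, so every
  unit a of the latter is s^p + p w with s and w in R; hence every non-zero element of K becomes,
  up to p-th powers, of the form 1 + p w. With P = 1 - x y, the Steinberg relation for
  (1 - x)/P + x (1 - y)/P = 1 rewrites the symbol {1 - x, 1 - y} in terms of symbols with an entry P.
  For x, y in p R this P lies in 1 + p^2 R, which consists of p-th powers if p is odd. If p = 2,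
  then {1 - 4 c, 1 + 2 a} vanishes because 1 + 8 R consists of squares, which settles degree 3,
  and {1 + 2 a, 1 + 2 b} reduces to {1 - 4 c, u} with c in R and u a unit of R. This symbol vanishes if
  u is s^2 + s t + c t^2 modulo the maximal ideal: up to squares, this is the norm form of
  L(sqrt(1 - 4 c)) over L.

  It remains to see that the form a^2 + a b + x b^2 represents every y in the residue field when the
  etale H^2 vanishes. Let alpha^2 + alpha = x and let chi be the corresponding quadratic character of
  the Galois group. The cocycle chi dlog y is a coboundary, of dlog z say. As the kernel of dlog
  consists of the squares, sigma(z)/z is a square or y times a square, according to chi(sigma). After
  division by a square, z lies in kappa(alpha), where the conjugate of z equals y z s^2; taking
  norms, y is the inverse of the norm of s.
*)
theory Submission
  imports Defs
begin

section \<open>Symbols in Milnor K-theory modulo p\<close>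

text \<open>L is never given a valuation. R is only known as a finitely generated module over the
  complete valuation ring of K; this makes it \<pi>-adically complete and separated, and a
  contraction principle then replaces Hensel's lemma wherever a root is extracted. The obstacle at p
  = 2 shows in (1 + p z)^p = 1 + p^2 (z + ...). For odd p the dots are divisible by p; for p = 2
  they are z^2, so a square root of 1 + 4 y asks for a solution of z^2 + z = y modulo the maximal
  ideal. Hence 1 - 4 c need not be a square, and its symbol with a unit is governed by the norm form
  s^2 + s t + c t^2 of an Artin-Schreier extension. The hypothesis on the etale H^2 makes all these
  forms universal over the residue field. In characteristic 2 square roots are unique, and a
  shortest expression of z through squares and constants already provides the divisor.\<close>

lemma hom_generate_subset:
  assumes "Group.group G" "h \<in> hom G H" "subgroup N H" "Group.group H" "K \<subseteq> carrier G"
    and "\<And>x. x \<in> K \<Longrightarrow> h x \<in> N"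
  shows "h ` generate G K \<subseteq> N"
proof -
  interpret group_hom G H h using assms(1,2,4) by (simp add: group_hom_def group_hom_axioms_def)
  have "generate H (h ` K) \<subseteq> N" using assms(3,6) by (intro H.generate_subgroup_incl) auto
  then show ?thesis using generate_img[OF assms(5)] by simp
qed

text \<open>Needed because \<open>milnor_res_mod\<close> is a \<open>quotient_map\<close> built on
  another one: the coset formula for the outer map asks that the inner map be a
  homomorphism.\<close>

lemma quotient_map_hom:
  assumes h: "h \<in> hom G G'" and N: "N \<lhd> G" and N': "N' \<lhd> G'" and sub: "h ` N \<subseteq> N'"
  shows "quotient_map G' N' h \<in> hom (G Mod N) (G' Mod N')"
proof (rule homI)
  interpret N: normal N G by fact
  interpret N': normal N' G' by fact
  note coset = quotient_map_coset[OF h N N' sub]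
  show "quotient_map G' N' h C \<in> carrier (G' Mod N')" if "C \<in> carrier (G Mod N)" for C
    using that hom_in_carrier[OF h] by (auto simp: carrier_FactGroup coset)
  show "quotient_map G' N' h (C \<otimes>\<^bsub>G Mod N\<^esub> D) = quotient_map G' N' h C \<otimes>\<^bsub>G' Mod N'\<^esub> quotient_map G' N' h D"
    if CD: "C \<in> carrier (G Mod N)" "D \<in> carrier (G Mod N)" for C D
  proof -
    obtain x y where xy: "x \<in> carrier G" "y \<in> carrier G" "C = N #>\<^bsub>G\<^esub> x" "D = N #>\<^bsub>G\<^esub> y"
      using CD by (auto simp: carrier_FactGroup)
    then have hxy: "h x \<in> carrier G'" "h y \<in> carrier G'" using hom_in_carrier[OF h] by auto
    have "C \<otimes>\<^bsub>G Mod N\<^esub> D = N #>\<^bsub>G\<^esub> (x \<otimes>\<^bsub>G\<^esub> y)" using xy N.rcos_sum by (simp add: FactGroup_def)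
    then have "quotient_map G' N' h (C \<otimes>\<^bsub>G Mod N\<^esub> D) = N' #>\<^bsub>G'\<^esub> (h x \<otimes>\<^bsub>G'\<^esub> h y)"
      using xy hom_mult[OF h] by (simp add: coset)
    also have "\<dots> = quotient_map G' N' h C \<otimes>\<^bsub>G' Mod N'\<^esub> quotient_map G' N' h D"
      using xy hxy N'.rcos_sum by (simp add: coset FactGroup_def)
    finally show ?thesis .
  qed
qed

lemma frag_extend_hom:
  assumes "\<And>k. k \<in> S \<Longrightarrow> Poly_Mapping.keys (f k) \<subseteq> T"
  shows "frag_extend f \<in> hom (free_Abelian_group S) (free_Abelian_group T)"
proof (rule homI)
  fix a assume "a \<in> carrier (free_Abelian_group S)"
  then show "frag_extend f a \<in> carrier (free_Abelian_group T)"
    using assms keys_frag_extend[of f a] by fastforce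
qed (simp add: frag_extend_add)

section \<open>The presentation of the Milnor K-groups, also modulo \<open>p\<close>\<close>

lemma milnor_relations_subset:
  "milnor_relations i \<subseteq> carrier (free_Abelian_group (milnor_tuples i))"
proof
  fix w :: "'f::field list \<Rightarrow>\<^sub>0 int"
  assume "w \<in> milnor_relations i"
  then consider (mult) xs a b ys where "w = frag_of (xs @ [a * b] @ ys) - frag_of (xs @ [a] @ ys) - frag_of (xs @ [b] @ ys)"
      "xs @ [a] @ ys \<in> milnor_tuples i" "b \<noteq> 0"
    | (steinberg) xs a ys where "w = frag_of (xs @ [a, 1 - a] @ ys)" "xs @ [a, 1 - a] @ ys \<in> milnor_tuples i"
    unfolding milnor_relations_def by blast
  then show "w \<in> carrier (free_Abelian_group (milnor_tuples i))"
  proof cases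
    case mult
    have "Poly_Mapping.keys (frag_of (xs @ [a * b] @ ys)) \<subseteq> milnor_tuples i"
      "Poly_Mapping.keys (frag_of (xs @ [a] @ ys)) \<subseteq> milnor_tuples i"
      "Poly_Mapping.keys (frag_of (xs @ [b] @ ys)) \<subseteq> milnor_tuples i"
      using mult by (auto simp: milnor_tuples_def)
    then show ?thesis
      unfolding mult(1) carrier_free_Abelian_group_iff by (meson keys_diff order_trans Un_least)
  qed (simp add: milnor_tuples_def)
qed

lemma subgroup_milnor_relation_group:
  "subgroup (milnor_relation_group i) (free_Abelian_group (milnor_tuples i))"
  unfolding milnor_relation_group_def
  by (rule group.generate_is_subgroup[OF group_free_Abelian_group milnor_relations_subset])

lemma normal_milnor_relation_group:
  "milnor_relation_group i \<lhd> free_Abelian_group (milnor_tuples i)"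
  by (rule comm_group.subgroup_imp_normal[OF abelian_free_Abelian_group subgroup_milnor_relation_group])

lemma comm_group_milnor_K: "comm_group (milnor_K i)"
  unfolding milnor_K_def
  by (rule comm_group.abelian_FactGroup[OF abelian_free_Abelian_group subgroup_milnor_relation_group])

lemma subgroup_power_subgroup:
  fixes G (structure)
  assumes "comm_group G"
  shows "subgroup (power_subgroup G n) G"
proof -
  interpret comm_group G by fact
  show ?thesis
  proof (rule subgroupI)
    show "power_subgroup G n \<subseteq> carrier G" "power_subgroup G n \<noteq> {}"
      by (auto simp: power_subgroup_def)
  next
    fix a assume "a \<in> power_subgroup G n"
    then obtain x where "x \<in> carrier G" "a = x [^] n" by (auto simp: power_subgroup_def)
    then have "inv a = inv x [^] n" "inv x \<in> carrier G" by (simp_all add: nat_pow_inv)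
    then show "inv a \<in> power_subgroup G n" by (auto simp: power_subgroup_def)
  next
    fix a b assume "a \<in> power_subgroup G n" "b \<in> power_subgroup G n"
    then obtain x y where "x \<in> carrier G" "a = x [^] n" "y \<in> carrier G" "b = y [^] n"
      by (auto simp: power_subgroup_def)
    then have "a \<otimes> b = (x \<otimes> y) [^] n" "x \<otimes> y \<in> carrier G"
      by (simp_all add: pow_mult_distrib m_comm)
    then show "a \<otimes> b \<in> power_subgroup G n" by (auto simp: power_subgroup_def)
  qed
qed

lemma normal_power_subgroup:
  assumes "comm_group G"
  shows "power_subgroup G n \<lhd> G"
  by (rule comm_group.subgroup_imp_normal[OF assms subgroup_power_subgroup[OF assms]])

text \<open>The kernel of the projection of the free abelian group onto \<open>K\<^sub>i/p\<close>.\<close>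

definition milnor_null :: "nat \<Rightarrow> nat \<Rightarrow> ('f::field list \<Rightarrow>\<^sub>0 int) set" where
  "milnor_null p i = {r + frag_cmul (int p) u | r u.
     r \<in> milnor_relation_group i \<and> u \<in> carrier (free_Abelian_group (milnor_tuples i))}"

lemma keys_milnor_relation_group: "r \<in> milnor_relation_group i \<Longrightarrow> Poly_Mapping.keys r \<subseteq> milnor_tuples i"
  using subgroup.mem_carrier[OF subgroup_milnor_relation_group] by simp

lemma milnor_relation_group_zero: "0 \<in> milnor_relation_group i"
  using subgroup.one_closed[OF subgroup_milnor_relation_group] by simp

lemma milnor_relation_group_add:
  "r \<in> milnor_relation_group i \<Longrightarrow> r' \<in> milnor_relation_group i \<Longrightarrow> r + r' \<in> milnor_relation_group i"
  using subgroup.m_closed[OF subgroup_milnor_relation_group] by fastforce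

lemma milnor_relation_group_minus: "r \<in> milnor_relation_group i \<Longrightarrow> - r \<in> milnor_relation_group i"
  using subgroup.m_inv_closed[OF subgroup_milnor_relation_group] keys_milnor_relation_group by fastforce

lemma milnor_relation_group_diff:
  "r \<in> milnor_relation_group i \<Longrightarrow> r' \<in> milnor_relation_group i \<Longrightarrow> r - r' \<in> milnor_relation_group i"
  using milnor_relation_group_add[OF _ milnor_relation_group_minus] by fastforce

lemma milnor_relation_groupI: "r \<in> milnor_relations i \<Longrightarrow> r \<in> milnor_relation_group i"
  unfolding milnor_relation_group_def by (rule generate.incl)

lemma milnor_null_relation:
  assumes "r \<in> milnor_relation_group i"
  shows "r \<in> milnor_null p i"
  using assms unfolding milnor_null_def by (force intro: exI[of _ 0])

lemma milnor_null_zero: "0 \<in> milnor_null p i"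
  by (rule milnor_null_relation[OF milnor_relation_group_zero])

lemma milnor_null_diff:
  assumes "a \<in> milnor_null p i" "b \<in> milnor_null p i"
  shows "a - b \<in> milnor_null p i"
proof -
  obtain r u s w where *: "a = r + frag_cmul (int p) u" "r \<in> milnor_relation_group i" "Poly_Mapping.keys u \<subseteq> milnor_tuples i"
    "b = s + frag_cmul (int p) w" "s \<in> milnor_relation_group i" "Poly_Mapping.keys w \<subseteq> milnor_tuples i"
    using assms unfolding milnor_null_def by auto
  have "a - b = (r - s) + frag_cmul (int p) (u - w)"
    unfolding * by (rule poly_mapping_eqI) (simp add: lookup_add lookup_minus algebra_simps)
  moreover have "r - s \<in> milnor_relation_group i" using * by (blast intro: milnor_relation_group_diff)
  moreover have "Poly_Mapping.keys (u - w) \<subseteq> milnor_tuples i" using * by (meson keys_diff order_trans Un_least)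
  ultimately show ?thesis unfolding milnor_null_def by auto
qed

lemma milnor_null_add:
  assumes "a \<in> milnor_null p i" "b \<in> milnor_null p i"
  shows "a + b \<in> milnor_null p i"
  using milnor_null_diff[OF assms(1) milnor_null_diff[OF milnor_null_zero assms(2)]] by simp

lemma milnor_mult_relation:
  assumes "a \<noteq> 0" "b \<noteq> 0" "0 \<notin> set xs" "0 \<notin> set ys" "i = Suc (length xs + length ys)"
  shows "frag_of (xs @ [a * b] @ ys) - frag_of (xs @ [a] @ ys) - frag_of (xs @ [b] @ ys)
    \<in> milnor_relation_group i"
proof (rule milnor_relation_groupI)
  have "xs @ [a] @ ys \<in> milnor_tuples i" using assms by (auto simp: milnor_tuples_def)
  then show "frag_of (xs @ [a * b] @ ys) - frag_of (xs @ [a] @ ys) - frag_of (xs @ [b] @ ys)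
    \<in> milnor_relations i" unfolding milnor_relations_def using assms(2) by blast
qed

lemma milnor_pow_relation:
  assumes "a \<noteq> 0" "0 \<notin> set xs" "0 \<notin> set ys" "i = Suc (length xs + length ys)"
  shows "frag_of (xs @ [a ^ n] @ ys) - frag_cmul (int n) (frag_of (xs @ [a] @ ys))
    \<in> milnor_relation_group i"
proof (induction n)
  case 0
  \<comment> \<open>The relation for 1 * 1 is minus the symbol with entry 1, so that this symbol is
    itself a relation.\<close>
  have "- (frag_of (xs @ [1 * 1] @ ys) - frag_of (xs @ [1] @ ys) - frag_of (xs @ [1] @ ys))
    \<in> milnor_relation_group i"
    by (intro milnor_relation_group_minus milnor_mult_relation) (use assms in auto)
  then show ?case by simp
next
  case (Suc n)
  have "frag_of (xs @ [a * a ^ n] @ ys) - frag_of (xs @ [a] @ ys) - frag_of (xs @ [a ^ n] @ ys)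
    \<in> milnor_relation_group i"
    by (rule milnor_mult_relation) (use assms in auto)
  from milnor_relation_group_add[OF this Suc] show ?case
    by (simp add: frag_cmul_distrib algebra_simps)
qed

lemma milnor_null_mult_slot:
  assumes "a \<noteq> 0" "b \<noteq> 0" "0 \<notin> set xs" "0 \<notin> set ys" "i = Suc (length xs + length ys)"
  assumes "frag_of (xs @ [b] @ ys) \<in> milnor_null p i"
  shows "frag_of (xs @ [a * b] @ ys) \<in> milnor_null p i \<longleftrightarrow> frag_of (xs @ [a] @ ys) \<in> milnor_null p i"
proof -
  let ?r = "frag_of (xs @ [a * b] @ ys) - frag_of (xs @ [a] @ ys) - frag_of (xs @ [b] @ ys)"
  have r: "?r \<in> milnor_null p i"
    by (rule milnor_null_relation, rule milnor_mult_relation) (use assms in auto)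
  have 1: "frag_of (xs @ [a * b] @ ys) = ?r + frag_of (xs @ [b] @ ys) + frag_of (xs @ [a] @ ys)"
    and 2: "frag_of (xs @ [a] @ ys) = frag_of (xs @ [a * b] @ ys) - (?r + frag_of (xs @ [b] @ ys))"
    by (simp_all add: algebra_simps)
  show ?thesis using milnor_null_add[OF r assms(6)] 1 2 milnor_null_add milnor_null_diff by metis
qed

lemma milnor_null_pow_slot:
  assumes "a \<noteq> 0" "0 \<notin> set xs" "0 \<notin> set ys" "i = Suc (length xs + length ys)"
  shows "frag_of (xs @ [a ^ p] @ ys) \<in> milnor_null p i"
proof -
  have "Poly_Mapping.keys (frag_of (xs @ [a] @ ys)) \<subseteq> milnor_tuples i"
    using assms by (auto simp: milnor_tuples_def)
  moreover have "frag_of (xs @ [a ^ p] @ ys) =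
     (frag_of (xs @ [a ^ p] @ ys) - frag_cmul (int p) (frag_of (xs @ [a] @ ys)))
      + frag_cmul (int p) (frag_of (xs @ [a] @ ys))" by simp
  ultimately show ?thesis
    using milnor_pow_relation[OF assms, of p] unfolding milnor_null_def carrier_free_Abelian_group_iff by blast
qed

text \<open>
  The bilinearity, Steinberg and torsion relations of \<open>K\<^sub>2/p\<close>, phrased for the set of pairs whose
  symbol vanishes: in each slot, that set is closed under products and quotients.
\<close>

locale symbol_vanishing =
  fixes Z :: "'f::field \<Rightarrow> 'f \<Rightarrow> bool" and p :: nat
  assumes mult_left_iff: "a \<noteq> 0 \<Longrightarrow> b \<noteq> 0 \<Longrightarrow> c \<noteq> 0 \<Longrightarrow> Z b c \<Longrightarrow> Z (a * b) c \<longleftrightarrow> Z a c"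
    and mult_right_iff: "a \<noteq> 0 \<Longrightarrow> b \<noteq> 0 \<Longrightarrow> c \<noteq> 0 \<Longrightarrow> Z c b \<Longrightarrow> Z c (a * b) \<longleftrightarrow> Z c a"
    and steinberg: "a \<noteq> 0 \<Longrightarrow> a \<noteq> 1 \<Longrightarrow> Z a (1 - a)"
    and pow_left: "a \<noteq> 0 \<Longrightarrow> c \<noteq> 0 \<Longrightarrow> Z (a ^ p) c"
    and pow_right: "a \<noteq> 0 \<Longrightarrow> c \<noteq> 0 \<Longrightarrow> Z c (a ^ p)"
begin

lemma one_left: "c \<noteq> 0 \<Longrightarrow> Z 1 c"
  using pow_left[of 1 c] by simp

lemma one_right: "c \<noteq> 0 \<Longrightarrow> Z c 1"
  using pow_right[of 1 c] by simp

lemma inverse_left: "a \<noteq> 0 \<Longrightarrow> c \<noteq> 0 \<Longrightarrow> Z a c \<Longrightarrow> Z (inverse a) c"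
  using mult_left_iff[of "inverse a" a c] one_left[of c] by simp

lemma inverse_right: "a \<noteq> 0 \<Longrightarrow> c \<noteq> 0 \<Longrightarrow> Z c a \<Longrightarrow> Z c (inverse a)"
  using mult_right_iff[of "inverse a" a c] one_right[of c] by simp

lemma divide_right: "a \<noteq> 0 \<Longrightarrow> b \<noteq> 0 \<Longrightarrow> c \<noteq> 0 \<Longrightarrow> Z c a \<Longrightarrow> Z c b \<Longrightarrow> Z c (a / b)"
  using mult_right_iff[of a "inverse b" c] inverse_right[of b c] by (simp add: divide_inverse)

lemma mult_left: "a \<noteq> 0 \<Longrightarrow> b \<noteq> 0 \<Longrightarrow> c \<noteq> 0 \<Longrightarrow> Z a c \<Longrightarrow> Z b c \<Longrightarrow> Z (a * b) c"
  using mult_left_iff by blast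

lemma mult_right: "a \<noteq> 0 \<Longrightarrow> b \<noteq> 0 \<Longrightarrow> c \<noteq> 0 \<Longrightarrow> Z c a \<Longrightarrow> Z c b \<Longrightarrow> Z c (a * b)"
  using mult_right_iff by blast

text \<open>The classical identity - a = (1 - a) / (1 - 1/a): the symbol of a with the numerator is
  Steinberg, and with the denominator it is the inverse of the Steinberg symbol for 1/a.\<close>

lemma minus_self:
  assumes a: "a \<noteq> 0"
  shows "Z a (- a)"
proof (cases "a = 1")
  case False
  have "Z (inverse a) (1 - inverse a)" using a False by (intro steinberg) auto
  then have "Z (inverse (inverse a)) (1 - inverse a)" by (rule inverse_left[rotated 2]) (use a False in auto)
  then have "Z a ((1 - a) / (1 - inverse a))"
    using a False by (intro divide_right steinberg) auto
  moreover have "(1 - a) / (1 - inverse a) = - a" using a False by (simp add: field_simps)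
  ultimately show ?thesis by simp
qed (simp add: one_left)

text \<open>Antisymmetry of the symbol, of which only the vanishing locus is visible here. It comes
  from {a b, - a b} = 0 after {a, - a}, {a, b} and {b, - b} have been split off.\<close>

lemma sym:
  assumes "a \<noteq> 0" "b \<noteq> 0" "Z a b"
  shows "Z b a"
proof -
  have "Z a ((- a) * b)" using assms minus_self by (intro mult_right) auto
  moreover have "Z (b * a) ((- a) * b)" using minus_self[of "b * a"] assms by (simp add: mult.commute)
  ultimately have "Z b ((- a) * b)" using mult_left_iff[of b a "(- a) * b"] assms by simp
  then have "Z b (a * (- b))" by (simp add: mult.commute)
  then show ?thesis using mult_right_iff[of a "- b" b] minus_self[of b] assms by simp
qed

text \<open>With \<open>P = 1 - x y\<close>, the elements \<open>(1 - x) / P\<close> and \<open>x (1 - y) / P\<close> add up to 1.\<close>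

lemma one_minus_pair:
  assumes nz: "x \<noteq> 1" "y \<noteq> 1" "x * y \<noteq> 1"
    and Zw: "x \<noteq> 0 \<Longrightarrow> Z (1 - x * y) (x * (1 - y) / (1 - x * y))"
    and Zx: "Z (1 - x) (1 - x * y)"
  shows "Z (1 - x) (1 - y)"
proof (cases "x = 0")
  case False
  define P where "P = 1 - x * y"
  define w where "w = x * (1 - y) / P"
  have n: "1 - x \<noteq> 0" "1 - y \<noteq> 0" "P \<noteq> 0" "w \<noteq> 0" using nz False by (auto simp: P_def w_def)
  have u: "(1 - x) / P = 1 - w" using n by (simp add: w_def P_def field_simps)
  have "Z (1 - w) w"
    using steinberg[of "1 - w"] n u by (metis add_diff_cancel_left' diff_eq_eq diff_0_right divide_eq_0_iff diff_zero)
  then have "Z ((1 - w) * P) w" using n u Zw False by (intro mult_left) (auto simp: P_def w_def)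
  moreover have "(1 - w) * P = 1 - x" using n by (simp flip: u)
  ultimately have "Z (1 - x) w" by simp
  \<comment> \<open>Multiplying the second slot by P turns w into x (1 - y); the factor x is then
    removed by the Steinberg relation for 1 - x.\<close>
  then have "Z (1 - x) (w * P)" using n Zx by (intro mult_right) (auto simp: P_def)
  then have "Z (1 - x) (x * (1 - y))" using n by (simp add: w_def)
  moreover have "Z (1 - x) x" using steinberg[of "1 - x"] n False by simp
  ultimately show ?thesis using mult_right_iff[of "1 - y" x "1 - x"] n False by (simp add: mult.commute)
qed (use nz one_left in auto)

lemma one_minus_pair_power:
  assumes "x \<noteq> 1" "y \<noteq> 1" and g: "1 - x * y = g ^ p" "g \<noteq> 0"
  shows "Z (1 - x) (1 - y)"
proof (rule one_minus_pair)
  have P: "1 - x * y \<noteq> 0" using g by simp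
  show "x * y \<noteq> 1" using P by auto
  show "Z (1 - x * y) (x * (1 - y) / (1 - x * y))" if "x \<noteq> 0"
    using pow_left[of g] g P assms(2) that by simp
  show "Z (1 - x) (1 - x * y)" using pow_right[of g] g assms(1) by simp
qed fact+

end

text \<open>The entries \<open>xs\<close> and \<open>ys\<close> are carried along, so that arguments
  in K_2 can be run on any two adjacent entries of a longer symbol.\<close>

lemma symbol_vanishing_milnor_null:
  assumes "0 \<notin> set xs" "0 \<notin> set ys" "i = length xs + length ys + 2"
  shows "symbol_vanishing (\<lambda>a b. frag_of (xs @ [a, b] @ ys) \<in> milnor_null p i) p"
proof
  fix a b c :: 'a assume nz: "a \<noteq> 0" "b \<noteq> 0" "c \<noteq> 0"
  show "frag_of (xs @ [a * b, c] @ ys) \<in> milnor_null p i \<longleftrightarrow> frag_of (xs @ [a, c] @ ys) \<in> milnor_null p i"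
    if "frag_of (xs @ [b, c] @ ys) \<in> milnor_null p i"
    using milnor_null_mult_slot[of a b xs "c # ys" i p] nz assms that by simp
  show "frag_of (xs @ [c, a * b] @ ys) \<in> milnor_null p i \<longleftrightarrow> frag_of (xs @ [c, a] @ ys) \<in> milnor_null p i"
    if "frag_of (xs @ [c, b] @ ys) \<in> milnor_null p i"
    using milnor_null_mult_slot[of a b "xs @ [c]" ys i p] nz assms that by simp
next
  fix a :: 'a assume "a \<noteq> 0" "a \<noteq> 1"
  then have "xs @ [a, 1 - a] @ ys \<in> milnor_tuples i" using assms by (auto simp: milnor_tuples_def)
  then show "frag_of (xs @ [a, 1 - a] @ ys) \<in> milnor_null p i"
    by (intro milnor_null_relation milnor_relation_groupI) (auto simp: milnor_relations_def)
next
  fix a c :: 'a assume nz: "a \<noteq> 0" "c \<noteq> 0"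
  show "frag_of (xs @ [a ^ p, c] @ ys) \<in> milnor_null p i"
    using milnor_null_pow_slot[of a xs "c # ys" i p] nz assms by simp
  show "frag_of (xs @ [c, a ^ p] @ ys) \<in> milnor_null p i"
    using milnor_null_pow_slot[of a "xs @ [c]" ys i p] nz assms by simp
qed


text \<open>It suffices to treat generators: \<open>milnor_null\<close> is a subgroup, so
  \<open>F\<close> maps the whole free group into it, and there the relation part dies in K_i while
  the multiple of \<open>p\<close> becomes a \<open>p\<close>-th power. The rest checks that the two
  nested quotient maps are well defined.\<close>

lemma milnor_res_mod_eq_one:
  fixes emb :: "'k::field \<Rightarrow> 'l::field"
  assumes emb0: "\<And>x. emb x = 0 \<longleftrightarrow> x = 0"
    and emb1: "emb 1 = 1"
    and emb_diff: "\<And>x y. emb (x - y) = emb x - emb y"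
    and emb_mult: "\<And>x y. emb (x * y) = emb x * emb y"
    and null: "\<And>xs. xs \<in> milnor_tuples i \<Longrightarrow> frag_of (map emb xs) \<in> milnor_null p i"
    and x: "x \<in> carrier (milnor_K_mod p i)"
  shows "milnor_res_mod emb p i x = \<one>\<^bsub>milnor_K_mod p i\<^esub>"
proof -
  define F where "F = frag_extend (\<lambda>xs. frag_of (map emb xs))"
  let ?A = "free_Abelian_group (milnor_tuples i) :: ('k list \<Rightarrow>\<^sub>0 int) monoid"
  let ?B = "free_Abelian_group (milnor_tuples i) :: ('l list \<Rightarrow>\<^sub>0 int) monoid"
  let ?M = "milnor_relation_group i :: ('k list \<Rightarrow>\<^sub>0 int) set"
  let ?N = "milnor_relation_group i :: ('l list \<Rightarrow>\<^sub>0 int) set"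
  let ?K = "milnor_K i :: ('k list \<Rightarrow>\<^sub>0 int) set monoid"
  let ?L = "milnor_K i :: ('l list \<Rightarrow>\<^sub>0 int) set monoid"
  interpret K: comm_group ?K by (rule comm_group_milnor_K)
  interpret L: comm_group ?L by (rule comm_group_milnor_K)
  have tup: "map emb xs \<in> milnor_tuples i \<longleftrightarrow> xs \<in> milnor_tuples i" for xs
    using emb0 by (force simp: milnor_tuples_def)
  have F_of: "F (frag_of xs) = frag_of (map emb xs)" and F_diff: "F (a - b) = F a - F b" and F0: "F 0 = 0" for xs a b
    by (simp_all add: F_def frag_extend_diff)
  have F_hom: "F \<in> hom ?A ?B"
    unfolding F_def by (rule frag_extend_hom) (simp add: tup)
  have F_null: "F a \<in> milnor_null p i" if "Poly_Mapping.keys a \<subseteq> milnor_tuples i" for a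
    by (rule free_Abelian_group_induct[OF that])
      (auto simp: F0 F_of F_diff null intro: milnor_null_zero milnor_null_diff)
  have F_relation: "F h \<in> ?N" if h: "h \<in> milnor_relations i" for h
  proof -
    consider (mult) xs a b ys where "h = frag_of (xs @ [a * b] @ ys) - frag_of (xs @ [a] @ ys) - frag_of (xs @ [b] @ ys)"
        "xs @ [a] @ ys \<in> milnor_tuples i" "b \<noteq> 0"
      | (steinberg) xs a ys where "h = frag_of (xs @ [a, 1 - a] @ ys)" "xs @ [a, 1 - a] @ ys \<in> milnor_tuples i"
      using h unfolding milnor_relations_def by blast
    then have "F h \<in> milnor_relations i"
    proof cases
      case mult
      then have "map emb xs @ [emb a] @ map emb ys \<in> milnor_tuples i" "emb b \<noteq> 0"
        using tup[of "xs @ [a] @ ys"] emb0 by auto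
      then show ?thesis
        unfolding milnor_relations_def mult(1) F_diff F_of by (auto simp: emb_mult)
    next
      case steinberg
      then have "map emb xs @ [emb a, 1 - emb a] @ map emb ys \<in> milnor_tuples i"
        using tup[of "xs @ [a, 1 - a] @ ys"] by (simp add: emb_diff emb1)
      then show ?thesis
        unfolding milnor_relations_def steinberg(1) F_of by (auto simp: emb_diff emb1)
    qed
    then show ?thesis by (rule milnor_relation_groupI)
  qed
  have F_rel: "F ` ?M \<subseteq> ?N"
    unfolding milnor_relation_group_def[where 'f='k]
    by (rule hom_generate_subset[OF group_free_Abelian_group F_hom subgroup_milnor_relation_group
          group_free_Abelian_group milnor_relations_subset F_relation])
  note normal = normal_milnor_relation_group normal_milnor_relation_group
  have res_hom: "milnor_res emb i \<in> hom ?K ?L"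
    unfolding milnor_res_def F_def[symmetric] milnor_K_def by (rule quotient_map_hom[OF F_hom normal F_rel])
  have coset_hom: "(\<lambda>a. ?N #>\<^bsub>?B\<^esub> a) \<in> hom ?B ?L"
    unfolding milnor_K_def by (rule normal.r_coset_hom_Mod[OF normal_milnor_relation_group])
  interpret coset: group_hom ?B ?L "\<lambda>a. ?N #>\<^bsub>?B\<^esub> a"
    using coset_hom by (simp add: group_hom_def group_hom_axioms_def)
  have res_pow: "milnor_res emb i a \<in> power_subgroup ?L p" if a: "a \<in> carrier ?K" for a
  proof -
    obtain w where w: "w \<in> carrier ?A" "a = ?M #>\<^bsub>?A\<^esub> w"
      using a unfolding milnor_K_def carrier_FactGroup by blast
    obtain r u where ru: "F w = r + frag_cmul (int p) u" "r \<in> ?N" "u \<in> carrier ?B"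
      using F_null[of w] w(1) unfolding milnor_null_def by auto
    have "?N #>\<^bsub>?B\<^esub> F w = (?N #>\<^bsub>?B\<^esub> r) \<otimes>\<^bsub>?L\<^esub> (?N #>\<^bsub>?B\<^esub> u) [^]\<^bsub>?L\<^esub> p"
      using coset.hom_mult[of r "u [^]\<^bsub>?B\<^esub> p"] coset.hom_nat_pow[OF ru(3), of p] ru
        keys_milnor_relation_group[OF ru(2)] coset.G.nat_pow_closed[OF ru(3), of p] by simp
    also have "?N #>\<^bsub>?B\<^esub> r = \<one>\<^bsub>?L\<^esub>"
      using subgroup.rcos_const[OF subgroup_milnor_relation_group group_free_Abelian_group ru(2)]
      by (simp add: milnor_K_def FactGroup_def)
    finally have "?N #>\<^bsub>?B\<^esub> F w = (?N #>\<^bsub>?B\<^esub> u) [^]\<^bsub>?L\<^esub> p"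
      using coset.hom_closed[OF ru(3)] by simp
    moreover have "milnor_res emb i a = ?N #>\<^bsub>?B\<^esub> F w"
      unfolding w(2) milnor_res_def F_def[symmetric] by (rule quotient_map_coset[OF F_hom normal F_rel w(1)])
    ultimately show ?thesis using coset.hom_closed[OF ru(3)] by (auto simp: power_subgroup_def)
  qed
  obtain a where a: "a \<in> carrier ?K" "x = power_subgroup ?K p #>\<^bsub>?K\<^esub> a"
    using x unfolding milnor_K_mod_def carrier_FactGroup by blast
  have "milnor_res_mod emb p i x = power_subgroup ?L p #>\<^bsub>?L\<^esub> milnor_res emb i a"
    unfolding a(2) milnor_res_mod_def
  proof (rule quotient_map_coset[OF res_hom _ _ _ a(1)])
    show "power_subgroup ?K p \<lhd> ?K" by (rule normal_power_subgroup[OF comm_group_milnor_K])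
    show "power_subgroup ?L p \<lhd> ?L" by (rule normal_power_subgroup[OF comm_group_milnor_K])
    show "milnor_res emb i ` power_subgroup ?K p \<subseteq> power_subgroup ?L p"
      using res_pow by (auto simp: power_subgroup_def)
  qed
  also have "\<dots> = power_subgroup ?L p"
    by (rule subgroup.rcos_const[OF subgroup_power_subgroup[OF comm_group_milnor_K] L.is_group res_pow[OF a(1)]])
  also have "\<dots> = \<one>\<^bsub>milnor_K_mod p i\<^esub>" by (simp add: milnor_K_mod_def FactGroup_def)
  finally show ?thesis .
qed

section \<open>Finite orders over complete discrete valuation rings\<close>

context complete_discretely_valued_field
begin

lemma val_one: "v 1 = 0"
  using val_mult[of 1 1] by simp

lemma val_minus: "v (- x) = v x"
proof (cases "x = 0")
  case False
  have "v (- 1) = 0" using val_mult[of "- 1" "- 1"] val_one by simp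
  then show ?thesis using val_mult[of "- 1" x] False by simp
qed simp

lemma val_inverse: "x \<noteq> 0 \<Longrightarrow> v (inverse x) = - v x"
  using val_mult[of x "inverse x"] val_one by simp

lemma val_divide: "x \<noteq> 0 \<Longrightarrow> y \<noteq> 0 \<Longrightarrow> v (x / y) = v x - v y"
  using val_mult[of x "inverse y"] val_inverse[of y] by (simp add: divide_inverse)

lemma val_power: "x \<noteq> 0 \<Longrightarrow> v (x ^ n) = int n * v x"
  by (induction n) (auto simp: val_one val_mult algebra_simps)

lemma val_ge_zero [simp]: "val_ge v n 0"
  by (simp add: val_ge_def)

lemma val_ge_mono: "val_ge v n x \<Longrightarrow> m \<le> n \<Longrightarrow> val_ge v m x"
  by (auto simp: val_ge_def)

lemma val_ge_minus: "val_ge v n x \<Longrightarrow> val_ge v n (- x)"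
  by (auto simp: val_ge_def val_minus)

lemma val_ge_add: "val_ge v n x \<Longrightarrow> val_ge v n y \<Longrightarrow> val_ge v n (x + y)"
  unfolding val_ge_def using val_add[of x y] by force

lemma val_ge_diff: "val_ge v n x \<Longrightarrow> val_ge v n y \<Longrightarrow> val_ge v n (x - y)"
  using val_ge_add[of n x "- y"] val_ge_minus by simp

lemma val_ge_mult: "val_ge v m x \<Longrightarrow> val_ge v n y \<Longrightarrow> val_ge v (m + n) (x * y)"
  unfolding val_ge_def using val_mult[of x y] by auto

lemma val_ring_closed:
  "0 \<in> valuation_ring v" "1 \<in> valuation_ring v"
  "x \<in> valuation_ring v \<Longrightarrow> y \<in> valuation_ring v \<Longrightarrow> x + y \<in> valuation_ring v"
  "x \<in> valuation_ring v \<Longrightarrow> y \<in> valuation_ring v \<Longrightarrow> x - y \<in> valuation_ring v"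
  "x \<in> valuation_ring v \<Longrightarrow> - x \<in> valuation_ring v"
  "x \<in> valuation_ring v \<Longrightarrow> y \<in> valuation_ring v \<Longrightarrow> x * y \<in> valuation_ring v"
  using val_ge_add[of 0 x y] val_ge_diff[of 0 x y] val_ge_minus[of 0 x] val_ge_mult[of 0 x 0 y]
  by (auto simp: valuation_ring_def) (simp add: val_ge_def val_one)

lemma val_ring_power: "x \<in> valuation_ring v \<Longrightarrow> x ^ n \<in> valuation_ring v"
  by (induction n) (auto intro: val_ring_closed)

lemma val_ring_of_nat: "of_nat n \<in> valuation_ring v"
  by (induction n) (auto intro: val_ring_closed)

lemma val_ring_sum: "(\<And>i. i \<in> I \<Longrightarrow> f i \<in> valuation_ring v) \<Longrightarrow> sum f I \<in> valuation_ring v"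
  by (induction I rule: infinite_finite_induct) (auto intro: val_ring_closed)

lemma val_ring_prod: "(\<And>i. i \<in> I \<Longrightarrow> f i \<in> valuation_ring v) \<Longrightarrow> prod f I \<in> valuation_ring v"
  by (induction I rule: infinite_finite_induct) (auto intro: val_ring_closed)

lemma uniformizer_in_val_ring: "uniformizer v \<pi> \<Longrightarrow> \<pi> \<in> valuation_ring v"
  by (simp add: uniformizer_def valuation_ring_def val_ge_def)

text \<open>Valuations become divisibility by powers of \<pi>, the form in which they can be carried
  over to L.\<close>

lemma val_ge_iff_uniformizer_power:
  assumes "uniformizer v \<pi>"
  shows "val_ge v (int n) x \<longleftrightarrow> (\<exists>y\<in>valuation_ring v. x = \<pi> ^ n * y)"
proof
  have \<pi>: "\<pi> \<noteq> 0" "v (\<pi> ^ n) = int n" using assms val_power by (auto simp: uniformizer_def)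
  show "\<exists>y\<in>valuation_ring v. x = \<pi> ^ n * y" if "val_ge v (int n) x"
    using that \<pi> val_divide[of x "\<pi> ^ n"]
    by (intro bexI[of _ "x / \<pi> ^ n"]) (auto simp: valuation_ring_def val_ge_def)
  show "val_ge v (int n) x" if "\<exists>y\<in>valuation_ring v. x = \<pi> ^ n * y"
  proof -
    have "val_ge v (int n) (\<pi> ^ n)" using \<pi> by (simp add: val_ge_def)
    then show ?thesis using that val_ge_mult[of "int n" "\<pi> ^ n" 0] by (auto simp: valuation_ring_def)
  qed
qed

end

section \<open>Modules over the valuation ring of K inside L\<close>

locale embedded_complete_field = complete_discretely_valued_field v
  for v :: "'k::field_char_0 \<Rightarrow> int" +
  fixes emb :: "'k \<Rightarrow> 'l::field"
  assumes emb_hom: "emb \<in> ring_hom ring_of_type_algebra ring_of_type_algebra"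
begin

lemma emb_1 [simp]: "emb 1 = 1"
  and emb_add [simp]: "emb (x + y) = emb x + emb y"
  and emb_mult [simp]: "emb (x * y) = emb x * emb y"
  using emb_hom by (auto simp: ring_hom_def ring_of_type_algebra_def)

lemma emb_0 [simp]: "emb 0 = 0"
  using emb_add[of 0 0] by (metis add_0 add_right_imp_eq)

lemma emb_minus [simp]: "emb (- x) = - emb x"
  using emb_add[of "- x" x] by (simp add: eq_neg_iff_add_eq_0)

lemma emb_diff [simp]: "emb (x - y) = emb x - emb y"
  using emb_add[of x "- y"] by simp

lemma emb_eq_0_iff [simp]: "emb x = 0 \<longleftrightarrow> x = 0"
proof
  assume "emb x = 0"
  then show "x = 0" using emb_mult[of x "inverse x"] by (cases "x = 0") auto
qed simp

lemma emb_inverse [simp]: "emb (inverse x) = inverse (emb x)"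
  using emb_mult[of x "inverse x"] by (cases "x = 0") (auto simp: field_simps)

lemma emb_divide [simp]: "emb (x / y) = emb x / emb y"
  by (simp add: divide_inverse)

lemma emb_power [simp]: "emb (x ^ n) = emb x ^ n"
  by (induction n) auto

lemma emb_of_nat [simp]: "emb (of_nat n) = of_nat n"
  by (induction n) auto

lemma emb_numeral [simp]: "emb (numeral n) = numeral n"
  using emb_of_nat[of "numeral n"] by simp

lemma emb_sum: "emb (sum f I) = (\<Sum>i\<in>I. emb (f i))"
  by (induction I rule: infinite_finite_induct) auto

lemma emb_prod: "emb (prod f I) = (\<Prod>i\<in>I. emb (f i))"
  by (induction I rule: infinite_finite_induct) auto

lemma of_nat_eq_0_iff_emb: "(of_nat n :: 'l) = 0 \<longleftrightarrow> n = 0"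
  using emb_eq_0_iff[of "of_nat n"] by simp

text \<open>For finite \<open>S\<close>, the submodule of L generated by \<open>S\<close> over the
  valuation ring of K. The coefficients need not be unique.\<close>

definition ospan :: "'l set \<Rightarrow> 'l set" where
  "ospan S = {\<Sum>s\<in>S. emb (c s) * s | c. \<forall>s. c s \<in> valuation_ring v}"

lemma ospan_memI: "(\<And>s. c s \<in> valuation_ring v) \<Longrightarrow> (\<Sum>s\<in>S. emb (c s) * s) \<in> ospan S"
  unfolding ospan_def by blast

lemma ospan_memE:
  assumes "x \<in> ospan S"
  obtains c where "x = (\<Sum>s\<in>S. emb (c s) * s)" "\<And>s. c s \<in> valuation_ring v"
  using assms unfolding ospan_def by blast

lemma ospan_empty: "x \<in> ospan {} \<Longrightarrow> x = 0"
  unfolding ospan_def by simp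

lemma ospan_0: "0 \<in> ospan S"
  unfolding ospan_def by (rule CollectI, rule exI[of _ "\<lambda>_. 0"]) (simp add: val_ring_closed)

lemma ospan_add: "x \<in> ospan S \<Longrightarrow> y \<in> ospan S \<Longrightarrow> x + y \<in> ospan S"
proof -
  assume "x \<in> ospan S" "y \<in> ospan S"
  then obtain c d where "x = (\<Sum>s\<in>S. emb (c s) * s)" "y = (\<Sum>s\<in>S. emb (d s) * s)"
    "\<forall>s. c s \<in> valuation_ring v" "\<forall>s. d s \<in> valuation_ring v" unfolding ospan_def by auto
  then show ?thesis unfolding ospan_def
    by (intro CollectI exI[of _ "\<lambda>s. c s + d s"]) (auto simp: sum.distrib distrib_right val_ring_closed)
qed

lemma ospan_scale: "a \<in> valuation_ring v \<Longrightarrow> x \<in> ospan S \<Longrightarrow> emb a * x \<in> ospan S"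
proof -
  assume "a \<in> valuation_ring v" "x \<in> ospan S"
  then obtain c where "x = (\<Sum>s\<in>S. emb (c s) * s)" "\<forall>s. c s \<in> valuation_ring v" unfolding ospan_def by auto
  then show ?thesis unfolding ospan_def using \<open>a \<in> _\<close>
    by (intro CollectI exI[of _ "\<lambda>s. a * c s"]) (auto simp: sum_distrib_left mult.assoc val_ring_closed)
qed

lemma ospan_base: "finite S \<Longrightarrow> s \<in> S \<Longrightarrow> s \<in> ospan S"
proof -
  assume "finite S" "s \<in> S"
  then have "(\<Sum>t\<in>S. emb (if t = s then 1 else 0) * t) = s"
    by (subst sum.remove[of S s]) (auto intro!: sum.neutral)
  then show ?thesis unfolding ospan_def
    by (intro CollectI exI[of _ "\<lambda>t. if t = s then 1 else 0"]) (auto simp: val_ring_closed)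
qed

lemma ospan_sum: "(\<And>i. i \<in> I \<Longrightarrow> f i \<in> ospan S) \<Longrightarrow> sum f I \<in> ospan S"
  by (induction I rule: infinite_finite_induct) (auto intro: ospan_0 ospan_add)

lemma ospan_induct [consumes 1, case_names zero add base]:
  assumes "x \<in> ospan S" "P 0" "\<And>x y. P x \<Longrightarrow> P y \<Longrightarrow> P (x + y)"
    "\<And>a s. s \<in> S \<Longrightarrow> a \<in> valuation_ring v \<Longrightarrow> P (emb a * s)"
  shows "P x"
proof -
  obtain c where x: "x = (\<Sum>s\<in>S. emb (c s) * s)" "\<forall>s. c s \<in> valuation_ring v"
    using assms(1) unfolding ospan_def by auto
  have "P (\<Sum>s\<in>T. emb (c s) * s)" if "T \<subseteq> S" for T
    using that by (induction T rule: infinite_finite_induct) (use assms x in auto)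
  then show ?thesis using x by simp
qed

lemma ospan_minimal: "S \<subseteq> ospan T \<Longrightarrow> ospan S \<subseteq> ospan T"
proof
  fix x assume "x \<in> ospan S" "S \<subseteq> ospan T"
  then show "x \<in> ospan T"
    by (induction rule: ospan_induct) (auto intro: ospan_0 ospan_add ospan_scale)
qed

text \<open>
  A smallest generating set is independent: in a relation, an element whose coefficient has least
  valuation lies in the span of the others.
\<close>

lemma ospan_independent_generators:
  assumes "finite S"
  obtains G where "finite G" "ospan G = ospan S"
    "\<And>c. (\<Sum>g\<in>G. emb (c g) * g) = 0 \<Longrightarrow> \<forall>g\<in>G. c g = 0"
proof -
  obtain G where G: "finite G" "ospan G = ospan S"
    and min: "\<And>H. finite H \<Longrightarrow> ospan H = ospan S \<Longrightarrow> card G \<le> card H"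
    using ex_has_least_nat[of "\<lambda>G. finite G \<and> ospan G = ospan S" S card] assms by blast
  have "\<forall>g\<in>G. c g = 0" if c: "(\<Sum>g\<in>G. emb (c g) * g) = 0" for c
  proof (rule ccontr)
    assume "\<not> (\<forall>g\<in>G. c g = 0)"
    then have ne: "{g\<in>G. c g \<noteq> 0} \<noteq> {}" "finite {g\<in>G. c g \<noteq> 0}" using G by auto
    define h where "h = arg_min_on (\<lambda>g. v (c g)) {g\<in>G. c g \<noteq> 0}"
    have h: "h \<in> G" "c h \<noteq> 0" using arg_min_if_finite(1)[OF ne(2,1)] by (auto simp: h_def)
    have hmin: "v (c h) \<le> v (c g)" if "g \<in> G" "c g \<noteq> 0" for g
      using arg_min_least[OF ne(2,1), of g "\<lambda>g. v (c g)"] that by (auto simp: h_def)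
    have "emb (c h) * h = - (\<Sum>g\<in>G - {h}. emb (c g) * g)"
      using c sum.remove[OF G(1) h(1), of "\<lambda>g. emb (c g) * g"] by (simp add: eq_neg_iff_add_eq_0)
    also have "\<dots> = emb (c h) * (\<Sum>g\<in>G - {h}. emb (- (c g / c h)) * g)"
      using h by (simp add: sum_distrib_left sum_negf)
    finally have "h = (\<Sum>g\<in>G - {h}. emb (- (c g / c h)) * g)" using h by simp
    moreover have "- (c g / c h) \<in> valuation_ring v" if "g \<in> G" for g
      using hmin[OF that] h by (auto simp: valuation_ring_def val_ge_def val_minus val_divide)
    ultimately have "h \<in> ospan (G - {h})"
      using G(1) by (metis (no_types, lifting) DiffE finite_Diff ospan_base ospan_scale ospan_sum)
    then have "ospan G \<subseteq> ospan (G - {h})" using G(1) by (intro ospan_minimal) (auto intro: ospan_base)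
    moreover have "ospan (G - {h}) \<subseteq> ospan G" using G(1) by (intro ospan_minimal) (auto intro: ospan_base)
    ultimately have "card G \<le> card (G - {h})" using G by (intro min) auto
    then show False using G(1) h(1) by (metis card_Diff1_less not_less)
  qed
  then show ?thesis using that G by blast
qed

end

text \<open>The span of \<open>S\<close> is a subring of L that is finitely generated as a module
  over the valuation ring of K. It stands in for the valuation ring of L, with \<rho> in the place
  of a uniformizer.\<close>

locale finite_order = embedded_complete_field v emb
  for v :: "'k::field_char_0 \<Rightarrow> int" and emb :: "'k \<Rightarrow> 'l::field" +
  fixes S :: "'l set" and \<pi> :: 'k and \<rho> :: 'l and p :: nat
  assumes finite_S: "finite S"
    and span_1: "1 \<in> ospan S"
    and span_mult: "\<And>x y. x \<in> ospan S \<Longrightarrow> y \<in> ospan S \<Longrightarrow> x * y \<in> ospan S"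
    and unif: "uniformizer v \<pi>"
    and rho: "\<rho> ^ p = emb \<pi>" "\<rho> \<in> ospan S" "p > 0"
begin

abbreviation "R \<equiv> ospan S"

lemma R_0: "0 \<in> R" and R_1: "1 \<in> R"
  and R_add: "x \<in> R \<Longrightarrow> y \<in> R \<Longrightarrow> x + y \<in> R"
  and R_mult: "x \<in> R \<Longrightarrow> y \<in> R \<Longrightarrow> x * y \<in> R"
  and R_sum: "(\<And>i. i \<in> I \<Longrightarrow> f i \<in> R) \<Longrightarrow> sum f I \<in> R"
  by (fact ospan_0 span_1 ospan_add span_mult ospan_sum)+

lemma R_emb: "a \<in> valuation_ring v \<Longrightarrow> emb a \<in> R"
  using ospan_scale[OF _ R_1, of a] by simp

lemma R_minus: "x \<in> R \<Longrightarrow> - x \<in> R"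
  using R_mult[OF R_emb[of "- 1"]] by (simp add: val_ring_closed)

lemma R_diff: "x \<in> R \<Longrightarrow> y \<in> R \<Longrightarrow> x - y \<in> R"
  using R_add[OF _ R_minus, of x y] by simp

lemma R_power: "x \<in> R \<Longrightarrow> x ^ n \<in> R"
  by (induction n) (auto intro: R_1 R_mult)

lemma R_of_nat: "of_nat n \<in> R"
  using R_emb[OF val_ring_of_nat[of n]] by simp

lemma R_numeral: "numeral n \<in> R"
  using R_of_nat[of "numeral n"] by simp

lemmas R_intros = R_0 R_1 R_add R_mult R_sum R_minus R_diff R_power R_of_nat R_numeral rho(2)

lemma \<rho>_nz: "\<rho> \<noteq> 0" and R_emb_\<pi>: "emb \<pi> \<in> R"
proof -
  have n: "\<pi> \<noteq> 0" using unif by (simp add: uniformizer_def)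
  show "\<rho> \<noteq> 0" using n rho(1,3) by (metis emb_eq_0_iff power_eq_0_iff)
  show "emb \<pi> \<in> R" using unif by (intro R_emb uniformizer_in_val_ring)
qed

text \<open>Coefficients with respect to independent generators are unique: if \<pi> w = 1, then g =
  \<pi> (g w) for a generator g, and comparing the coefficients at g would make \<pi> a unit of the
  valuation ring of K.\<close>

lemma uniformizer_not_unit: "w \<in> R \<Longrightarrow> emb \<pi> * w \<noteq> 1"
proof
  assume w: "w \<in> R" "emb \<pi> * w = 1"
  obtain G where G: "finite G" "ospan G = R"
    and ind: "\<And>c. (\<Sum>g\<in>G. emb (c g) * g) = 0 \<Longrightarrow> \<forall>g\<in>G. c g = 0"
    using ospan_independent_generators[OF finite_S] by blast
  have "G \<noteq> {}" using G(2) R_1 ospan_empty by fastforce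
  then obtain g where g: "g \<in> G" by blast
  have "g * w \<in> ospan G" using g G w R_mult ospan_base by blast
  then obtain c where c: "g * w = (\<Sum>h\<in>G. emb (c h) * h)" "\<forall>h. c h \<in> valuation_ring v"
    unfolding ospan_def by auto
  let ?d = "\<lambda>h. \<pi> * c h - (if h = g then 1 else 0)"
  have "(\<Sum>h\<in>G. emb (?d h) * h) = emb \<pi> * (g * w) - (\<Sum>h\<in>G. emb (if h = g then 1 else 0) * h)"
    by (simp only: emb_diff emb_mult left_diff_distrib sum_subtractf c(1) sum_distrib_left mult.assoc)
  also have "(\<Sum>h\<in>G. emb (if h = g then 1 else 0) * h) = g"
    using G g by (subst sum.remove[of G g]) (auto intro!: sum.neutral)
  also have "emb \<pi> * (g * w) = g" using w by (metis mult.left_commute mult.right_neutral)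
  finally have "(\<Sum>h\<in>G. emb (?d h) * h) = 0" by simp
  then have "?d g = 0" using ind[of ?d] g by blast
  then have "\<pi> * c g = 1" by simp
  then have "v \<pi> + v (c g) = 0" using val_mult[of \<pi> "c g"] val_one by (metis mult_zero_left mult_zero_right zero_neq_one)
  moreover have "c g \<noteq> 0" using \<open>\<pi> * c g = 1\<close> by auto
  ultimately show False using unif c(2)[rule_format, of g] by (simp add: uniformizer_def valuation_ring_def val_ge_def)
qed

text \<open>Krull's intersection theorem, read off from coefficients: with respect to independent
  generators every coefficient of x is divisible by all powers of \<pi>.\<close>

lemma separated:
  assumes x: "x \<in> R" and div: "\<And>n. \<exists>w\<in>R. x = emb \<pi> ^ n * w"
  shows "x = 0"
proof -
  obtain G where G: "finite G" "ospan G = R"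
    and ind: "\<And>c. (\<Sum>g\<in>G. emb (c g) * g) = 0 \<Longrightarrow> \<forall>g\<in>G. c g = 0"
    using ospan_independent_generators[OF finite_S] by blast
  obtain a where a: "x = (\<Sum>g\<in>G. emb (a g) * g)" using x G by (metis ospan_memE)
  have "a g = 0" if g: "g \<in> G" for g
  proof (rule ccontr)
    assume nz: "a g \<noteq> 0"
    \<comment> \<open>One more than the valuation of the coefficient; if that valuation is negative,
      \<open>nat\<close> gives 0, which still exceeds it.\<close>
    define n where "n = nat (v (a g) + 1)"
    obtain w where "w \<in> R" "x = emb \<pi> ^ n * w" using div by blast
    then obtain b where b: "x = emb \<pi> ^ n * (\<Sum>g\<in>G. emb (b g) * g)" "\<forall>s. b s \<in> valuation_ring v"
      using G(2) by (metis ospan_memE)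
    have "(\<Sum>g\<in>G. emb (a g - \<pi> ^ n * b g) * g) = 0"
      using a b(1) by (simp add: left_diff_distrib sum_subtractf sum_distrib_left mult.assoc)
    then have "a g = \<pi> ^ n * b g" using ind g by fastforce
    then have "val_ge v (int n) (a g)" using val_ge_iff_uniformizer_power[OF unif] b(2) by blast
    then show False using nz by (simp add: val_ge_def n_def split: if_splits)
  qed
  then show ?thesis using a by simp
qed

text \<open>Coefficients are chosen for z 0 and for each increment, not for each z n. Their partial
  sums are then Cauchy although \<open>S\<close> may be dependent, and the limit is taken
  coefficient by coefficient in K.\<close>

lemma complete_R:
  assumes z: "\<And>n. z n \<in> R" and step: "\<And>n. \<exists>w\<in>R. z (Suc n) - z n = emb \<pi> ^ n * w"
  shows "\<exists>l\<in>R. \<forall>n. \<exists>w\<in>R. l - z n = emb \<pi> ^ n * w"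
proof -
  obtain c0 where c0: "z 0 = (\<Sum>s\<in>S. emb (c0 s) * s)" "\<And>s. c0 s \<in> valuation_ring v"
    using z[of 0] by (auto simp: ospan_def)
  have "\<exists>d. (\<forall>s. d s \<in> valuation_ring v) \<and> z (Suc n) - z n = emb \<pi> ^ n * (\<Sum>s\<in>S. emb (d s) * s)" for n
    using step[of n] by (auto simp: ospan_def)
  then obtain d where d: "\<And>n s. d n s \<in> valuation_ring v"
    "\<And>n. z (Suc n) - z n = emb \<pi> ^ n * (\<Sum>s\<in>S. emb (d n s) * s)" by metis
  define c where "c n s = c0 s + (\<Sum>k<n. \<pi> ^ k * d k s)" for n s
  have zc: "z n = (\<Sum>s\<in>S. emb (c n s) * s)" for n
  proof (induction n)
    case (Suc n)
    have "z (Suc n) = z n + emb \<pi> ^ n * (\<Sum>s\<in>S. emb (d n s) * s)" using d(2)[of n] by (simp add: algebra_simps)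
    then show ?case using Suc by (simp add: c_def sum.distrib distrib_right sum_distrib_left mult.assoc add.assoc)
  qed (simp add: c0 c_def)
  have c_diff: "val_ge v (int n) (c m s - c n s)" if "n \<le> m" for m n s
    using that
  proof (induction m rule: dec_induct)
    case (step m)
    have "val_ge v (int m) (\<pi> ^ m * d m s)" using val_ge_iff_uniformizer_power[OF unif] d(1) by blast
    then have "val_ge v (int n) (\<pi> ^ m * d m s)" by (rule val_ge_mono) (use step in simp)
    then have "val_ge v (int n) ((c m s - c n s) + \<pi> ^ m * d m s)" using step by (intro val_ge_add) auto
    then show ?case by (simp add: c_def algebra_simps)
  qed simp
  have "\<exists>l. \<forall>n. val_ge v (int n) (l - c n s)" for s
  proof -
    have "val_Cauchy v (\<lambda>n. c n s)"
      unfolding val_Cauchy_def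
    proof (intro allI exI impI)
      fix N m n assume "nat N \<le> m" "nat N \<le> n"
      then have "val_ge v (int (nat N)) ((c m s - c (nat N) s) - (c n s - c (nat N) s))"
        by (intro val_ge_diff c_diff)
      then show "val_ge v N (c m s - c n s)" by (auto elim: val_ge_mono)
    qed
    then obtain l where l: "val_tendsto v (\<lambda>n. c n s) l" using complete by blast
    have "val_ge v (int n) (l - c n s)" for n
    proof -
      obtain M where M: "\<And>m. m \<ge> M \<Longrightarrow> val_ge v (int n) (c m s - l)" using l unfolding val_tendsto_def by blast
      have "val_ge v (int n) ((c (max M n) s - c n s) - (c (max M n) s - l))"
        by (intro val_ge_diff c_diff M) auto
      then show ?thesis by simp
    qed
    then show ?thesis by blast
  qed
  then obtain l where l: "\<And>s n. val_ge v (int n) (l s - c n s)" by metis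
  have "\<exists>w\<in>valuation_ring v. l s - c n s = \<pi> ^ n * w" for s n
    using l[of n s] val_ge_iff_uniformizer_power[OF unif] by blast
  then obtain w where w: "\<And>s n. w s n \<in> valuation_ring v" "\<And>s n. l s - c n s = \<pi> ^ n * w s n" by metis
  have lO: "l s \<in> valuation_ring v" for s
  proof -
    have "l s = c0 s + w s 0" using w(2)[of s 0] by (simp add: c_def algebra_simps)
    then show ?thesis using w(1) c0(2) by (simp add: val_ring_closed)
  qed
  have "(\<Sum>s\<in>S. emb (l s) * s) - z n = emb \<pi> ^ n * (\<Sum>s\<in>S. emb (w s n) * s)" for n
  proof -
    have "(\<Sum>s\<in>S. emb (l s) * s) - z n = (\<Sum>s\<in>S. emb (l s - c n s) * s)"
      unfolding zc by (simp add: left_diff_distrib sum_subtractf)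
    then show ?thesis unfolding w(2) by (simp add: sum_distrib_left mult.assoc)
  qed
  moreover have "(\<Sum>s\<in>S. emb (w s n) * s) \<in> R" "(\<Sum>s\<in>S. emb (l s) * s) \<in> R" for n
    by (intro ospan_memI w lO)+
  ultimately show ?thesis by blast
qed

text \<open>The contraction principle, applied to the iterates of 0. The contraction ratio is
  \<rho>, while completeness and separatedness are known for \<pi> = \<rho>^p; therefore the
  subsequence of indices divisible by \<open>p\<close> is used.\<close>

lemma fixed_point:
  assumes F: "\<And>a. a \<in> R \<Longrightarrow> F a \<in> R"
    and contr: "\<And>a b. a \<in> R \<Longrightarrow> b \<in> R \<Longrightarrow> \<exists>w\<in>R. F a - F b = \<rho> * (a - b) * w"
  shows "\<exists>z\<in>R. F z = z"
proof -
  define u where "u n = (F ^^ n) 0" for n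
  have uR: "u n \<in> R" for n by (induction n) (auto simp: u_def R_0 F)
  have u_step: "\<exists>w\<in>R. u (Suc n) - u n = \<rho> ^ n * w" for n
  proof (induction n)
    case 0
    then show ?case using uR by (intro bexI[of _ "u 1 - u 0"]) (auto intro: R_diff)
  next
    case (Suc n)
    then obtain w where w: "w \<in> R" "u (Suc n) - u n = \<rho> ^ n * w" by blast
    obtain w' where w': "w' \<in> R" "F (u (Suc n)) - F (u n) = \<rho> * (u (Suc n) - u n) * w'"
      using contr[OF uR uR] by blast
    then have "u (Suc (Suc n)) - u (Suc n) = \<rho> * (\<rho> ^ n * w) * w'"
      unfolding w(2)[symmetric] by (simp add: u_def)
    then have "u (Suc (Suc n)) - u (Suc n) = \<rho> ^ Suc n * (w * w')" by (simp add: mult_ac)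
    then show ?case using w w' by (blast intro: R_mult)
  qed
  have u_add: "\<exists>w\<in>R. u (n + k) - u n = \<rho> ^ n * w" for n k
  proof (induction k)
    case (Suc k)
    then obtain w w' where w: "w \<in> R" "u (n + k) - u n = \<rho> ^ n * w" "w' \<in> R"
      "u (Suc (n + k)) - u (n + k) = \<rho> ^ (n + k) * w'" using u_step[of "n + k"] by blast
    then have "u (n + Suc k) - u n = \<rho> ^ n * (w + \<rho> ^ k * w')"
      by (simp add: power_add algebra_simps)
    then show ?case using w by (blast intro: R_intros)
  qed (use R_0 in auto)
  have pw: "\<rho> ^ (p * n) = emb \<pi> ^ n" for n by (simp add: power_mult rho)
  have "\<exists>z\<in>R. \<forall>n. \<exists>w\<in>R. z - u (p * n) = emb \<pi> ^ n * w"
  proof (rule complete_R)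
    show "\<exists>w\<in>R. u (p * Suc n) - u (p * n) = emb \<pi> ^ n * w" for n
      using u_add[of "p * n" p] by (simp add: pw add.commute)
  qed (fact uR)
  then obtain z where z: "z \<in> R" "\<And>n. \<exists>w\<in>R. z - u (p * n) = emb \<pi> ^ n * w" by blast
  have "F z - z = 0"
  proof (rule separated)
    fix n
    obtain w where w: "w \<in> R" "z - u (p * n) = emb \<pi> ^ n * w" using z by blast
    obtain w' where w': "w' \<in> R" "u (Suc (p * n)) - u (p * n) = emb \<pi> ^ n * w'" using u_step[of "p * n"] pw by auto
    obtain y where y: "y \<in> R" "F z - F (u (p * n)) = \<rho> * (z - u (p * n)) * y" using contr[OF z(1) uR] by blast
    have "F z - z = (F z - F (u (p * n))) + (u (Suc (p * n)) - u (p * n)) - (z - u (p * n))"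
      by (simp add: u_def)
    also have "\<dots> = \<rho> * (emb \<pi> ^ n * w) * y + emb \<pi> ^ n * w' - emb \<pi> ^ n * w"
      by (simp only: y(2) w(2) w'(2))
    also have "\<dots> = emb \<pi> ^ n * (\<rho> * w * y + w' - w)" by (simp add: algebra_simps)
    finally show "\<exists>w\<in>R. F z - z = emb \<pi> ^ n * w" using w w' y by (blast intro: R_intros)
  qed (use z F R_diff in auto)
  then show ?thesis using z by auto
qed

text \<open>The inverse is the fixed point of w -> 1 - \<rho> t w, in place of a geometric
  series.\<close>

lemma one_plus_unit:
  assumes "t \<in> R"
  shows "\<exists>w\<in>R. (1 + \<rho> * t) * w = 1"
proof -
  have "\<exists>w\<in>R. (1 - \<rho> * t * w) = w"
  proof (rule fixed_point)
    fix a b assume "a \<in> R" "b \<in> R"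
    show "\<exists>w\<in>R. (1 - \<rho> * t * a) - (1 - \<rho> * t * b) = \<rho> * (a - b) * w"
      using assms by (intro bexI[of _ "- t"]) (auto intro: R_intros simp: algebra_simps)
  qed (use assms in \<open>auto intro!: R_intros\<close>)
  then show ?thesis by (auto simp: algebra_simps)
qed

end

text \<open>The facts about a pseudo-perfect extension on which the symbol computations rest, kept
  apart from their proof through \<open>p\<close>-bases. As the image of \<pi> is \<rho>^p,
  \<open>reduced\<close> says that divisibility by \<rho> is detected on \<open>p\<close>-th
  powers.\<close>

locale frobenius_order = finite_order v emb S \<pi> \<rho> p
  for v :: "'k::field_char_0 \<Rightarrow> int" and emb :: "'k \<Rightarrow> 'l::field"
    and S :: "'l set" and \<pi> :: 'k and \<rho> :: 'l and p :: nat +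
  assumes prime_p: "Factorial_Ring.prime p"
    and val_p: "val_ge v 1 (of_nat p)"
    and frobenius_into: "\<And>w. w \<in> R \<Longrightarrow> \<exists>c\<in>valuation_ring v. \<exists>u\<in>R. w ^ p = emb c + of_nat p * u"
    and frobenius_onto: "\<And>a. a \<in> valuation_ring v \<Longrightarrow> \<exists>s\<in>R. \<exists>u\<in>R. emb a = s ^ p + of_nat p * u"
    and reduced: "\<And>z w. z \<in> R \<Longrightarrow> w \<in> R \<Longrightarrow> z ^ p = emb \<pi> * w \<Longrightarrow> \<exists>u\<in>R. z = \<rho> * u"
begin

lemma emb_pi_rho: "\<exists>q\<in>R. emb \<pi> = \<rho> * q"
  using rho by (intro bexI[of _ "\<rho> ^ (p - 1)"] R_intros) (simp flip: power_Suc)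

lemma p_pi: "\<exists>q\<in>R. of_nat p = emb \<pi> * q"
proof -
  obtain q where "q \<in> valuation_ring v" "of_nat p = \<pi> * q"
    using val_p val_ge_iff_uniformizer_power[OF unif, of 1] by auto
  then show ?thesis by (intro bexI[of _ "emb q"]) (auto intro: R_emb simp flip: emb_mult emb_of_nat)
qed

lemma p_rho: "\<exists>q\<in>R. of_nat p = \<rho> * q"
  using p_pi emb_pi_rho by (metis R_mult mult.assoc)

lemma one_plus_rho_nz: "t \<in> R \<Longrightarrow> 1 + \<rho> * t \<noteq> 0"
  using one_plus_unit[of t] by auto

lemma one_plus_p_unit: "t \<in> R \<Longrightarrow> \<exists>w\<in>R. (1 + of_nat p * t) * w = 1"
  using p_rho one_plus_unit by (metis R_mult mult.assoc)

lemma one_plus_p_nz: "t \<in> R \<Longrightarrow> 1 + of_nat p * t \<noteq> 0"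
  using one_plus_p_unit[of t] by auto

lemma p_nz: "(of_nat p :: 'l) \<noteq> 0"
  using of_nat_eq_0_iff_emb[of p] rho(3) by simp

text \<open>Decided by the element c of the valuation ring congruent to z^p modulo \<open>p\<close>:
  if \<pi> divides c, then \<pi> divides z^p and \<open>reduced\<close> applies; otherwise z^p,
  hence z, is a unit.\<close>

lemma local_ring:
  assumes z: "z \<in> R"
  shows "(\<exists>w\<in>R. z = \<rho> * w) \<or> (\<exists>w\<in>R. z * w = 1)"
proof -
  obtain c u where cu: "c \<in> valuation_ring v" "u \<in> R" "z ^ p = emb c + of_nat p * u"
    using frobenius_into[OF z] by blast
  show ?thesis
  proof (cases "val_ge v 1 c")
    case True
    then obtain c' where "c' \<in> valuation_ring v" "c = \<pi> * c'"
      using val_ge_iff_uniformizer_power[OF unif, of 1] by auto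
    moreover obtain q where "q \<in> R" "of_nat p = emb \<pi> * q" using p_pi by blast
    ultimately have "z ^ p = emb \<pi> * (emb c' + q * u)" "emb c' + q * u \<in> R"
      using cu by (auto simp: algebra_simps intro: R_intros R_emb)
    then show ?thesis using reduced[OF z] by blast
  next
    case False
    then have c: "c \<noteq> 0" "v c = 0" using cu(1) by (auto simp: val_ge_def valuation_ring_def)
    then have i: "inverse c \<in> valuation_ring v" by (simp add: valuation_ring_def val_ge_def val_inverse)
    then obtain w where w: "w \<in> R" "(1 + of_nat p * (emb (inverse c) * u)) * w = 1"
      using one_plus_p_unit cu by (blast intro: R_mult R_emb)
    have "z ^ p = emb c * (1 + of_nat p * (emb (inverse c) * u))" using c cu by (simp add: field_simps)
    then have "z ^ p * (emb (inverse c) * w) = (emb c * emb (inverse c)) * ((1 + of_nat p * (emb (inverse c) * u)) * w)"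
      by (simp only: mult_ac)
    moreover have "emb c * emb (inverse c) = 1" using c by simp
    ultimately have "z ^ p * (emb (inverse c) * w) = 1" by (simp only: w(2) mult_1_right)
    then have "z * (z ^ (p - 1) * (emb (inverse c) * w)) = 1"
      using rho(3) by (simp add: power_eq_if mult.assoc)
    moreover have "z ^ (p - 1) * (emb (inverse c) * w) \<in> R" using z i w by (intro R_intros R_emb)
    ultimately show ?thesis by blast
  qed
qed

text \<open>Powers of \<pi> are \<open>p\<close>-th powers in L, so x may be replaced by a unit a.
  In a = s^p + p u the power s^p is a times an element of 1 + p R, hence a unit of R that can be
  factored out.\<close>

lemma emb_unit_mod_powers:
  assumes x: "x \<noteq> 0"
  shows "\<exists>g w. g \<noteq> 0 \<and> w \<in> R \<and> emb x = g ^ p * (1 + of_nat p * w)"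
proof -
  have unit: "\<exists>g w. g \<noteq> 0 \<and> w \<in> R \<and> emb a = g ^ p * (1 + of_nat p * w)" if a: "a \<noteq> 0" "v a = 0" for a
  proof -
    have aO: "a \<in> valuation_ring v" "inverse a \<in> valuation_ring v"
      using a by (auto simp: valuation_ring_def val_ge_def val_inverse)
    obtain s u where su: "s \<in> R" "u \<in> R" "emb a = s ^ p + of_nat p * u" using frobenius_onto[OF aO(1)] by blast
    let ?t = "- (emb (inverse a) * u)"
    have t: "?t \<in> R" using aO su by (intro R_intros R_emb)
    obtain w where w: "w \<in> R" "(1 + of_nat p * ?t) * w = 1" using one_plus_p_unit[OF t] by blast
    have i1: "emb a * emb (inverse a) = 1" using a by simp
    have "emb a * (1 + of_nat p * ?t) = emb a - of_nat p * u * (emb a * emb (inverse a))"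
      by (simp add: algebra_simps del: emb_inverse)
    then have sp: "s ^ p = emb a * (1 + of_nat p * ?t)" unfolding i1 using su(3) by simp
    have inv: "s ^ p * (emb (inverse a) * w) = 1"
    proof -
      have "s ^ p * (emb (inverse a) * w) = (emb a * emb (inverse a)) * ((1 + of_nat p * ?t) * w)"
        unfolding sp by (simp only: mult_ac)
      then show ?thesis unfolding i1 w(2) by simp
    qed
    have "emb a = s ^ p * (1 + of_nat p * (emb (inverse a) * w * u))"
    proof -
      have "s ^ p * (1 + of_nat p * (emb (inverse a) * w * u)) =
        s ^ p + of_nat p * u * (s ^ p * (emb (inverse a) * w))" by (simp add: algebra_simps)
      then show ?thesis unfolding inv su(3) by simp
    qed
    moreover have "s \<noteq> 0" using inv rho(3) by (auto simp: power_0_left)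
    moreover have "emb (inverse a) * w * u \<in> R" using aO w su by (intro R_intros R_emb)
    ultimately show ?thesis by blast
  qed
  define n where "n = nat \<bar>v x\<bar>"
  have \<pi>: "\<pi> \<noteq> 0" "v (\<pi> ^ n) = int n" "emb (\<pi> ^ n) = (\<rho> ^ n) ^ p"
    using unif val_power by (auto simp: uniformizer_def power_commutes rho(1)[symmetric] simp flip: power_mult)
      (simp add: mult.commute)
  show ?thesis
  proof (cases "v x \<ge> 0")
    case True
    then have "v (x / \<pi> ^ n) = 0" using \<pi> x by (simp add: val_divide n_def)
    then obtain g w where "g \<noteq> 0" "w \<in> R" "emb (x / \<pi> ^ n) = g ^ p * (1 + of_nat p * w)"
      using unit[of "x / \<pi> ^ n"] x \<pi> by auto
    then have "emb (x / \<pi> ^ n) * emb (\<pi> ^ n) = (g * \<rho> ^ n) ^ p * (1 + of_nat p * w)" "g * \<rho> ^ n \<noteq> 0" "w \<in> R"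
      using \<rho>_nz unfolding \<pi>(3) by (auto simp: power_mult_distrib)
    moreover have "emb (x / \<pi> ^ n) * emb (\<pi> ^ n) = emb x"
      by (simp only: emb_mult[symmetric]) (use \<pi>(1) in simp)
    ultimately show ?thesis by metis
  next
    case False
    then have "v (x * \<pi> ^ n) = 0" using \<pi> x by (simp add: val_mult n_def)
    then obtain g w where gw: "g \<noteq> 0" "w \<in> R" "emb (x * \<pi> ^ n) = g ^ p * (1 + of_nat p * w)"
      using unit[of "x * \<pi> ^ n"] x \<pi> by auto
    then have "emb (x * \<pi> ^ n) / emb (\<pi> ^ n) = (g / \<rho> ^ n) ^ p * (1 + of_nat p * w)" "g / \<rho> ^ n \<noteq> 0"
      using \<rho>_nz unfolding \<pi>(3) by (auto simp: power_divide)
    moreover have "emb (x * \<pi> ^ n) / emb (\<pi> ^ n) = emb x" using \<pi> \<rho>_nz by simp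
    ultimately show ?thesis using gw(2) by metis
  qed
qed

section \<open>Powers and symbols of elements near 1\<close>

lemma R_power_diff:
  assumes "a \<in> R" "b \<in> R"
  shows "\<exists>w\<in>R. a ^ k - b ^ k = (a - b) * w"
  using assms by (intro bexI[of _ "\<Sum>i<k. b ^ (k - Suc i) * a ^ i"] power_diff_sumr2 R_intros)

text \<open>
  With \<open>p\<^sup>3 a\<^sub>k = (p choose k) p\<^sup>k\<close>, one has \<open>(1 + p z)\<^sup>p = 1 + p\<^sup>2 (z + p \<Sum> a\<^sub>k z\<^sup>k)\<close>.
\<close>

lemma one_plus_p2_power:
  assumes "p \<noteq> 2" and y: "y \<in> R"
  shows "\<exists>g. g \<noteq> 0 \<and> 1 + of_nat p ^ 2 * y = g ^ p"
proof -
  have p3: "p \<ge> 3" using assms(1) prime_ge_2_nat[OF prime_p] by simp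
  define a where "a k = (p choose k) * p ^ k div p ^ 3" for k
  have a: "(p choose k) * p ^ k = p ^ 3 * a k" if "2 \<le> k" for k
  proof -
    have "p ^ 3 dvd (p choose k) * p ^ k"
    \<comment> \<open>Only k = 2 needs p to be odd, since then p divides the binomial coefficient;
      for k >= 3 the factor p^k suffices.\<close>
    proof (cases "k = 2")
      case True
      then have "p dvd p choose k" using p3 prime_p by (intro dvd_choose_prime) auto
      then have "p * p ^ 2 dvd (p choose k) * p ^ k" using True by (intro mult_dvd_mono) auto
      then show ?thesis by (simp add: power3_eq_cube power2_eq_square mult.assoc)
    next
      case False
      then have "p ^ 3 dvd p ^ k" using that by (intro le_imp_power_dvd) auto
      then show ?thesis by (rule dvd_mult)
    qed
    then show ?thesis by (simp add: a_def)
  qed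
  have expand: "(1 + of_nat p * z) ^ p = 1 + of_nat p ^ 2 * (z + of_nat p * (\<Sum>k\<in>{2..p}. of_nat (a k) * z ^ k))" for z :: 'l
  proof -
    have "(1 + of_nat p * z) ^ p = (\<Sum>k\<le>p. of_nat (p choose k) * (of_nat p * z) ^ k)"
      using binomial_ring[of "of_nat p * z" 1 p] by (simp add: add.commute)
    also have "{..p} = {0,1} \<union> {2..p}" using p3 by auto
    also have "(\<Sum>k\<in>{0,1} \<union> {2..p}. of_nat (p choose k) * (of_nat p * z) ^ k) =
      1 + of_nat p * (of_nat p * z) + (\<Sum>k\<in>{2..p}. of_nat (p choose k) * (of_nat p * z) ^ k)"
      by (subst sum.union_disjoint) auto
    also have "(\<Sum>k\<in>{2..p}. of_nat (p choose k) * (of_nat p * z) ^ k) =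
      (\<Sum>k\<in>{2..p}. of_nat p ^ 3 * (of_nat (a k) * z ^ k))"
    proof (rule sum.cong)
      fix k assume "k \<in> {2..p}"
      then have "of_nat ((p choose k) * p ^ k) = (of_nat (p ^ 3 * a k) :: 'l)" using a by simp
      then have "of_nat (p choose k) * of_nat p ^ k * z ^ k = of_nat p ^ 3 * of_nat (a k) * z ^ k" by simp
      then show "of_nat (p choose k) * (of_nat p * z) ^ k = of_nat p ^ 3 * (of_nat (a k) * z ^ k)"
        by (simp add: power_mult_distrib mult.assoc)
    qed simp
    finally show ?thesis
      by (simp add: sum_distrib_left power2_eq_square power3_eq_cube distrib_left mult.assoc)
  qed
  obtain q where q: "q \<in> R" "of_nat p = \<rho> * q" using p_rho by blast
  \<comment> \<open>The bracket in \<open>expand\<close> is to equal y. The factor \<open>p\<close>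
    before the sum is divisible by \<rho> and gives the contraction ratio.\<close>
  have "\<exists>z\<in>R. y - of_nat p * (\<Sum>k\<in>{2..p}. of_nat (a k) * z ^ k) = z"
  proof (rule fixed_point)
    fix s t assume st: "s \<in> R" "t \<in> R"
    obtain w where w: "\<And>k. w k \<in> R" "\<And>k. s ^ k - t ^ k = (s - t) * w k"
      using R_power_diff[OF st] by metis
    have "(\<Sum>k\<in>{2..p}. of_nat (a k) * s ^ k) - (\<Sum>k\<in>{2..p}. of_nat (a k) * t ^ k)
      = (\<Sum>k\<in>{2..p}. of_nat (a k) * ((s - t) * w k))"
      unfolding sum_subtractf[symmetric] w(2)[symmetric] by (simp add: right_diff_distrib)
    also have "\<dots> = (s - t) * (\<Sum>k\<in>{2..p}. of_nat (a k) * w k)"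
      by (simp add: sum_distrib_left mult_ac)
    finally have d: "(\<Sum>k\<in>{2..p}. of_nat (a k) * s ^ k) - (\<Sum>k\<in>{2..p}. of_nat (a k) * t ^ k)
      = (s - t) * (\<Sum>k\<in>{2..p}. of_nat (a k) * w k)" .
    have "(y - of_nat p * (\<Sum>k\<in>{2..p}. of_nat (a k) * s ^ k)) - (y - of_nat p * (\<Sum>k\<in>{2..p}. of_nat (a k) * t ^ k))
      = - of_nat p * ((\<Sum>k\<in>{2..p}. of_nat (a k) * s ^ k) - (\<Sum>k\<in>{2..p}. of_nat (a k) * t ^ k))"
      by (simp add: right_diff_distrib)
    also have "\<dots> = \<rho> * (s - t) * (- q * (\<Sum>k\<in>{2..p}. of_nat (a k) * w k))"
      unfolding d q(2) by (simp add: mult_ac)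
    finally have "(y - of_nat p * (\<Sum>k\<in>{2..p}. of_nat (a k) * s ^ k)) - (y - of_nat p * (\<Sum>k\<in>{2..p}. of_nat (a k) * t ^ k))
      = \<rho> * (s - t) * (- q * (\<Sum>k\<in>{2..p}. of_nat (a k) * w k))" .
    moreover have "- q * (\<Sum>k\<in>{2..p}. of_nat (a k) * w k) \<in> R" using q w(1) by (intro R_intros)
    ultimately show "\<exists>w\<in>R. (y - of_nat p * (\<Sum>k\<in>{2..p}. of_nat (a k) * s ^ k)) - (y - of_nat p * (\<Sum>k\<in>{2..p}. of_nat (a k) * t ^ k))
      = \<rho> * (s - t) * w" by blast
  qed (intro R_intros y)
  then obtain z where z: "z \<in> R" "z + of_nat p * (\<Sum>k\<in>{2..p}. of_nat (a k) * z ^ k) = y" by (auto simp: algebra_simps)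
  then show ?thesis using expand[of z] one_plus_p_nz[of z] by metis
qed

text \<open>(1 + 2 \<rho> z)^2 = 1 + 4 \<rho> (z + \<rho> z^2), and the factor \<rho> before z^2
  makes z + \<rho> z^2 = y solvable by contraction.\<close>

lemma one_plus_4rho_square:
  assumes "p = 2" and y: "y \<in> R"
  shows "\<exists>g. g \<noteq> 0 \<and> 1 + 4 * \<rho> * y = g ^ p"
proof -
  have "\<exists>z\<in>R. y - \<rho> * z ^ 2 = z"
  proof (rule fixed_point)
    fix s t assume st: "s \<in> R" "t \<in> R"
    show "\<exists>w\<in>R. (y - \<rho> * s ^ 2) - (y - \<rho> * t ^ 2) = \<rho> * (s - t) * w"
      using st by (intro bexI[of _ "- (s + t)"] R_intros) (simp_all add: algebra_simps power2_eq_square)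
  qed (intro R_intros y)
  then obtain z where z: "z \<in> R" "y = z + \<rho> * z ^ 2" by (auto simp: algebra_simps)
  have "1 + 4 * \<rho> * y = (1 + \<rho> * (2 * z)) ^ p"
    unfolding z(2) assms(1) by (simp add: algebra_simps power2_eq_square)
  then show ?thesis using one_plus_rho_nz[of "2 * z"] z(1) by (blast intro: R_intros)
qed

text \<open>Here 1 - x y lies in 1 + 4 \<rho> R and is therefore a square.\<close>

lemma pair_eight:
  assumes "symbol_vanishing Z p" "p = 2" "x \<noteq> 1" "y \<noteq> 1" and t: "t \<in> R" "x * y = 4 * \<rho> * t"
  shows "Z (1 - x) (1 - y)"
proof -
  interpret symbol_vanishing Z p by fact
  obtain g where "g \<noteq> 0" "1 + 4 * \<rho> * (- t) = g ^ p" using one_plus_4rho_square[OF assms(2) R_minus[OF t(1)]] by blast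
  then show ?thesis using assms t by (intro one_minus_pair_power[of x y g]) auto
qed

lemma vanishing_odd:
  assumes Z: "symbol_vanishing Z p" "p \<noteq> 2" and a: "a \<in> R" and b: "b \<in> R"
  shows "Z (1 + of_nat p * a) (1 + of_nat p * b)"
proof -
  interpret symbol_vanishing Z p by fact
  obtain g where g: "g \<noteq> 0" "1 + of_nat p ^ 2 * (- (a * b)) = g ^ p"
    using one_plus_p2_power[OF Z(2), of "- (a * b)"] a b by (blast intro: R_intros)
  have "Z (1 - (- (of_nat p * a))) (1 - (- (of_nat p * b)))"
  proof (rule one_minus_pair_power)
    show "1 - - (of_nat p * a) * - (of_nat p * b) = g ^ p"
      using g by (simp add: power2_eq_square algebra_simps)
  qed (use g one_plus_p_nz[OF a] one_plus_p_nz[OF b] in \<open>auto simp: add_eq_0_iff minus_equation_iff\<close>)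
  then show ?thesis by simp
qed

lemma two_rho:
  assumes "p = 2" obtains q where "q \<in> R" "2 = \<rho> * q"
  using p_rho assms by auto

lemma one_minus_four_nz:
  assumes "p = 2" "c \<in> R"
  shows "1 - 4 * c \<noteq> 0"
proof -
  obtain q where q: "q \<in> R" "2 = \<rho> * q" using two_rho assms(1) .
  have "(4::'l) = 2 * 2" by simp
  then have "1 - 4 * c = 1 - (\<rho> * q) * 2 * c" using q(2) by simp
  also have "\<dots> = 1 + \<rho> * (- q * 2 * c)" by (simp add: algebra_simps)
  also have "\<dots> \<noteq> 0" using q assms by (intro one_plus_rho_nz R_intros)
  finally show ?thesis .
qed

text \<open>The two deviations from 1 multiply to an element of 8 R, and 8 lies in 4 \<rho> R
  because \<rho> divides 2.\<close>

lemma pair_four_two: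
  assumes Z: "symbol_vanishing Z p" "p = 2" and c: "c \<in> R" and a: "a \<in> R"
  shows "Z (1 - 4 * c) (1 + 2 * a)"
proof -
  obtain q where q: "q \<in> R" "2 = \<rho> * q" using two_rho Z(2) .
  have "4 * c * (- (2 * a)) = 4 * \<rho> * (- q * c * a)" by (simp add: q(2) algebra_simps)
  moreover have "- q * c * a \<in> R" using q c a by (intro R_intros)
  ultimately have "Z (1 - 4 * c) (1 - - (2 * a))"
    using one_minus_four_nz[OF Z(2) c] one_plus_p_nz[OF a] Z(2)
    by (intro pair_eight[OF Z]) (auto simp: add_eq_0_iff minus_equation_iff)
  then show ?thesis by simp
qed

text \<open>The third entry does the work: \<open>one_minus_pair\<close> for the first two entries
  leaves symbols with an entry P = 1 - 4 a b, and P next to 1 + 2 c is killed by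
  \<open>pair_four_two\<close>, whatever the remaining entry is.\<close>

lemma vanishing_two_degree_three:
  assumes T12: "\<And>c. c \<noteq> 0 \<Longrightarrow> symbol_vanishing (\<lambda>a b. T a b c) p"
    and T23: "\<And>a. a \<noteq> 0 \<Longrightarrow> symbol_vanishing (T a) p"
    and p: "p = 2" and abc: "a \<in> R" "b \<in> R" "c \<in> R"
  shows "T (1 + of_nat p * a) (1 + of_nat p * b) (1 + of_nat p * c)"
proof -
  let ?C = "1 + 2 * c" and ?P = "1 - (- (2 * a)) * (- (2 * b))"
  have P: "?P = 1 - 4 * (a * b)" by simp
  have C: "?C \<noteq> 0" "1 + 2 * a \<noteq> 0" "1 + 2 * b \<noteq> 0" using one_plus_p_nz abc p by auto
  have Pnz: "?P \<noteq> 0" unfolding P using abc by (intro one_minus_four_nz p R_intros)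
  interpret symbol_vanishing "\<lambda>a b. T a b ?C" p by (rule T12[OF C(1)])
  have TP: "T w ?P ?C" if "w \<noteq> 0" for w
    unfolding P using abc by (intro pair_four_two[OF T23[OF that] p] R_intros)
  have "T (1 - (- (2 * a))) (1 - (- (2 * b))) ?C"
  proof (rule one_minus_pair)
    let ?w = "- (2 * a) * (1 - - (2 * b)) / ?P"
    show "T ?P ?w ?C" if "- (2 * a) \<noteq> 0"
    proof -
      have "?w \<noteq> 0" using that C Pnz by simp
      then show ?thesis using TP Pnz by (intro sym[of ?w]) auto
    qed
    show "T (1 - - (2 * a)) ?P ?C" using C by (intro TP) simp
  qed (use C Pnz in \<open>auto simp: add_eq_0_iff minus_equation_iff\<close>)
  then show ?thesis using p by simp
qed

text \<open>Squaring carries the problem from R modulo \<rho> to the residue field of K: modulo 2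
  the squares of x and y are x' and y' in the valuation ring, \<open>form\<close> is solved for
  these by a and b, and s, t are square roots of a, b modulo 2. Then y - N has its square in \<pi>
  R, and \<open>reduced\<close> extracts \<rho>.\<close>

lemma residue_form_lift:
  assumes p: "p = 2"
    and form: "\<And>x y. x \<in> valuation_ring v \<Longrightarrow> y \<in> valuation_ring v \<Longrightarrow>
       \<exists>a\<in>valuation_ring v. \<exists>b\<in>valuation_ring v. val_ge v 1 (y - (a ^ 2 + a * b + x * b ^ 2))"
    and xy: "x \<in> R" "y \<in> R"
  shows "\<exists>s\<in>R. \<exists>t\<in>R. \<exists>w\<in>R. y = s ^ 2 + s * t + x * t ^ 2 + \<rho> * w"
proof -
  obtain x' u where x': "x' \<in> valuation_ring v" "u \<in> R" "x ^ 2 = emb x' + 2 * u"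
    using frobenius_into[OF xy(1)] p by auto
  obtain y' u' where y': "y' \<in> valuation_ring v" "u' \<in> R" "y ^ 2 = emb y' + 2 * u'"
    using frobenius_into[OF xy(2)] p by auto
  obtain a b where ab: "a \<in> valuation_ring v" "b \<in> valuation_ring v" "val_ge v 1 (y' - (a ^ 2 + a * b + x' * b ^ 2))"
    using form[OF x'(1) y'(1)] by blast
  then obtain d where d: "d \<in> valuation_ring v" "y' - (a ^ 2 + a * b + x' * b ^ 2) = \<pi> * d"
    using val_ge_iff_uniformizer_power[OF unif, of 1] by auto
  obtain s m where s: "s \<in> R" "m \<in> R" "emb a = s ^ 2 + 2 * m" using frobenius_onto[OF ab(1)] p by auto
  obtain t n where t: "t \<in> R" "n \<in> R" "emb b = t ^ 2 + 2 * n" using frobenius_onto[OF ab(2)] p by auto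
  obtain q where q: "q \<in> R" "2 = emb \<pi> * q" using p_pi p by auto
  have ey: "emb y' = emb a ^ 2 + emb a * emb b + emb x' * emb b ^ 2 + emb \<pi> * emb d"
    using arg_cong[OF d(2), of emb] by (simp add: algebra_simps)
  have ex: "emb x' = x ^ 2 - 2 * u" using x'(3) by simp
  define N where "N = s ^ 2 + s * t + x * t ^ 2"
  \<comment> \<open>Apart from \<pi> d, all terms in the expansion of (y - N)^2 carry a factor 2; E
    is their sum with this factor taken out.\<close>
  define E where "E = 2 * s ^ 2 * m + 2 * m ^ 2 + s ^ 2 * n + m * t ^ 2 + 2 * m * n
    + x ^ 2 * (2 * t ^ 2 * n + 2 * n ^ 2) - u * (t ^ 2 + 2 * n) ^ 2
    + u' - y * N + N ^ 2 - s ^ 3 * t - s ^ 2 * (x * t ^ 2) - s * t * (x * t ^ 2)"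
  have NR: "N \<in> R" unfolding N_def using xy s t by (intro R_intros)
  have ER: "E \<in> R" unfolding E_def using xy s t x' y' NR by (intro R_intros)
  have "(y - N) ^ 2 = y ^ 2 - 2 * y * N + N ^ 2" by (simp add: power2_eq_square algebra_simps)
  also have "\<dots> = emb \<pi> * emb d + 2 * E"
    unfolding y'(3) ey ex s(3) t(3) E_def N_def by (simp add: power2_eq_square power3_eq_cube algebra_simps)
  also have "\<dots> = emb \<pi> * emb d + (emb \<pi> * q) * E" unfolding q(2)[symmetric] ..
  also have "\<dots> = emb \<pi> * (emb d + q * E)" by (simp add: algebra_simps)
  finally have sq: "(y - N) ^ p = emb \<pi> * (emb d + q * E)" using p by simp
  have "emb d + q * E \<in> R" using d q ER by (intro R_intros R_emb)
  then obtain w where "w \<in> R" "y - N = \<rho> * w" using reduced[OF _ _ sq] xy NR R_diff by blast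
  then have "y = N + \<rho> * w" by (simp add: algebra_simps)
  then show ?thesis using s t \<open>w \<in> R\<close> unfolding N_def by blast
qed

text \<open>With P = 1 - 4 a b, the symbol to kill is that of P with 2 a (1 + 2 b) / (- P). The
  factor 1 + 2 b is settled by \<open>pair_four_two\<close> and - P by \<open>minus_self\<close>.
  The factor 2 a is a unit of R times a square, unless \<rho> divides a, and then P itself is a
  square.\<close>

lemma vanishing_two_degree_two:
  assumes Z: "symbol_vanishing Z p" and p: "p = 2"
    and form: "\<And>x y. x \<in> R \<Longrightarrow> y \<in> R \<Longrightarrow> \<exists>s\<in>R. \<exists>t\<in>R. \<exists>w\<in>R. y = s ^ 2 + s * t + x * t ^ 2 + \<rho> * w"
    and a: "a \<in> R" and b: "b \<in> R"
  shows "Z (1 + of_nat p * a) (1 + of_nat p * b)"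
proof -
  interpret symbol_vanishing Z p by fact
  define c where "c = a * b"
  define P where "P = 1 - 4 * c"
  have cR: "c \<in> R" unfolding c_def using a b by (rule R_mult)
  have Pnz: "P \<noteq> 0" unfolding P_def by (rule one_minus_four_nz[OF p cR])
  have nz: "1 + 2 * a \<noteq> 0" "1 + 2 * b \<noteq> 0" using one_plus_p_nz a b p by auto
  have two: "(2 :: 'l) \<noteq> 0" using p_nz p by simp
  have norm: "Z P (s ^ 2 + s * t + c * t ^ 2)" if N: "s ^ 2 + s * t + c * t ^ 2 \<noteq> 0" for s t
  proof -
    let ?N = "s ^ 2 + s * t + c * t ^ 2" and ?A = "2 * s + t"
    \<comment> \<open>Completing the square: 4 N = A^2 - P t^2 is the norm of A + t sqrt(P).\<close>
    have four: "2 ^ p * ?N = ?A ^ p - P * t ^ p" unfolding p P_def by (simp add: power2_eq_square algebra_simps)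
    have "Z P (?A ^ p - P * t ^ p)"
    \<comment> \<open>If t or A is zero, the value is a square or - P times a square. Otherwise, up
      to the square A^2, it is 1 - P f with a square f, and the Steinberg relation for P f
      applies.\<close>
    proof (cases "t = 0")
      case True
      then have "?A \<noteq> 0" using N two by auto
      then show ?thesis using True Pnz pow_right[of ?A P] p by (simp add: power_0_left)
    next
      case t: False
      show ?thesis
      proof (cases "?A = 0")
        case True
        have "Z P ((- P) * t ^ p)" using Pnz t by (intro mult_right minus_self pow_right) auto
        then show ?thesis using True p by (simp add: power_0_left)
      next
        case A: False
        let ?f = "(t / ?A) ^ p"
        have f: "?f \<noteq> 0" "1 - P * ?f \<noteq> 0"
        proof -
          show "?f \<noteq> 0" using t A by simp
          have "?A ^ p - P * t ^ p \<noteq> 0" unfolding four[symmetric] using two N by simp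
          then show "1 - P * ?f \<noteq> 0" using A by (simp add: power_divide field_simps)
        qed
        have "Z (P * ?f) (1 - P * ?f)" using f Pnz by (intro steinberg) auto
        then have "Z P (1 - P * ?f)" using mult_left_iff[OF Pnz f] pow_left[of "t / ?A" "1 - P * ?f"] t A f by auto
        then have "Z P ((1 - P * ?f) * ?A ^ p)" using Pnz f A by (intro mult_right pow_right) auto
        moreover have "(1 - P * ?f) * ?A ^ p = ?A ^ p - P * t ^ p" using A by (simp add: power_divide field_simps)
        ultimately show ?thesis by simp
      qed
    qed
    then have "Z P (?N * 2 ^ p)" using four by (simp add: mult.commute)
    then show ?thesis using mult_right_iff[of ?N "2 ^ p" P] pow_right[of 2 P] N two Pnz by simp
  qed
  have unit: "Z P y" if y: "y \<in> R" "y' \<in> R" "y * y' = 1" for y y'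
  proof -
    obtain s t w where st: "s \<in> R" "t \<in> R" "w \<in> R" "y = s ^ 2 + s * t + c * t ^ 2 + \<rho> * w"
      using form[OF cR y(1)] by blast
    \<comment> \<open>Replacing y by the value N of the form costs the symbol of P with e. It
      vanishes because 4 c (1 - e) lies in 4 \<rho> R.\<close>
    let ?N = "s ^ 2 + s * t + c * t ^ 2" and ?e = "1 - \<rho> * (w * y')"
    have e: "?e \<noteq> 0" using one_plus_rho_nz[of "- (w * y')"] st y by (auto intro!: R_intros)
    have ynz: "y \<noteq> 0" using y(3) by auto
    have N: "?N = y * ?e"
    proof -
      have "y * ?e = y - \<rho> * w * (y * y')" by (simp add: algebra_simps)
      then show ?thesis unfolding y(3) using st(4) by simp
    qed
    have "4 * c * (\<rho> * (w * y')) = 4 * \<rho> * (c * (w * y'))" by (simp add: mult_ac)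
    moreover have "c * (w * y') \<in> R" using cR st(3) y(2) by (intro R_intros)
    ultimately have "Z (1 - 4 * c) ?e"
      using Pnz e by (intro pair_eight[OF Z p, where t = "c * (w * y')"]) (auto simp: P_def)
    moreover have "Z P (y * ?e)" using norm[of s t] N ynz e by (metis mult_eq_0_iff)
    ultimately show ?thesis using mult_right_iff[of y ?e P] ynz e Pnz P_def by simp
  qed
  have Z2a: "Z P (2 * a)" if a0: "a \<noteq> 0"
  proof (cases "\<exists>w\<in>R. a = \<rho> * w")
    case True
    then obtain w where w: "w \<in> R" "a = \<rho> * w" by blast
    obtain g where "g \<noteq> 0" "1 + 4 * \<rho> * (- (w * b)) = g ^ p"
      using one_plus_4rho_square[OF p, of "- (w * b)"] w b by (blast intro: R_intros)
    moreover have "1 + 4 * \<rho> * (- (w * b)) = P" by (simp add: P_def c_def w(2))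
    ultimately show ?thesis using pow_left[of g "2 * a"] two a0 by simp
  next
    case False
    then obtain a' where a': "a' \<in> R" "a * a' = 1" using local_ring[OF a] by blast
    \<comment> \<open>In K, 2 is a unit h times \<pi>^n, and \<pi>^n becomes the square of \<rho>^n
      in L; so 2 a is the unit h a up to squares.\<close>
    define n where "n = nat (v 2)"
    have vp: "0 \<le> v 2" using val_p p by (auto simp: val_ge_def)
    have \<pi>n: "\<pi> ^ n \<noteq> 0" "v (\<pi> ^ n) = int n" using unif val_power by (auto simp: uniformizer_def)
    define h where "h = 2 / \<pi> ^ n"
    have h: "h \<noteq> 0" "v h = 0" using \<pi>n vp val_divide[of 2 "\<pi> ^ n"] by (auto simp: h_def n_def)
    have hR: "emb h \<in> R" "emb (inverse h) \<in> R"
      using h by (intro R_emb; simp add: valuation_ring_def val_ge_def val_inverse)+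
    have "emb (\<pi> ^ n * h) = emb (of_nat 2)" using \<pi>n by (simp add: h_def)
    then have h2: "(\<rho> ^ n) ^ p * emb h = 2"
      using rho(1) by (simp add: power_commutes flip: power_mult) (simp add: power_mult mult.commute[of n])
    have "(emb h * a) * (emb (inverse h) * a') = (emb h * emb (inverse h)) * (a * a')" by (simp only: mult_ac)
    also have "\<dots> = 1" using h a' by (simp flip: emb_mult)
    finally have "Z P (emb h * a)" using hR a a' by (intro unit[of _ "emb (inverse h) * a'"] R_intros)
    then have "Z P ((emb h * a) * (\<rho> ^ n) ^ p)" using Pnz h a0 \<rho>_nz
      by (intro mult_right[of "emb h * a"] pow_right) auto
    moreover have "(emb h * a) * (\<rho> ^ n) ^ p = 2 * a" using h2 by (metis mult.assoc mult.commute)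
    ultimately show ?thesis by simp
  qed
  have P': "1 - (- (2 * a)) * (- (2 * b)) = P" by (simp add: P_def c_def)
  have "Z (1 - - (2 * a)) (1 - - (2 * b))"
  proof (rule one_minus_pair, goal_cases)
    case 4
    then have a0: "a \<noteq> 0" by auto
    have "Z P (1 + 2 * b)" unfolding P_def by (rule pair_four_two[OF Z p cR b])
    then have "Z P ((2 * a) * (1 + 2 * b) / (- P))"
      using Pnz nz two a0 by (intro divide_right mult_right minus_self Z2a) auto
    then show ?case unfolding P' by simp
  next
    case 5
    show ?case unfolding P' using sym[OF Pnz nz(1) pair_four_two[OF Z p cR a, folded P_def]] by simp
  qed (use nz Pnz P' in \<open>auto simp: add_eq_0_iff minus_equation_iff\<close>)
  then show ?thesis using p by simp
qed

lemma vanishing_on_base: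
  assumes Z: "symbol_vanishing Z p"
    and van: "\<And>a b. a \<in> R \<Longrightarrow> b \<in> R \<Longrightarrow> Z (1 + of_nat p * a) (1 + of_nat p * b)"
    and xy: "x \<noteq> 0" "y \<noteq> 0"
  shows "Z (emb x) (emb y)"
proof -
  interpret symbol_vanishing Z p by fact
  obtain g w where g: "g \<noteq> 0" "w \<in> R" "emb x = g ^ p * (1 + of_nat p * w)" using emb_unit_mod_powers[OF xy(1)] by blast
  obtain h u where h: "h \<noteq> 0" "u \<in> R" "emb y = h ^ p * (1 + of_nat p * u)" using emb_unit_mod_powers[OF xy(2)] by blast
  show ?thesis unfolding g(3) h(3)
    using g h one_plus_p_nz by (intro mult_left mult_right pow_left pow_right van) auto
qed

lemma vanishing_on_base_three:
  assumes T12: "\<And>c. c \<noteq> 0 \<Longrightarrow> symbol_vanishing (\<lambda>a b. T a b c) p"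
    and T23: "\<And>a. a \<noteq> 0 \<Longrightarrow> symbol_vanishing (T a) p"
    and van: "\<And>a b c. a \<in> R \<Longrightarrow> b \<in> R \<Longrightarrow> c \<in> R \<Longrightarrow>
       T (1 + of_nat p * a) (1 + of_nat p * b) (1 + of_nat p * c)"
    and xyz: "x \<noteq> 0" "y \<noteq> 0" "z \<noteq> 0"
  shows "T (emb x) (emb y) (emb z)"
proof -
  obtain g w where g: "g \<noteq> 0" "w \<in> R" "emb z = g ^ p * (1 + of_nat p * w)"
    using emb_unit_mod_powers[OF xyz(3)] by blast
  have 1: "T (emb x) (emb y) (1 + of_nat p * w)"
    by (rule vanishing_on_base[OF T12 van]) (use g xyz one_plus_p_nz in auto)
  interpret symbol_vanishing "T (emb x)" p by (rule T23) (use xyz in simp)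
  show ?thesis unfolding g(3) using 1 g xyz one_plus_p_nz by (intro mult_right pow_right) auto
qed

end

section \<open>Pseudo-perfect extensions\<close>

lemma p_basis_expansion:
  fixes B :: "'r::field set"
  assumes "CHAR('r) = p" "p > 0" "p_basis p B"
  shows "\<exists>c. a = (\<Sum>e\<in>B \<rightarrow>\<^sub>E {..<p}. c e ^ p * p_monomial B e)"
proof -
  interpret vs: vector_space "pscale p :: 'r \<Rightarrow> 'r \<Rightarrow> 'r" by (rule vector_space_pscale[OF assms(1,2)])
  have fin: "finite (B \<rightarrow>\<^sub>E {..<p})" and inj: "inj_on (p_monomial B) (B \<rightarrow>\<^sub>E {..<p})"
    and sp: "vs.span (p_monomial B ` (B \<rightarrow>\<^sub>E {..<p})) = UNIV"
    using assms(3) by (auto simp: p_basis_def intro: finite_PiE)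
  have "a \<in> range (\<lambda>u. \<Sum>m\<in>p_monomial B ` (B \<rightarrow>\<^sub>E {..<p}). pscale p (u m) m)"
    using sp vs.span_finite[OF finite_imageI[OF fin], of "p_monomial B"] by blast
  then obtain u where "a = (\<Sum>m\<in>p_monomial B ` (B \<rightarrow>\<^sub>E {..<p}). pscale p (u m) m)" by blast
  then show ?thesis
    by (intro exI[of _ "\<lambda>e. u (p_monomial B e)"]) (simp add: sum.reindex[OF inj] pscale_def)
qed

lemma p_basis_independent:
  fixes B :: "'r::field set"
  assumes "CHAR('r) = p" "p > 0" "p_basis p B"
    and c: "(\<Sum>e\<in>B \<rightarrow>\<^sub>E {..<p}. c e ^ p * p_monomial B e) = 0" and e: "e \<in> B \<rightarrow>\<^sub>E {..<p}"
  shows "c e = 0"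
proof -
  interpret vs: vector_space "pscale p :: 'r \<Rightarrow> 'r \<Rightarrow> 'r" by (rule vector_space_pscale[OF assms(1,2)])
  have fin: "finite (B \<rightarrow>\<^sub>E {..<p})" and inj: "inj_on (p_monomial B) (B \<rightarrow>\<^sub>E {..<p})"
    and dep: "\<not> vs.dependent (p_monomial B ` (B \<rightarrow>\<^sub>E {..<p}))"
    using assms(3) by (auto simp: p_basis_def intro: finite_PiE)
  define u where "u m = c (inv_into (B \<rightarrow>\<^sub>E {..<p}) (p_monomial B) m)" for m
  have u: "u (p_monomial B e) = c e" if "e \<in> B \<rightarrow>\<^sub>E {..<p}" for e
    using that inj by (simp add: u_def)
  have "(\<Sum>m\<in>p_monomial B ` (B \<rightarrow>\<^sub>E {..<p}). pscale p (u m) m) = 0"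
    using c u by (simp add: sum.reindex[OF inj] pscale_def)
  then have "u (p_monomial B e) = 0"
    using vs.dependent_finite[OF finite_imageI[OF fin], of "p_monomial B"] dep e by blast
  then show ?thesis using u[OF e] by simp
qed

text \<open>The additivity of Frobenius modulo \<open>p\<close>, with the error term kept since R
  has characteristic 0.\<close>

lemma (in finite_order) frobenius_add:
  assumes p: "Factorial_Ring.prime p" and xy: "x \<in> R" "y \<in> R"
  shows "\<exists>u\<in>R. (x + y) ^ p = x ^ p + y ^ p + of_nat p * u"
proof -
  define a where "a k = (p choose k) div p" for k
  have a: "p choose k = p * a k" if "0 < k" "k < p" for k
    using dvd_choose_prime[of k p] that p by (simp add: a_def)
  have "(x + y) ^ p = (\<Sum>k\<le>p. of_nat (p choose k) * x ^ k * y ^ (p - k))" by (rule binomial_ring)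
  also have "{..p} = {0, p} \<union> {0<..<p}" by auto
  also have "(\<Sum>k\<in>{0, p} \<union> {0<..<p}. of_nat (p choose k) * x ^ k * y ^ (p - k))
    = x ^ p + y ^ p + (\<Sum>k\<in>{0<..<p}. of_nat (p choose k) * x ^ k * y ^ (p - k))"
    using rho(3) by (subst sum.union_disjoint) auto
  also have "(\<Sum>k\<in>{0<..<p}. of_nat (p choose k) * x ^ k * y ^ (p - k))
    = of_nat p * (\<Sum>k\<in>{0<..<p}. of_nat (a k) * x ^ k * y ^ (p - k))"
    unfolding sum_distrib_left by (rule sum.cong) (simp_all add: a mult.assoc)
  finally show ?thesis using xy by (blast intro: R_intros)
qed

lemma (in finite_order) frobenius_sum:
  assumes p: "Factorial_Ring.prime p" and f: "\<And>i. i \<in> I \<Longrightarrow> f i \<in> R"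
  shows "\<exists>u\<in>R. (sum f I) ^ p = (\<Sum>i\<in>I. f i ^ p) + of_nat p * u"
  using f
proof (induction I rule: infinite_finite_induct)
  case (insert i I)
  obtain u where u: "u \<in> R" "(sum f I) ^ p = (\<Sum>i\<in>I. f i ^ p) + of_nat p * u" using insert by auto
  obtain u' where u': "u' \<in> R" "(f i + sum f I) ^ p = f i ^ p + (sum f I) ^ p + of_nat p * u'"
    using frobenius_add[OF p, of "f i" "sum f I"] insert by (auto intro: R_intros)
  have "(sum f (insert i I)) ^ p = (\<Sum>i\<in>insert i I. f i ^ p) + of_nat p * (u + u')"
    using insert u u' by (simp add: algebra_simps)
  then show ?case using u u' R_add by blast
qed (use rho(3) R_0 in \<open>auto intro!: bexI[of _ 0]\<close>)

text \<open>Indexing by the residues in \<open>B\<close>, rather than by the elements of the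
  pseudo-basis, lets the monomials over the residue field, over K and over L share their exponent
  functions.\<close>

locale pseudo_perfect = embedded_complete_field v emb
  for v :: "'k::field_char_0 \<Rightarrow> int" and emb :: "'k \<Rightarrow> 'l::field" +
  fixes res :: "'k \<Rightarrow> 'r::field" and p :: nat and B :: "'r set" and lift :: "'r \<Rightarrow> 'k"
    and root :: "'r \<Rightarrow> 'l" and \<pi> :: 'k and \<rho> :: 'l
  assumes res: "residue_map v res" and char: "CHAR('r) = p" and p_pos: "p > 0"
    and basis: "p_basis p B"
    and lift: "\<And>b. b \<in> B \<Longrightarrow> lift b \<in> valuation_ring v" "\<And>b. b \<in> B \<Longrightarrow> res (lift b) = b"
    and root: "\<And>b. b \<in> B \<Longrightarrow> root b ^ p = emb (lift b)"
    and uniformizer: "uniformizer v \<pi>" and root_uniformizer: "\<rho> ^ p = emb \<pi>"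
begin

lemma prime_p: "Factorial_Ring.prime p"
  using prime_CHAR_semidom[where 'a = 'r] char p_pos by simp

lemma res_add: "x \<in> valuation_ring v \<Longrightarrow> y \<in> valuation_ring v \<Longrightarrow> res (x + y) = res x + res y"
  and res_mult: "x \<in> valuation_ring v \<Longrightarrow> y \<in> valuation_ring v \<Longrightarrow> res (x * y) = res x * res y"
  and res_1: "res 1 = 1"
  and res_surj: "\<exists>x\<in>valuation_ring v. res x = a"
  and res_eq_0_iff: "x \<in> valuation_ring v \<Longrightarrow> res x = 0 \<longleftrightarrow> val_ge v 1 x"
proof -
  show "x \<in> valuation_ring v \<Longrightarrow> y \<in> valuation_ring v \<Longrightarrow> res (x + y) = res x + res y"
    "x \<in> valuation_ring v \<Longrightarrow> y \<in> valuation_ring v \<Longrightarrow> res (x * y) = res x * res y"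
    "res 1 = 1" "x \<in> valuation_ring v \<Longrightarrow> res x = 0 \<longleftrightarrow> val_ge v 1 x"
    using res by (auto simp: residue_map_def ring_hom_def ring_of_type_algebra_def)
  have "a \<in> res ` valuation_ring v" using res by (simp add: residue_map_def)
  then show "\<exists>x\<in>valuation_ring v. res x = a" by blast
qed

lemma res_0: "res 0 = 0"
  using res_eq_0_iff[of 0] by (simp add: val_ring_closed)

lemma res_diff: "x \<in> valuation_ring v \<Longrightarrow> y \<in> valuation_ring v \<Longrightarrow> res (x - y) = res x - res y"
  using res_add[of "x - y" y] by (simp add: val_ring_closed)

lemma res_power: "x \<in> valuation_ring v \<Longrightarrow> res (x ^ n) = res x ^ n"
  by (induction n) (auto simp: res_1 res_mult val_ring_power)

lemma res_of_nat: "res (of_nat n) = of_nat n"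
  by (induction n) (auto simp: res_0 res_1 res_add val_ring_closed val_ring_of_nat)

lemma res_sum: "(\<And>i. i \<in> I \<Longrightarrow> f i \<in> valuation_ring v) \<Longrightarrow> res (sum f I) = (\<Sum>i\<in>I. res (f i))"
  by (induction I rule: infinite_finite_induct) (auto simp: res_0 res_add val_ring_sum)

lemma res_prod: "(\<And>i. i \<in> I \<Longrightarrow> f i \<in> valuation_ring v) \<Longrightarrow> res (prod f I) = (\<Prod>i\<in>I. res (f i))"
  by (induction I rule: infinite_finite_induct) (auto simp: res_1 res_mult val_ring_prod)

abbreviation "E \<equiv> B \<rightarrow>\<^sub>E {..<p}"

definition root_monomial :: "('r \<Rightarrow> nat) \<Rightarrow> 'l" where
  "root_monomial e = (\<Prod>b\<in>B. root b ^ e b)"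

definition lift_monomial :: "('r \<Rightarrow> nat) \<Rightarrow> 'k" where
  "lift_monomial e = (\<Prod>b\<in>B. lift b ^ e b)"

text \<open>The monomials in all adjoined roots with exponents below \<open>p\<close>. Higher
  exponents are reduced because the \<open>p\<close>-th power of each root lies in the valuation
  ring of K, so the span of these monomials is a ring.\<close>

definition generators :: "'l set" where
  "generators = (\<lambda>(j, e). \<rho> ^ j * root_monomial e) ` ({..<p} \<times> E)"

lemma finite_B: "finite B"
  using basis by (simp add: p_basis_def)

lemma finite_E: "finite E"
  using finite_B by (auto intro: finite_PiE)

lemma finite_generators: "finite generators"
  using finite_E by (simp add: generators_def)

lemma lift_monomial_in: "lift_monomial e \<in> valuation_ring v"
  unfolding lift_monomial_def by (intro val_ring_prod val_ring_power lift)

lemma res_lift_monomial: "res (lift_monomial e) = p_monomial B e"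
  unfolding lift_monomial_def p_monomial_def
  by (subst res_prod) (auto simp: res_power lift val_ring_power intro!: prod.cong)

lemma root_monomial_power: "root_monomial e ^ p = emb (lift_monomial e)"
proof -
  have "root_monomial e ^ p = (\<Prod>b\<in>B. (root b ^ p) ^ e b)"
    by (simp add: root_monomial_def prod_power_distrib power_mult[symmetric] mult.commute)
  then show ?thesis by (simp add: lift_monomial_def emb_prod root)
qed

lemma generatorI: "j < p \<Longrightarrow> e \<in> E \<Longrightarrow> \<rho> ^ j * root_monomial e \<in> ospan generators"
  using finite_generators by (intro ospan_base) (auto simp: generators_def)

lemma root_mult_monomial:
  assumes b: "b \<in> B" and e: "e \<in> E"
  shows "\<exists>a\<in>valuation_ring v. \<exists>e'\<in>E. root b * root_monomial e = emb a * root_monomial e'"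
proof (cases "Suc (e b) < p")
  case True
  have "root_monomial (e(b := Suc (e b))) = root b * root_monomial e"
    unfolding root_monomial_def using finite_B b
    by (subst (1 2) prod.remove[of B b]) (auto simp: mult.assoc intro!: prod.cong)
  moreover have "e(b := Suc (e b)) \<in> E" using e b True by (auto simp: PiE_iff extensional_def)
  ultimately show ?thesis by (intro bexI[of _ 1] bexI[of _ "e(b := Suc (e b))"]) (auto simp: val_ring_closed)
next
  case False
  \<comment> \<open>The exponent of b overflows to \<open>p\<close>: the full power is traded for
    \<open>lift b\<close> and the exponent starts again at 0.\<close>
  then have eb: "Suc (e b) = p" using e b by (force simp: PiE_iff)
  have "root b * root_monomial e = root b ^ Suc (e b) * (\<Prod>c\<in>B - {b}. root c ^ e c)"
    unfolding root_monomial_def using finite_B b by (subst prod.remove[of B b]) (auto simp: mult.assoc)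
  also have "\<dots> = emb (lift b) * root_monomial (e(b := 0))"
    unfolding root_monomial_def using finite_B b root[OF b]
    by (subst prod.remove[of B b]) (auto simp: eb intro!: prod.cong)
  finally have "root b * root_monomial e = emb (lift b) * root_monomial (e(b := 0))" .
  moreover have "e(b := 0) \<in> E" using e b p_pos by (auto simp: PiE_iff extensional_def)
  ultimately show ?thesis using lift(1)[OF b] by blast
qed

lemma ospan_root_mult:
  assumes b: "b \<in> B" and x: "x \<in> ospan generators"
  shows "root b * x \<in> ospan generators"
  using x
proof (induction rule: ospan_induct)
  case (base a s)
  then obtain j e where je: "j < p" "e \<in> E" "s = \<rho> ^ j * root_monomial e" by (auto simp: generators_def)
  obtain a' e' where ae: "a' \<in> valuation_ring v" "e' \<in> E" "root b * root_monomial e = emb a' * root_monomial e'"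
    using root_mult_monomial[OF b je(2)] by blast
  have "root b * (emb a * s) = emb a * \<rho> ^ j * (root b * root_monomial e)" using je by (simp add: mult_ac)
  also have "\<dots> = emb (a * a') * (\<rho> ^ j * root_monomial e')" unfolding ae(3) by (simp add: mult_ac)
  finally have eq: "root b * (emb a * s) = emb (a * a') * (\<rho> ^ j * root_monomial e')" .
  show ?case unfolding eq using base(2) ae je by (intro ospan_scale generatorI val_ring_closed)
qed (auto simp: distrib_left intro: ospan_0 ospan_add)

lemma ospan_rho_mult:
  assumes x: "x \<in> ospan generators"
  shows "\<rho> * x \<in> ospan generators"
  using x
proof (induction rule: ospan_induct)
  case (base a s)
  then obtain j e where je: "j < p" "e \<in> E" "s = \<rho> ^ j * root_monomial e" by (auto simp: generators_def)
  show ?case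
  proof (cases "Suc j < p")
    case True
    have eq: "\<rho> * (emb a * s) = emb a * (\<rho> ^ Suc j * root_monomial e)" using je by (simp add: mult_ac)
    show ?thesis unfolding eq using base(2) je True by (intro ospan_scale generatorI)
  next
    case False
    then have "Suc j = p" using je by simp
    then have "\<rho> * \<rho> ^ j = emb \<pi>" using root_uniformizer by (simp flip: power_Suc)
    moreover have "\<rho> * (emb a * s) = emb a * ((\<rho> * \<rho> ^ j) * root_monomial e)" using je by (simp add: mult_ac)
    ultimately have eq: "\<rho> * (emb a * s) = emb (a * \<pi>) * (\<rho> ^ 0 * root_monomial e)" by simp
    show ?thesis unfolding eq using base(2) je p_pos uniformizer_in_val_ring[OF uniformizer]
      by (intro ospan_scale generatorI val_ring_closed)
  qed
qed (auto simp: distrib_left intro: ospan_0 ospan_add)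

lemma ospan_power_mult:
  assumes "\<And>x. x \<in> ospan generators \<Longrightarrow> t * x \<in> ospan generators" "x \<in> ospan generators"
  shows "t ^ n * x \<in> ospan generators"
  using assms(2) by (induction n) (auto simp: mult.assoc intro: assms(1))

lemma ospan_monomial_mult:
  assumes "x \<in> ospan generators"
  shows "root_monomial e * x \<in> ospan generators"
proof -
  have "(\<Prod>b\<in>C. root b ^ e b) * x \<in> ospan generators" if "C \<subseteq> B" for C
    using that
  proof (induction C rule: infinite_finite_induct)
    case (insert b C)
    have "root b ^ e b * ((\<Prod>b\<in>C. root b ^ e b) * x) \<in> ospan generators"
      by (rule ospan_power_mult[OF ospan_root_mult]) (use insert in auto)
    then show ?case using insert by (simp add: mult.assoc)
  qed (use assms in auto)
  then show ?thesis by (simp add: root_monomial_def)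
qed

lemma ospan_mult:
  assumes x: "x \<in> ospan generators" and y: "y \<in> ospan generators"
  shows "x * y \<in> ospan generators"
  using x
proof (induction rule: ospan_induct)
  case (base a s)
  then obtain j e where je: "s = \<rho> ^ j * root_monomial e" by (auto simp: generators_def)
  have "emb a * (\<rho> ^ j * (root_monomial e * y)) \<in> ospan generators"
    by (intro ospan_scale base(2) ospan_power_mult[OF ospan_rho_mult] ospan_monomial_mult y)
  then show ?case by (simp add: je mult.assoc)
qed (auto simp: distrib_right intro: ospan_0 ospan_add)

lemma ospan_one: "1 \<in> ospan generators"
proof -
  define e where "e = (\<lambda>b\<in>B. 0 :: nat)"
  have "e \<in> E" "root_monomial e = 1" using p_pos by (auto simp: e_def root_monomial_def)
  then show ?thesis using generatorI[of 0 e] p_pos by simp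
qed

sublocale finite_order v emb generators \<pi> \<rho> p
  using finite_generators ospan_one ospan_mult uniformizer root_uniformizer ospan_rho_mult[OF ospan_one] p_pos
  by unfold_locales auto

lemma root_monomial_in: "root_monomial e \<in> R"
  using ospan_monomial_mult[OF ospan_one, of e] by simp

lemma generator_power: "s \<in> generators \<Longrightarrow> \<exists>c\<in>valuation_ring v. s ^ p = emb c"
proof -
  assume "s \<in> generators"
  then obtain j e where "s = \<rho> ^ j * root_monomial e" by (auto simp: generators_def)
  then have "s ^ p = (\<rho> ^ p) ^ j * root_monomial e ^ p"
    by (simp add: power_mult_distrib mult.commute flip: power_mult)
  then have "s ^ p = emb (\<pi> ^ j * lift_monomial e)"
    by (simp add: root_uniformizer root_monomial_power)
  moreover have "\<pi> ^ j * lift_monomial e \<in> valuation_ring v"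
    using uniformizer_in_val_ring[OF uniformizer] by (intro val_ring_closed val_ring_power lift_monomial_in)
  ultimately show ?thesis by blast
qed

lemma frobenius_into:
  assumes "w \<in> R"
  shows "\<exists>c\<in>valuation_ring v. \<exists>u\<in>R. w ^ p = emb c + of_nat p * u"
proof -
  \<comment> \<open>Membership in R is carried through the induction, since
    \<open>frobenius_add\<close> needs it for both summands.\<close>
  have "w \<in> R \<and> (\<exists>c\<in>valuation_ring v. \<exists>u\<in>R. w ^ p = emb c + of_nat p * u)"
    using assms
  proof (induction rule: ospan_induct)
    case zero
    then show ?case using p_pos R_0 by (auto simp: val_ring_closed intro!: bexI[of _ 0])
  next
    case (add x y)
    then obtain c u d w where cd: "c \<in> valuation_ring v" "u \<in> R" "x ^ p = emb c + of_nat p * u"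
      "d \<in> valuation_ring v" "w \<in> R" "y ^ p = emb d + of_nat p * w" by blast
    obtain z where z: "z \<in> R" "(x + y) ^ p = x ^ p + y ^ p + of_nat p * z"
      using frobenius_add[OF prime_p] add by blast
    have "(x + y) ^ p = emb (c + d) + of_nat p * (u + w + z)"
      unfolding z cd by (simp add: algebra_simps)
    moreover have "c + d \<in> valuation_ring v" "u + w + z \<in> R" using cd z by (auto intro: R_intros val_ring_closed)
    ultimately show ?case using add R_add by blast
  next
    case (base a s)
    obtain c where c: "c \<in> valuation_ring v" "s ^ p = emb c" using generator_power[OF base(1)] by blast
    have "(emb a * s) ^ p = emb (a ^ p * c) + of_nat p * 0" by (simp add: c power_mult_distrib)
    moreover have "a ^ p * c \<in> valuation_ring v" using base c by (intro val_ring_closed val_ring_power)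
    moreover have "emb a * s \<in> R" using base finite_generators by (intro ospan_scale ospan_base)
    ultimately show ?case using R_0 by blast
  qed
  then show ?thesis by blast
qed

text \<open>In the \<open>p\<close>-basis expansion of the residue of a every monomial lifts to a
  \<open>p\<close>-th power in L, so the lifted sum is a \<open>p\<close>-th power modulo
  \<open>p\<close>. The lift agrees with a only modulo \<pi>.\<close>

lemma approximate_power:
  assumes a: "a \<in> valuation_ring v"
  shows "\<exists>s\<in>R. \<exists>u\<in>R. \<exists>b\<in>valuation_ring v. emb a = s ^ p + of_nat p * u + emb (\<pi> * b)"
proof -
  obtain c where c: "res a = (\<Sum>e\<in>E. c e ^ p * p_monomial B e)"
    using p_basis_expansion[OF char p_pos basis] by blast
  obtain d where d: "\<And>e. d e \<in> valuation_ring v" "\<And>e. res (d e) = c e"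
    using choice[of "\<lambda>e x. x \<in> valuation_ring v \<and> res x = c e"] res_surj by blast
  let ?A = "\<Sum>e\<in>E. d e ^ p * lift_monomial e"
  have A: "?A \<in> valuation_ring v" by (intro val_ring_sum val_ring_closed val_ring_power d lift_monomial_in)
  have "res ?A = res a"
    unfolding c using d lift_monomial_in
    by (subst res_sum) (auto simp: res_mult res_power val_ring_power val_ring_closed res_lift_monomial)
  then have "val_ge v 1 (a - ?A)" using res_eq_0_iff[of "a - ?A"] res_diff a A by (simp add: val_ring_closed)
  then obtain b where b: "b \<in> valuation_ring v" "a - ?A = \<pi> * b"
    using val_ge_iff_uniformizer_power[OF uniformizer, of 1] by auto
  let ?s = "\<Sum>e\<in>E. emb (d e) * root_monomial e"
  have sR: "emb (d e) * root_monomial e \<in> R" for e by (intro R_mult R_emb d root_monomial_in)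
  obtain u where u: "u \<in> R" "?s ^ p = (\<Sum>e\<in>E. (emb (d e) * root_monomial e) ^ p) + of_nat p * u"
    using frobenius_sum[OF prime_p, of E "\<lambda>e. emb (d e) * root_monomial e"] sR by blast
  have "(\<Sum>e\<in>E. (emb (d e) * root_monomial e) ^ p) = emb ?A"
    by (simp add: emb_sum power_mult_distrib root_monomial_power)
  then have "emb a = ?s ^ p + of_nat p * (- u) + emb (\<pi> * b)"
    using u(2) b(2) by (simp add: algebra_simps flip: emb_add emb_diff emb_mult)
  then show ?thesis using sR u b R_sum[of E "\<lambda>e. emb (d e) * root_monomial e"] R_minus by blast
qed

lemma val_p: "val_ge v 1 (of_nat p)"
  using res_eq_0_iff[OF val_ring_of_nat[of p]] res_of_nat[of p] char of_nat_CHAR[where 'a = 'r] by simp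

text \<open>Successive approximation: an error \<pi>^n b is absorbed by adding \<rho>^n t to s, as
  \<pi>^n is the \<open>p\<close>-th power of \<rho>^n. The process ends after v(p) steps, when the
  error is a multiple of \<open>p\<close>.\<close>

lemma frobenius_onto:
  assumes a: "a \<in> valuation_ring v"
  shows "\<exists>s\<in>R. \<exists>u\<in>R. emb a = s ^ p + of_nat p * u"
proof -
  have approx: "\<exists>s\<in>R. \<exists>u\<in>R. \<exists>b\<in>valuation_ring v. emb a = s ^ p + of_nat p * u + emb (\<pi> ^ n * b)" for n
  proof (induction n)
    case 0
    then show ?case using a R_0 p_pos by (intro bexI[of _ 0] bexI[of _ a]) auto
  next
    case (Suc n)
    then obtain s u b where s: "s \<in> R" "u \<in> R" "b \<in> valuation_ring v"
      "emb a = s ^ p + of_nat p * u + emb (\<pi> ^ n * b)" by blast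
    obtain t w d where t: "t \<in> R" "w \<in> R" "d \<in> valuation_ring v"
      "emb b = t ^ p + of_nat p * w + emb (\<pi> * d)" using approximate_power[OF s(3)] by blast
    have tR: "\<rho> ^ n * t \<in> R" using t by (intro R_intros)
    obtain z where z: "z \<in> R" "(s + \<rho> ^ n * t) ^ p = s ^ p + (\<rho> ^ n * t) ^ p + of_nat p * z"
      using frobenius_add[OF prime_p s(1) tR] by blast
    have rp: "(\<rho> ^ n) ^ p = emb \<pi> ^ n" by (simp add: root_uniformizer[symmetric] mult.commute flip: power_mult)
    have "emb a = (s + \<rho> ^ n * t) ^ p + of_nat p * (u + emb (\<pi> ^ n) * w - z) + emb (\<pi> ^ Suc n * d)"
      unfolding z(2) power_mult_distrib rp using s(4) t(4) by (simp add: algebra_simps)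
    moreover have "s + \<rho> ^ n * t \<in> R" "u + emb (\<pi> ^ n) * w - z \<in> R"
      using s t tR z R_emb_\<pi> by (auto intro!: R_intros)
    ultimately show ?case using t(3) by blast
  qed
  define n where "n = nat (v (of_nat p))"
  have p: "(of_nat p :: 'k) \<noteq> 0" "v (of_nat p) = int n" using val_p p_pos by (auto simp: val_ge_def n_def)
  have \<pi>n: "\<pi> ^ n \<noteq> 0" "v (\<pi> ^ n) = int n" using uniformizer val_power by (auto simp: uniformizer_def)
  have q: "\<pi> ^ n / of_nat p \<in> valuation_ring v"
    using p \<pi>n by (simp add: valuation_ring_def val_ge_def val_divide)
  obtain s u b where s: "s \<in> R" "u \<in> R" "b \<in> valuation_ring v"
    "emb a = s ^ p + of_nat p * u + emb (\<pi> ^ n * b)" using approx[of n] by blast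
  have "emb (\<pi> ^ n * b) = emb (of_nat p) * emb (\<pi> ^ n / of_nat p * b)"
    using p by (simp only: emb_mult[symmetric]) simp
  then have "emb a = s ^ p + of_nat p * (u + emb (\<pi> ^ n / of_nat p * b))"
    using s(4) by (simp add: distrib_left)
  moreover have "u + emb (\<pi> ^ n / of_nat p * b) \<in> R"
    using s q by (intro R_add R_emb val_ring_closed)
  ultimately show ?thesis using s(1) by blast
qed

text \<open>Generators containing a positive power of \<rho> go into the error term.\<close>

lemma expand_mod_rho:
  assumes "z \<in> R"
  shows "\<exists>c. (\<forall>e. c e \<in> valuation_ring v) \<and> (\<exists>u\<in>R. z = (\<Sum>e\<in>E. emb (c e) * root_monomial e) + \<rho> * u)"
  using assms
proof (induction rule: ospan_induct)
  case zero
  then show ?case by (intro exI[of _ "\<lambda>_. 0"]) (auto simp: val_ring_closed R_0)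
next
  case (add x y)
  then obtain c u d w where *: "\<forall>e. c e \<in> valuation_ring v" "u \<in> R" "x = (\<Sum>e\<in>E. emb (c e) * root_monomial e) + \<rho> * u"
    "\<forall>e. d e \<in> valuation_ring v" "w \<in> R" "y = (\<Sum>e\<in>E. emb (d e) * root_monomial e) + \<rho> * w" by blast
  have "x + y = (\<Sum>e\<in>E. emb (c e + d e) * root_monomial e) + \<rho> * (u + w)"
    unfolding * by (simp add: sum.distrib algebra_simps)
  moreover have "\<forall>e. c e + d e \<in> valuation_ring v" "u + w \<in> R" using * by (auto intro: val_ring_closed R_add)
  ultimately show ?case by (intro exI[of _ "\<lambda>e. c e + d e"]) blast
next
  case (base a s)
  then obtain j e where je: "j < p" "e \<in> E" "s = \<rho> ^ j * root_monomial e" by (auto simp: generators_def)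
  show ?case
  proof (cases j)
    case 0
    have "(\<Sum>f\<in>E. emb (if f = e then a else 0) * root_monomial f) = emb a * root_monomial e"
      using finite_E je(2) by (subst sum.remove[of E e]) (auto intro!: sum.neutral)
    then show ?thesis using base je 0
      by (intro exI[of _ "\<lambda>f. if f = e then a else 0"]) (auto simp: val_ring_closed R_0 intro!: bexI[of _ 0])
  next
    case (Suc i)
    have "emb a * (\<rho> ^ i * root_monomial e) \<in> R" using base by (intro R_intros R_emb root_monomial_in)
    then show ?thesis using je Suc
      by (intro exI[of _ "\<lambda>_. 0"]) (auto simp: val_ring_closed mult_ac intro!: bexI[of _ "emb a * (\<rho> ^ i * root_monomial e)"])
  qed
qed

text \<open>This uses the independence of the \<open>p\<close>-basis. Modulo \<rho>, z is a
  combination of root monomials, and modulo \<pi> R its \<open>p\<close>-th power is the combination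
  \<open>?A\<close> of lifted monomials. If \<pi> divides z^p, the residue of \<open>?A\<close>
  vanishes, hence so do the residues of all coefficients.\<close>

lemma reduced:
  assumes z: "z \<in> R" and w: "w \<in> R" and zw: "z ^ p = emb \<pi> * w"
  shows "\<exists>u\<in>R. z = \<rho> * u"
proof -
  obtain c u where c: "\<And>e. c e \<in> valuation_ring v" "u \<in> R"
    "z = (\<Sum>e\<in>E. emb (c e) * root_monomial e) + \<rho> * u" using expand_mod_rho[OF z] by blast
  let ?s = "\<Sum>e\<in>E. emb (c e) * root_monomial e" and ?A = "\<Sum>e\<in>E. c e ^ p * lift_monomial e"
  have sR: "emb (c e) * root_monomial e \<in> R" for e by (intro R_mult R_emb c root_monomial_in)
  obtain x where x: "x \<in> R" "?s ^ p = (\<Sum>e\<in>E. (emb (c e) * root_monomial e) ^ p) + of_nat p * x"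
    using frobenius_sum[OF prime_p, of E "\<lambda>e. emb (c e) * root_monomial e"] sR by blast
  have s_in: "?s \<in> R" by (rule R_sum) (rule sR)
  obtain y where y: "y \<in> R" "z ^ p = ?s ^ p + (\<rho> * u) ^ p + of_nat p * y"
    unfolding c(3)
    using frobenius_add[OF prime_p s_in R_mult[OF rho(2) c(2)]] by blast
  have "(\<Sum>e\<in>E. (emb (c e) * root_monomial e) ^ p) = emb ?A"
    by (simp add: emb_sum power_mult_distrib root_monomial_power)
  then have "emb ?A = emb \<pi> * w - (\<rho> * u) ^ p - of_nat p * (x + y)"
    using x(2) y(2) zw by (simp add: algebra_simps)
  moreover obtain q where q: "q \<in> valuation_ring v" "of_nat p = \<pi> * q"
    using val_p val_ge_iff_uniformizer_power[OF unif, of 1] by auto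
  moreover have "(of_nat p :: 'l) = emb \<pi> * emb q" using arg_cong[OF q(2), of emb] by simp
  ultimately have A: "emb ?A = emb \<pi> * (w - u ^ p - emb q * (x + y))"
    by (simp add: power_mult_distrib root_uniformizer algebra_simps)
  have AR: "w - u ^ p - emb q * (x + y) \<in> R" using w c(2) q x y by (intro R_intros R_emb)
  have AO: "?A \<in> valuation_ring v" by (intro val_ring_sum val_ring_closed val_ring_power c lift_monomial_in)
  \<comment> \<open>Divisibility by \<pi> in R descends to the valuation ring of K: a unit
    \<open>?A\<close> would make \<pi> a unit of R.\<close>
  have "val_ge v 1 ?A"
  proof (rule ccontr)
    assume "\<not> val_ge v 1 ?A"
    then have "?A \<noteq> 0" "v ?A = 0" using AO by (auto simp: val_ge_def valuation_ring_def)
    then have "inverse ?A \<in> valuation_ring v" by (simp add: valuation_ring_def val_ge_def val_inverse)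
    then have "(w - u ^ p - emb q * (x + y)) * emb (inverse ?A) \<in> R" using AR by (intro R_mult R_emb)
    moreover have "emb \<pi> * ((w - u ^ p - emb q * (x + y)) * emb (inverse ?A)) = emb ?A * emb (inverse ?A)"
      unfolding A by (simp only: mult.assoc)
    moreover have "emb ?A * emb (inverse ?A) = 1" using \<open>?A \<noteq> 0\<close> by (simp only: emb_mult[symmetric]) simp
    ultimately show False using uniformizer_not_unit by metis
  qed
  then have "res ?A = 0" using res_eq_0_iff[OF AO] by simp
  moreover have "res ?A = (\<Sum>e\<in>E. res (c e) ^ p * p_monomial B e)"
    using c lift_monomial_in
    by (subst res_sum) (auto simp: res_mult res_power val_ring_power val_ring_closed res_lift_monomial)
  ultimately have "res (c e) = 0" if "e \<in> E" for e
    using p_basis_independent[OF char p_pos basis _ that, of "\<lambda>e. res (c e)"] by simp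
  then have "\<exists>d\<in>valuation_ring v. c e = \<pi> * d" if "e \<in> E" for e
    using res_eq_0_iff[OF c(1)] val_ge_iff_uniformizer_power[OF unif, of 1] that by auto
  then obtain d where d: "\<And>e. e \<in> E \<Longrightarrow> d e \<in> valuation_ring v" "\<And>e. e \<in> E \<Longrightarrow> c e = \<pi> * d e" by metis
  have "?s = (\<Sum>e\<in>E. emb \<pi> * (emb (d e) * root_monomial e))"
    by (rule sum.cong) (simp_all add: d(2) mult.assoc)
  also have "\<dots> = \<rho> * (\<rho> ^ (p - 1) * (\<Sum>e\<in>E. emb (d e) * root_monomial e))"
    using p_pos by (simp add: sum_distrib_left[symmetric] root_uniformizer[symmetric] power_eq_if mult.assoc)
  finally have "z = \<rho> * (\<rho> ^ (p - 1) * (\<Sum>e\<in>E. emb (d e) * root_monomial e) + u)"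
    unfolding c(3) by (simp add: distrib_left)
  moreover have "\<rho> ^ (p - 1) * (\<Sum>e\<in>E. emb (d e) * root_monomial e) + u \<in> R"
    using c(2) d by (intro R_intros R_emb root_monomial_in)
  ultimately show ?thesis by blast
qed

sublocale frobenius_order v emb generators \<pi> \<rho> p
  using prime_p val_p frobenius_into frobenius_onto reduced by unfold_locales

end

section \<open>Vanishing of the symbols of elements of K\<close>

lemma pseudo_perfect_extensionE:
  fixes v :: "'k::field_char_0 \<Rightarrow> int" and res :: "'k \<Rightarrow> 'r::field" and emb :: "'k \<Rightarrow> 'l::field"
  assumes "complete_discretely_valued_field v" "residue_map v res" "CHAR('r) = p" "p > 0"
    "pseudo_perfect_extension p v res emb"
  obtains B lift root \<pi> \<rho> where "pseudo_perfect v emb res p B lift root \<pi> \<rho>"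
proof -
  from assms(5) obtain \<Lambda> r where emb: "emb \<in> ring_hom ring_of_type_algebra ring_of_type_algebra"
    and \<Lambda>: "pseudo_basis p v res \<Lambda>" and r: "\<forall>u\<in>\<Lambda>. r u ^ p = emb u"
    unfolding pseudo_perfect_extension_def by blast
  from \<Lambda> obtain U \<pi> where U: "\<Lambda> = insert \<pi> U" "uniformizer v \<pi>" "U \<subseteq> valuation_ring v"
    "inj_on res U" "p_basis p (res ` U)" unfolding pseudo_basis_def by blast
  let ?lift = "inv_into U res"
  have "pseudo_perfect v emb res p (res ` U) ?lift (r \<circ> ?lift) \<pi> (r \<pi>)"
    unfolding pseudo_perfect_def pseudo_perfect_axioms_def embedded_complete_field_def embedded_complete_field_axioms_def
    using assms(1-4) emb r U inv_into_into[of _ res U] f_inv_into_f[of _ res U] by auto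
  then show ?thesis by (rule that)
qed

text \<open>The first two entries decide, or the first three if p = 2 and i >= 3; the others are
  carried along.\<close>

lemma milnor_tuple_null:
  fixes v :: "'k::field_char_0 \<Rightarrow> int" and res :: "'k \<Rightarrow> 'r::field" and emb :: "'k \<Rightarrow> 'l::field"
  assumes "complete_discretely_valued_field v" "residue_map v res" "CHAR('r) = p" "p > 0"
    "pseudo_perfect_extension p v res emb"
    and i: "i \<ge> 3 \<or> i = 2 \<and> (p = 2 \<longrightarrow> (\<forall>x y :: 'r. \<exists>a b. y = a ^ 2 + a * b + x * b ^ 2))"
    and xs: "xs \<in> milnor_tuples i"
  shows "frag_of (map emb xs) \<in> milnor_null p i"
proof -
  obtain B lift root \<pi> \<rho> where "pseudo_perfect v emb res p B lift root \<pi> \<rho>"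
    using pseudo_perfect_extensionE[OF assms(1-5)] by blast
  then interpret pseudo_perfect v emb res p B lift root \<pi> \<rho> .
  have pair: "frag_of (map emb (x # y # ys)) \<in> milnor_null p i"
    if van: "\<And>Z a b. symbol_vanishing Z p \<Longrightarrow> a \<in> R \<Longrightarrow> b \<in> R \<Longrightarrow> Z (1 + of_nat p * a) (1 + of_nat p * b)"
      and xs: "xs = x # y # ys" for x y ys
  proof -
    have "0 \<notin> set (map emb ys)" "i = length [] + length (map emb ys) + 2" "x \<noteq> 0" "y \<noteq> 0"
      using \<open>xs \<in> _\<close> xs by (auto simp: milnor_tuples_def)
    then show ?thesis
      using vanishing_on_base[OF symbol_vanishing_milnor_null[of "[]" "map emb ys" i p] van[OF symbol_vanishing_milnor_null]]
      by simp
  qed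
  show ?thesis
  proof (cases "p = 2")
    case False
    have "length xs \<ge> 2" using xs i by (auto simp: milnor_tuples_def)
    then obtain x y ys where "xs = x # y # ys" by (metis Suc_le_length_iff numeral_2_eq_2)
    then show ?thesis using pair vanishing_odd[OF _ False] by blast
  next
    case p: True
    show ?thesis
    proof (cases "i \<ge> 3")
      case True
      then have "length xs \<ge> 3" using xs by (auto simp: milnor_tuples_def)
      then obtain x y z ys where xs': "xs = x # y # z # ys" by (metis Suc_le_length_iff numeral_3_eq_3)
      let ?T = "\<lambda>a b c. frag_of ([a, b, c] @ map emb ys) \<in> milnor_null p i"
      have nz: "0 \<notin> set (map emb ys)" "i = length ys + 3" "x \<noteq> 0" "y \<noteq> 0" "z \<noteq> 0"
        using xs xs' by (auto simp: milnor_tuples_def)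
      have T12: "symbol_vanishing (\<lambda>a b. ?T a b c) p" if "c \<noteq> 0" for c
        using symbol_vanishing_milnor_null[of "[]" "c # map emb ys" i p] nz that by simp
      have T23: "symbol_vanishing (?T a) p" if "a \<noteq> 0" for a
        using symbol_vanishing_milnor_null[of "[a]" "map emb ys" i p] nz that by simp
      have "?T (emb x) (emb y) (emb z)"
        by (rule vanishing_on_base_three[of ?T, OF T12 T23 vanishing_two_degree_three[of ?T, OF T12 T23 p]]) (use nz in auto)
      then show ?thesis by (simp add: xs')
    next
      case False
      then have form: "\<exists>a b. y = a ^ 2 + a * b + x * b ^ 2" for x y :: 'r using i p by auto
      have "length xs = 2" using xs i False by (auto simp: milnor_tuples_def)
      then obtain x y ys where xs': "xs = x # y # ys" by (metis Suc_length_conv numeral_2_eq_2)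
      have formO: "\<exists>a\<in>valuation_ring v. \<exists>b\<in>valuation_ring v. val_ge v 1 (y - (a ^ 2 + a * b + x * b ^ 2))"
        if xy: "x \<in> valuation_ring v" "y \<in> valuation_ring v" for x y
      proof -
        obtain a' b' where "res y = a' ^ 2 + a' * b' + res x * b' ^ 2" using form by blast
        moreover obtain a where a: "a \<in> valuation_ring v" "res a = a'" using res_surj by blast
        moreover obtain b where b: "b \<in> valuation_ring v" "res b = b'" using res_surj by blast
        ultimately have "res (y - (a ^ 2 + a * b + x * b ^ 2)) = 0"
          using xy by (simp add: res_diff res_add res_mult res_power val_ring_closed val_ring_power)
        then show ?thesis using a b xy res_eq_0_iff[of "y - (a ^ 2 + a * b + x * b ^ 2)"]
          by (intro bexI[of _ a] bexI[of _ b]) (auto simp: val_ring_closed val_ring_power)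
      qed
      have "Z (1 + of_nat p * a) (1 + of_nat p * b)"
        if "symbol_vanishing Z p" "a \<in> R" "b \<in> R" for Z a b
      proof (rule vanishing_two_degree_two[OF that(1) p _ that(2,3)])
        fix x y assume "x \<in> R" "y \<in> R"
        then show "\<exists>s\<in>R. \<exists>t\<in>R. \<exists>w\<in>R. y = s\<^sup>2 + s * t + x * t\<^sup>2 + \<rho> * w"
          by (intro residue_form_lift[OF p formO])
      qed
      then show ?thesis unfolding xs' by (rule pair[OF _ xs'])
    qed
  qed
qed

section \<open>Separable closures in characteristic 2\<close>

abbreviation ac_poly :: "'r::field poly \<Rightarrow> 'r alg_closure \<Rightarrow> 'r alg_closure" where
  "ac_poly f \<equiv> poly (map_poly to_ac f)"

lemma map_poly_to_ac_simps [simp]: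
  "map_poly to_ac (f + g) = map_poly to_ac f + map_poly to_ac g"
  "map_poly to_ac (f - g) = map_poly to_ac f - map_poly to_ac g"
  "map_poly to_ac (- f) = - map_poly to_ac f"
  "map_poly to_ac (smult c f) = smult (to_ac c) (map_poly to_ac f)"
  "map_poly to_ac (f * g) = map_poly to_ac f * map_poly to_ac g"
  "map_poly to_ac (pCons c f) = pCons (to_ac c) (map_poly to_ac f)"
  "map_poly to_ac (pderiv f) = pderiv (map_poly to_ac f)"
  by (auto intro!: poly_eqI simp: coeff_map_poly coeff_mult to_ac_sum coeff_pCons coeff_pderiv split: nat.splits)

text \<open>This is how inverses become polynomials: x f(x) = - c, with c a non-zero
  constant.\<close>

lemma algebraic_constant_term:
  fixes x :: "'r::field alg_closure"
  assumes "x \<noteq> 0"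
  obtains c f where "c \<noteq> 0" "ac_poly (pCons c f) x = 0"
proof -
  obtain g :: "'r poly" where "g \<noteq> 0" "ac_poly g x = 0" using alg_closure_algebraic by metis
  then have "\<exists>c f. c \<noteq> 0 \<and> ac_poly (pCons c f) x = 0"
  proof (induction g)
    case (pCons c f)
    then show ?case using assms by (cases "c = 0") auto
  qed simp
  then show ?thesis using that by blast
qed

text \<open>The minimal polynomial of a common root would divide both polynomials.\<close>

lemma coprime_no_common_root:
  fixes f g :: "'r::field poly"
  assumes "coprime f g" "ac_poly f z = 0"
  shows "ac_poly g z \<noteq> 0"
proof
  assume g: "ac_poly g z = 0"
  have "\<exists>m :: 'r poly. m \<noteq> 0 \<and> ac_poly m z = 0" using alg_closure_algebraic by metis
  then obtain m :: "'r poly" where m: "m \<noteq> 0" "ac_poly m z = 0"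
    and min: "\<And>h :: 'r poly. h \<noteq> 0 \<Longrightarrow> ac_poly h z = 0 \<Longrightarrow> degree m \<le> degree h"
    using ex_has_least_nat[of "\<lambda>m :: 'r poly. m \<noteq> 0 \<and> ac_poly m z = 0" _ degree] by metis
  have dvd: "m dvd h" if "ac_poly h z = 0" for h
  proof -
    have "h = (h div m) * m + h mod m" by simp
    then have "ac_poly h z = ac_poly (h div m) z * ac_poly m z + ac_poly (h mod m) z"
      by (metis map_poly_to_ac_simps(1,5) poly_add poly_mult)
    then have "ac_poly (h mod m) z = 0" using that m(2) by simp
    then have "h mod m = 0" using min degree_mod_less[OF m(1), of h] by fastforce
    then show ?thesis by (simp add: dvd_eq_mod_eq_0)
  qed
  have "is_unit m" using assms(1) dvd[OF assms(2)] dvd[OF g] by (rule coprime_common_divisor)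
  then obtain k where "1 = m * k" by (elim dvdE)
  then have "ac_poly 1 z = ac_poly m z * ac_poly k z" by (metis map_poly_to_ac_simps(5) poly_mult)
  then show False using m(2) by simp
qed

lemma ac_scale_vector_space: "vector_space (\<lambda>c x. to_ac c * x)"
  by unfold_locales (simp_all add: algebra_simps)

global_interpretation ac: vector_space "\<lambda>(c::'r::field) (x::'r alg_closure). to_ac c * x"
  by (rule ac_scale_vector_space)

lemma ac_poly_in_span: "ac_poly f t \<in> ac.span (range (\<lambda>i. t ^ i))"
proof -
  have "ac_poly f t = (\<Sum>i\<le>degree (map_poly to_ac f). to_ac (coeff f i) * t ^ i)"
    by (simp add: poly_altdef coeff_map_poly)
  then show ?thesis by (simp only:) (intro ac.span_sum ac.span_scale ac.span_base; blast)
qed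

lemma ac_span_powersE:
  assumes "u \<in> ac.span (range (\<lambda>i. t ^ i))"
  obtains f where "u = ac_poly f t"
proof -
  have "\<exists>f. u = ac_poly f t"
    using assms
  proof (induction rule: ac.span_induct_alt)
    case base
    show ?case by (rule exI[of _ 0]) simp
  next
    case (step c x y)
    then obtain i f where "x = t ^ i" "y = ac_poly f t" by blast
    then show ?case
      by (intro exI[of _ "monom c i + f"]) (simp add: map_poly_monom poly_monom)
  qed
  then show ?thesis using that by blast
qed

lemma ac_span_mult:
  assumes "u \<in> ac.span P" "w \<in> ac.span Q" "\<And>p q. p \<in> P \<Longrightarrow> q \<in> Q \<Longrightarrow> p * q \<in> ac.span T"
  shows "u * w \<in> ac.span T"
  using assms(1)
proof (induction rule: ac.span_induct_alt)
  case (step c x y)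
  have "x * w \<in> ac.span T"
    using assms(2)
  proof (induction rule: ac.span_induct_alt)
    case (step d z z')
    then have "to_ac d * (x * z) + x * z' \<in> ac.span T"
      using assms(3) \<open>x \<in> P\<close> by (intro ac.span_add ac.span_scale)
    then show ?case by (simp add: algebra_simps)
  qed (simp add: ac.span_zero)
  then have "to_ac c * (x * w) + y * w \<in> ac.span T" using step by (intro ac.span_add ac.span_scale)
  then show ?case by (simp add: algebra_simps)
qed (simp add: ac.span_zero)

lemma ac_powers_finite_span:
  fixes x :: "'r::field alg_closure"
  shows "\<exists>n. \<forall>i. x ^ i \<in> ac.span ((\<lambda>k. x ^ k) ` {..<n})"
proof -
  obtain f :: "'r poly" where f: "f \<noteq> 0" "ac_poly f x = 0" using alg_closure_algebraic by metis
  define n where "n = degree f"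
  let ?P = "(\<lambda>k. x ^ k) ` {..<n}"
  have "(\<Sum>i\<le>n. to_ac (coeff f i) * x ^ i) = 0"
    using f(2) by (simp add: poly_altdef coeff_map_poly n_def degree_map_poly)
  then have "to_ac (coeff f n) * x ^ n = - (\<Sum>i<n. to_ac (coeff f i) * x ^ i)"
  proof -
    have "{..n} = insert n {..<n}" by auto
    then show ?thesis using \<open>(\<Sum>i\<le>n. to_ac (coeff f i) * x ^ i) = 0\<close> by (simp add: eq_neg_iff_add_eq_0)
  qed
  moreover have "coeff f n \<noteq> 0" using f(1) by (simp add: n_def)
  ultimately have "x ^ n = to_ac (inverse (coeff f n)) * (- (\<Sum>i<n. to_ac (coeff f i) * x ^ i))"
    by (simp add: field_simps)
  moreover have "(\<Sum>i<n. to_ac (coeff f i) * x ^ i) \<in> ac.span ?P"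
    by (intro ac.span_sum ac.span_scale ac.span_base) auto
  ultimately have n: "x ^ n \<in> ac.span ?P" by (simp only:) (intro ac.span_scale ac.span_neg)
  have "x ^ i \<in> ac.span ?P" for i
  proof (induction i)
    case 0
    show ?case
    proof (cases "n = 0")
      case True
      then show ?thesis using n by simp
    next
      case False
      then show ?thesis by (intro ac.span_base image_eqI[of _ _ 0]) auto
    qed
  next
    case (Suc i)
    have "x ^ 1 * x ^ i \<in> ac.span ?P"
    proof (rule ac_span_mult[OF ac.span_base Suc])
      fix p q assume "p \<in> {x ^ 1}" "q \<in> ?P"
      then obtain k where "k < n" "p * q = x ^ Suc k" by auto
      then show "p * q \<in> ac.span ?P"
        using n by (cases "Suc k = n") (simp, metis Suc_lessI ac.span_base imageI lessThan_iff)
    qed simp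
    then show ?case by simp
  qed
  then show ?thesis by blast
qed

section \<open>Separable elements in characteristic 2 form a field\<close>

context
  fixes T :: "'r::field itself"
  assumes char2: "CHAR('r) = 2"
begin

lemma ac_two: "x + x = (0 :: 'r alg_closure)"
proof -
  have "of_nat CHAR('r alg_closure) = (0 :: 'r alg_closure)" by (rule of_nat_CHAR)
  then have "(2 :: 'r alg_closure) = 0" using char2 by simp
  then show ?thesis by (simp flip: mult_2)
qed

lemma base_two: "x + x = (0 :: 'r)"
  by (metis ac_two to_ac_add to_ac_eq_0_iff)

lemma ac_minus: "- x = (x :: 'r alg_closure)"
  using ac_two[of x] by (simp add: neg_eq_iff_add_eq_0)

lemma ac_square_add: "(x + y) ^ 2 = (x ^ 2 + y ^ 2 :: 'r alg_closure)"
proof -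
  have "2 * x * y = 0" unfolding mult_2 ac_two by simp
  then show ?thesis unfolding power2_sum by simp
qed

lemma ac_square_eq_iff: "x ^ 2 = y ^ 2 \<longleftrightarrow> x = (y :: 'r alg_closure)"
  by (metis ac_minus power2_eq_iff)

lemma ac_square_span:
  fixes u :: "'r alg_closure"
  assumes "u \<in> ac.span P"
  shows "u ^ 2 \<in> ac.span ((\<lambda>u. u ^ 2) ` P)"
  using assms
proof (induction rule: ac.span_induct_alt)
  case (step c x y)
  have eq: "(to_ac c * x + y) ^ 2 = to_ac (c ^ 2) * x ^ 2 + y ^ 2"
    by (simp add: ac_square_add power_mult_distrib)
  show ?case unfolding eq by (rule ac.span_add[OF ac.span_scale[OF ac.span_base]]) (use step in auto)
qed (simp add: ac.span_zero)

text \<open>A basis of \<open>M\<close> is mapped by squaring to a spanning set of \<open>M\<close>, hence to a basis.\<close>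

lemma squares_span:
  fixes M N F :: "'r alg_closure set"
  assumes F: "finite F" "M \<subseteq> ac.span F"
    and MM: "M \<subseteq> ac.span ((\<lambda>u. u ^ 2) ` M)"
    and N: "N \<subseteq> M" "(\<lambda>u. u ^ 2) ` N \<subseteq> N"
  shows "N \<subseteq> ac.span ((\<lambda>u. u ^ 2) ` N)"
proof -
  let ?sq = "\<lambda>u::'r alg_closure. u ^ 2"
  have inj: "inj_on ?sq Y" for Y by (auto simp: inj_on_def ac_square_eq_iff)
  obtain C where C: "C \<subseteq> N" "ac.independent C" "N \<subseteq> ac.span C"
    using ac.maximal_independent_subset[of N] by blast
  obtain B where B: "C \<subseteq> B" "B \<subseteq> M" "ac.independent B" "M \<subseteq> ac.span B"
    using ac.maximal_independent_subset_extend[of C M] C N by blast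
  have finB: "finite B" using ac.independent_span_bound[OF F(1) B(3)] B(2) F(2) by blast
  have "?sq ` M \<subseteq> ac.span (?sq ` B)" using B(4) ac_square_span by blast
  then have "ac.span (?sq ` M) \<subseteq> ac.span (?sq ` B)"
    by (rule ac.span_minimal[OF _ ac.subspace_span])
  then have BsqB: "B \<subseteq> ac.span (?sq ` B)" using B(2) MM by blast
  \<comment> \<open>If one square were redundant, fewer elements than \<open>B\<close> has would
    span the independent set \<open>B\<close>.\<close>
  have "ac.independent (?sq ` B)"
  proof
    assume "ac.dependent (?sq ` B)"
    then obtain a where a: "a \<in> ?sq ` B" "a \<in> ac.span (?sq ` B - {a})" unfolding ac.dependent_def by blast
    then have "ac.span (?sq ` B) = ac.span (?sq ` B - {a})" using ac.span_redundant[of a "?sq ` B - {a}"]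
      by (simp add: insert_absorb)
    then have "card B \<le> card (?sq ` B - {a})"
      using ac.independent_span_bound[of "?sq ` B - {a}" B] finB B(3) BsqB by auto
    also have "\<dots> < card (?sq ` B)" using a(1) finB by (intro card_Diff1_less) auto
    finally show False using card_image[OF inj, of B] by simp
  qed
  then have sqC: "ac.independent (?sq ` C)" by (rule ac.independent_mono) (use B(1) in auto)
  have finC: "finite C" using finB B(1) finite_subset by blast
  \<comment> \<open>By counting: an element of \<open>N\<close> outside could be added to the
    squares of \<open>C\<close>, giving more independent elements in the span of \<open>C\<close>
    than \<open>C\<close> has.\<close>
  have "v \<in> ac.span (?sq ` C)" if "v \<in> N" for v
  proof (rule ccontr)
    assume v: "v \<notin> ac.span (?sq ` C)"
    then have "ac.independent (insert v (?sq ` C))" using sqC ac.independent_insertI by blast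
    moreover have "insert v (?sq ` C) \<subseteq> ac.span C" using N(2) C that by blast
    ultimately have "card (insert v (?sq ` C)) \<le> card C" using ac.independent_span_bound[OF finC] by blast
    moreover have "v \<notin> ?sq ` C" using v by (auto intro: ac.span_base)
    ultimately show False using finC card_image[OF inj, of C] by simp
  qed
  then show ?thesis using C(1) ac.span_mono[of "?sq ` C" "?sq ` N"] by blast
qed

text \<open>If \<open>z = q(z\<^sup>2)\<close>, then \<open>X - q(X\<^sup>2)\<close> has derivative 1.\<close>

lemma sep_closure_iff: "z \<in> sep_closure \<longleftrightarrow> (\<exists>q :: 'r poly. z = ac_poly q (z ^ 2))"
proof
  assume "\<exists>q :: 'r poly. z = ac_poly q (z ^ 2)"
  then obtain q :: "'r poly" where q: "z = ac_poly q (z ^ 2)" by blast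
  define f where "f = [:0, 1:] - pcompose q [:0, 0, 1:]"
  have "[:0, 0, 1:] = [:0, 1:] * [:0, 1:: 'r:]" by simp
  then have "pderiv [:0, 0, 1 :: 'r:] = [:0, 1 + 1:]" by (simp add: pderiv_pCons)
  then have "pderiv f = 1" using base_two[of 1] by (simp add: f_def pderiv_diff pderiv_pcompose pderiv_pCons)
  moreover have "ac_poly (pcompose q [:0, 0, 1:]) z = ac_poly q (z ^ 2)"
    by (induction q) (simp_all add: pcompose_pCons power2_eq_square)
  then have "ac_poly f z = 0" using q by (simp add: f_def)
  moreover have "f \<noteq> 0" using \<open>pderiv f = 1\<close> by auto
  ultimately show "z \<in> sep_closure" unfolding sep_closure_def by auto
next
  assume "z \<in> sep_closure"
  then obtain f :: "'r poly" where f: "coprime f (pderiv f)" "ac_poly f z = 0" unfolding sep_closure_def by auto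
  \<comment> \<open>Splitting f into its even and odd part. In characteristic 2 the derivative is
    the odd part divided by X, again a polynomial in the square.\<close>
  have decomp: "\<exists>g h. ac_poly f z = ac_poly g (z ^ 2) + z * ac_poly h (z ^ 2) \<and> poly (pderiv (map_poly to_ac f)) z = ac_poly h (z ^ 2)"
    for f :: "'r poly"
  proof (induction f)
    case 0
    show ?case by (rule exI[of _ 0], rule exI[of _ 0]) simp
  next
    case (pCons c f)
    then obtain g h where gh: "ac_poly f z = ac_poly g (z ^ 2) + z * ac_poly h (z ^ 2)"
      "poly (pderiv (map_poly to_ac f)) z = ac_poly h (z ^ 2)" by blast
    have "ac_poly (pCons c f) z = ac_poly (pCons c h) (z ^ 2) + z * ac_poly g (z ^ 2)"
      by (simp add: gh(1) power2_eq_square algebra_simps)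
    moreover have "poly (pderiv (map_poly to_ac (pCons c f))) z = ac_poly g (z ^ 2) + (z * ac_poly h (z ^ 2) + z * ac_poly h (z ^ 2))"
      by (simp add: pderiv_pCons gh algebra_simps)
    ultimately show ?case unfolding ac_two by (intro exI[of _ "pCons c h"] exI[of _ g]) simp
  qed
  have nz: "poly (pderiv (map_poly to_ac f)) z \<noteq> 0" using coprime_no_common_root[OF f] by simp
  obtain g h where gh: "ac_poly f z = ac_poly g (z ^ 2) + z * ac_poly h (z ^ 2)"
    "poly (pderiv (map_poly to_ac f)) z = ac_poly h (z ^ 2)" using decomp by blast
  define w where "w = ac_poly h (z ^ 2)"
  have w: "w \<noteq> 0" using nz gh by (simp add: w_def)
  \<comment> \<open>Since z h(z^2) equals g(z^2), it remains to invert h(z^2), and the inverse of an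
    algebraic element is a polynomial in it.\<close>
  obtain c k where ck: "c \<noteq> 0" "ac_poly (pCons c k) w = 0" using algebraic_constant_term[OF w] .
  have wk: "w * (- ac_poly k w) = to_ac c" using ck(2) by (simp add: add_eq_0_iff)
  have "inverse w = inverse w * (w * (- ac_poly k w)) / to_ac c" unfolding wk using ck(1) by simp
  also have "\<dots> = - ac_poly k w / to_ac c" using w by simp
  also have "\<dots> = ac_poly (smult (- inverse c) (pcompose k h)) (z ^ 2)"
  proof -
    have "ac_poly (pcompose k h) t = ac_poly k (ac_poly h t)" for t
      by (induction k) (simp_all add: pcompose_pCons)
    then show ?thesis by (simp add: w_def divide_inverse)
  qed
  finally have "z = ac_poly (g * smult (- inverse c) (pcompose k h)) (z ^ 2)"
  proof -
    assume *: "inverse w = ac_poly (smult (- inverse c) (pcompose k h)) (z ^ 2)"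
    have "z * w = ac_poly g (z ^ 2)" using gh(1) f(2) ac_minus by (metis add_eq_0_iff w_def)
    then have "z = ac_poly g (z ^ 2) * inverse w" using w by (simp add: field_simps)
    then show ?thesis unfolding * by (simp add: mult_ac)
  qed
  then show "\<exists>q :: 'r poly. z = ac_poly q (z ^ 2)" by blast
qed

text \<open>By \<open>sep_closure_iff\<close>, separability of z means that z is a polynomial in
  z^2. The algebra \<open>K\<close> generated by x and y is finite-dimensional and spanned by its
  squares, because x and y are separable. By \<open>squares_span\<close> the subalgebra
  \<open>V\<close> generated by z inherits this, so z lies in the span of the powers of z^2.\<close>

lemma sep_closure_span:
  fixes x y :: "'r alg_closure"
  assumes x: "x \<in> sep_closure" and y: "y \<in> sep_closure"
    and z: "z \<in> ac.span (range (\<lambda>(i, j). x ^ i * y ^ j))"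
  shows "z \<in> sep_closure"
proof -
  let ?M = "range (\<lambda>(i::nat, j::nat). x ^ i * y ^ j)" and ?sq = "\<lambda>u::'r alg_closure. u ^ 2"
  define K where "K = ac.span ?M"
  have mono: "x ^ i * y ^ j \<in> K" for i j unfolding K_def by (rule ac.span_base) auto
  have K_mult: "u * w \<in> K" if "u \<in> K" "w \<in> K" for u w
    using that unfolding K_def
  proof (rule ac_span_mult)
    fix p q assume "p \<in> ?M" "q \<in> ?M"
    then obtain i j k l where "p = x ^ i * y ^ j" "q = x ^ k * y ^ l" by auto
    then have "p * q = x ^ (i + k) * y ^ (j + l)" by (simp add: power_add mult_ac)
    then show "p * q \<in> ac.span ?M" using mono[of "i + k" "j + l"] by (simp add: K_def)
  qed
  have z_power: "z ^ i \<in> K" for i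
    using z mono[of 0 0] by (induction i) (auto simp: K_def[symmetric] intro: K_mult)
  obtain n where n: "\<And>i. x ^ i \<in> ac.span ((\<lambda>k. x ^ k) ` {..<n})" using ac_powers_finite_span by blast
  obtain m where m: "\<And>i. y ^ i \<in> ac.span ((\<lambda>k. y ^ k) ` {..<m})" using ac_powers_finite_span by blast
  let ?W = "(\<lambda>(i, j). x ^ i * y ^ j) ` ({..<n} \<times> {..<m})"
  have "x ^ i * y ^ j \<in> ac.span ?W" for i j
    by (rule ac_span_mult[OF n m]) (auto intro!: ac.span_base)
  then have "?M \<subseteq> ac.span ?W" by auto
  then have KW: "K \<subseteq> ac.span ?W" unfolding K_def by (rule ac.span_minimal[OF _ ac.subspace_span])
  have sq_power: "t ^ i \<in> ac.span (range (\<lambda>k. (t ^ 2) ^ k))" if "t \<in> sep_closure" for t :: "'r alg_closure" and i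
  proof (induction i)
    case 0
    show ?case by (rule ac.span_base) (auto intro: image_eqI[of _ _ 0])
  next
    case (Suc i)
    obtain q :: "'r poly" where "t = ac_poly q (t ^ 2)" using \<open>t \<in> _\<close> sep_closure_iff by blast
    then have "t \<in> ac.span (range (\<lambda>k. (t ^ 2) ^ k))" using ac_poly_in_span by metis
    then have "t * t ^ i \<in> ac.span (range (\<lambda>k. (t ^ 2) ^ k))"
      by (rule ac_span_mult[OF _ Suc]) (auto simp flip: power_add intro: ac.span_base)
    then show ?case by simp
  qed
  have "x ^ i * y ^ j \<in> ac.span (?sq ` K)" for i j
  proof (rule ac_span_mult[OF sq_power[OF x] sq_power[OF y]])
    fix p q assume "p \<in> range (\<lambda>k. (x ^ 2) ^ k)" "q \<in> range (\<lambda>k. (y ^ 2) ^ k)"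
    then obtain k l where "p * q = ?sq (x ^ k * y ^ l)"
      by (auto simp: power_mult_distrib mult.commute simp flip: power_mult)
    then show "p * q \<in> ac.span (?sq ` K)" using mono by (auto intro: ac.span_base)
  qed
  then have "?M \<subseteq> ac.span (?sq ` K)" by auto
  then have KK: "K \<subseteq> ac.span (?sq ` K)" unfolding K_def by (rule ac.span_minimal[OF _ ac.subspace_span])
  let ?P = "range (\<lambda>i::nat. z ^ i)"
  define V where "V = ac.span ?P"
  have VK: "V \<subseteq> K" unfolding V_def K_def
    by (rule ac.span_minimal[OF _ ac.subspace_span]) (use z_power in \<open>auto simp: K_def\<close>)
  have "?sq ` ?P \<subseteq> ?P" by (auto simp flip: power_mult)
  then have sqV: "?sq ` V \<subseteq> V" using ac_square_span ac.span_mono[of "?sq ` ?P" ?P] unfolding V_def by blast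
  have "V \<subseteq> ac.span (?sq ` V)" by (rule squares_span[OF _ KW KK VK sqV]) simp
  moreover have "?sq ` V \<subseteq> ac.span (range (\<lambda>i. (z ^ 2) ^ i))"
  proof -
    have "?sq ` ?P = range (\<lambda>i. (z ^ 2) ^ i)" by (simp add: image_image mult.commute flip: power_mult)
    then show ?thesis using ac_square_span[of _ ?P] unfolding V_def by auto
  qed
  then have "ac.span (?sq ` V) \<subseteq> ac.span (range (\<lambda>i. (z ^ 2) ^ i))"
    by (rule ac.span_minimal[OF _ ac.subspace_span])
  moreover have "z \<in> V" unfolding V_def by (rule ac.span_base) (auto intro: image_eqI[of _ _ 1])
  ultimately have "z \<in> ac.span (range (\<lambda>i. (z ^ 2) ^ i))" by blast
  then show ?thesis using sep_closure_iff ac_span_powersE by metis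
qed

lemma to_ac_in_sep_closure: "to_ac (c :: 'r) \<in> sep_closure"
  unfolding sep_closure_iff by (rule exI[of _ "[:c:]"]) simp

lemma sep_closure_add: "x \<in> sep_closure \<Longrightarrow> y \<in> sep_closure \<Longrightarrow> x + y \<in> (sep_closure :: 'r alg_closure set)"
  and sep_closure_mult: "x \<in> sep_closure \<Longrightarrow> y \<in> sep_closure \<Longrightarrow> x * y \<in> (sep_closure :: 'r alg_closure set)"
proof -
  assume xy: "x \<in> sep_closure" "y \<in> (sep_closure :: 'r alg_closure set)"
  have 1: "x ^ i * y ^ j \<in> ac.span (range (\<lambda>(i, j). x ^ i * y ^ j))" for i j
    by (rule ac.span_base) auto
  show "x + y \<in> sep_closure" using ac.span_add[OF 1[of 1 0] 1[of 0 1]] by (intro sep_closure_span[OF xy]) simp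
  show "x * y \<in> sep_closure" using 1[of 1 1] by (intro sep_closure_span[OF xy]) simp
qed

lemma sep_closure_zero: "0 \<in> (sep_closure :: 'r alg_closure set)"
  and sep_closure_one: "1 \<in> (sep_closure :: 'r alg_closure set)"
  using to_ac_in_sep_closure[of 0] to_ac_in_sep_closure[of 1] by simp_all

lemma sep_closure_power: "x \<in> sep_closure \<Longrightarrow> x ^ n \<in> (sep_closure :: 'r alg_closure set)"
  by (induction n) (auto intro: sep_closure_one sep_closure_mult)

lemma sep_closure_poly:
  assumes "x \<in> (sep_closure :: 'r alg_closure set)"
  shows "ac_poly f x \<in> sep_closure"
  by (induction f) (auto simp: sep_closure_zero intro!: sep_closure_add sep_closure_mult to_ac_in_sep_closure assms)

lemma sep_closure_inverse:
  assumes "x \<in> (sep_closure :: 'r alg_closure set)"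
  shows "inverse x \<in> sep_closure"
proof (cases "x = 0")
  case False
  obtain c f where cf: "c \<noteq> 0" "ac_poly (pCons c f) x = 0" using algebraic_constant_term[OF False] .
  have xf: "x * (- ac_poly f x) = to_ac c" using cf(2) by (simp add: add_eq_0_iff)
  have "inverse x = inverse x * (x * (- ac_poly f x)) / to_ac c" unfolding xf using cf(1) by simp
  also have "\<dots> = to_ac (inverse c) * ac_poly f x" using False by (simp add: ac_minus field_simps)
  finally have "inverse x = to_ac (inverse c) * ac_poly f x" .
  then show ?thesis using sep_closure_mult[OF to_ac_in_sep_closure[of "inverse c"] sep_closure_poly[OF assms, of f]] by simp
qed (simp add: sep_closure_zero)

end

text \<open>
  The graph of a homomorphism over \<open>'r\<close> from a subring of the algebraic closure to the algebraic
  closure; such subrings are fields by algebraicity.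
\<close>

definition partial_embedding :: "('r::field alg_closure \<times> 'r alg_closure) set \<Rightarrow> bool" where
  "partial_embedding R \<longleftrightarrow>
     (\<forall>c. (to_ac c, to_ac c) \<in> R) \<and>
     (\<forall>x y x' y'. (x, y) \<in> R \<longrightarrow> (x', y') \<in> R \<longrightarrow> (x + x', y + y') \<in> R \<and> (x * x', y * y') \<in> R) \<and>
     (\<forall>y. (0, y) \<in> R \<longrightarrow> y = 0)"

text \<open>If \<open>R\<close> is the graph of an embedding, g is the polynomial obtained by
  applying the embedding to the coefficients of f.\<close>

definition coeff_related :: "('a::zero \<times> 'b::zero) set \<Rightarrow> 'a poly \<Rightarrow> 'b poly \<Rightarrow> bool" where
  "coeff_related R f g \<longleftrightarrow> (\<forall>n. (coeff f n, coeff g n) \<in> R)"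

context
  fixes R :: "('r::field alg_closure \<times> 'r alg_closure) set"
  assumes R: "partial_embedding R"
begin

lemma pe_const: "(to_ac c, to_ac c) \<in> R"
  and pe_add: "(x, y) \<in> R \<Longrightarrow> (x', y') \<in> R \<Longrightarrow> (x + x', y + y') \<in> R"
  and pe_mult: "(x, y) \<in> R \<Longrightarrow> (x', y') \<in> R \<Longrightarrow> (x * x', y * y') \<in> R"
  and pe_zeroD: "(0, y) \<in> R \<Longrightarrow> y = 0"
  using R by (auto simp: partial_embedding_def)

lemma pe_zero: "(0, 0) \<in> R"
  using pe_const[of 0] by simp

lemma pe_one: "(1, 1) \<in> R"
  using pe_const[of 1] by simp

lemma pe_minus: "(x, y) \<in> R \<Longrightarrow> (- x, - y) \<in> R"
  using pe_mult[OF pe_const[of "- 1"]] by simp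

lemma pe_diff: "(x, y) \<in> R \<Longrightarrow> (x', y') \<in> R \<Longrightarrow> (x - x', y - y') \<in> R"
  using pe_add[OF _ pe_minus] by fastforce

lemma pe_unique: "(x, y) \<in> R \<Longrightarrow> (x, y') \<in> R \<Longrightarrow> y = y'"
  using pe_diff[of x y x y'] pe_zeroD by fastforce

lemma pe_sum: "(\<And>i. i \<in> I \<Longrightarrow> (f i, g i) \<in> R) \<Longrightarrow> (sum f I, sum g I) \<in> R"
  by (induction I rule: infinite_finite_induct) (auto intro: pe_zero pe_add)

lemma pe_ac_poly: "(x, y) \<in> R \<Longrightarrow> (ac_poly f x, ac_poly f y) \<in> R"
  by (induction f) (auto intro: pe_zero pe_add pe_mult pe_const)

text \<open>x and y satisfy the same equation over the base field, with non-zero constant term; the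
  polynomial expression for the inverse that it yields is therefore the same for both.\<close>

lemma pe_inverse:
  assumes xy: "(x, y) \<in> R" and x: "x \<noteq> 0"
  shows "y \<noteq> 0" "(inverse x, inverse y) \<in> R"
proof -
  obtain c f where cf: "c \<noteq> 0" "ac_poly (pCons c f) x = 0" using algebraic_constant_term[OF x] .
  have y0: "ac_poly (pCons c f) y = 0" using pe_ac_poly[OF xy, of "pCons c f"] cf(2) pe_zeroD by simp
  show y: "y \<noteq> 0" using y0 cf(1) by auto
  have inv: "inverse z = - ac_poly f z * inverse (to_ac c)" if "z \<noteq> 0" "ac_poly (pCons c f) z = 0" for z
  proof -
    have zf: "z * (- ac_poly f z) = to_ac c" using that(2) by (simp add: add_eq_0_iff)
    have "inverse z = inverse z * (z * (- ac_poly f z)) * inverse (to_ac c)" unfolding zf using cf(1) by simp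
    also have "\<dots> = - ac_poly f z * inverse (to_ac c)" using that(1) by simp
    finally show ?thesis .
  qed
  show "(inverse x, inverse y) \<in> R"
    unfolding inv[OF x cf(2)] inv[OF y y0]
    using pe_mult[OF pe_minus[OF pe_ac_poly[OF xy]] pe_const[of "inverse c"]] by simp
qed

lemma related_zero: "coeff_related R 0 0"
  by (simp add: coeff_related_def pe_zero)

lemma related_add: "coeff_related R f f' \<Longrightarrow> coeff_related R g g' \<Longrightarrow> coeff_related R (f + g) (f' + g')"
  by (simp add: coeff_related_def pe_add)

lemma related_diff: "coeff_related R f f' \<Longrightarrow> coeff_related R g g' \<Longrightarrow> coeff_related R (f - g) (f' - g')"
  by (simp add: coeff_related_def pe_diff)

lemma related_mult: "coeff_related R f f' \<Longrightarrow> coeff_related R g g' \<Longrightarrow> coeff_related R (f * g) (f' * g')"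
  by (simp add: coeff_related_def coeff_mult pe_sum pe_mult)

lemma related_monom: "(c, c') \<in> R \<Longrightarrow> coeff_related R (monom c n) (monom c' n)"
  by (simp add: coeff_related_def coeff_monom pe_zero)

lemma related_const: "(c, c') \<in> R \<Longrightarrow> coeff_related R [:c:] [:c':]"
  by (simp add: coeff_related_def coeff_pCons pe_zero split: nat.splits)

lemma related_X: "coeff_related R [:0, 1:] [:0, 1:]"
  by (simp add: coeff_related_def coeff_pCons pe_zero pe_one split: nat.splits)

lemma related_ac_poly: "coeff_related R (map_poly to_ac f) (map_poly to_ac f)"
  by (simp add: coeff_related_def coeff_map_poly pe_const)

lemma related_zeroD: "coeff_related R 0 g \<Longrightarrow> g = 0"
  by (intro poly_eqI) (simp add: coeff_related_def pe_zeroD)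

text \<open>Division with remainder, carried out in parallel for a polynomial and its image, so that
  quotients and remainders stay related.\<close>

lemma related_divide:
  assumes m: "coeff_related R m m'" "m \<noteq> 0" and f: "coeff_related R f f'"
  shows "\<exists>q q' r r'. coeff_related R q q' \<and> coeff_related R r r' \<and> f = q * m + r \<and> f' = q' * m' + r' \<and>
    (r = 0 \<or> degree r < degree m)"
  using f
\<comment> \<open>The zero polynomial has measure 0 and the others degree plus one, so that the step
  from a non-zero constant to 0 counts as a decrease.\<close>
proof (induction "if f = 0 then 0 else Suc (degree f)" arbitrary: f f' rule: less_induct)
  case less
  show ?case
  proof (cases "f = 0 \<or> degree f < degree m")
    case True
    then show ?thesis using less.prems related_zero
      by (intro exI[of _ 0] exI[of _ 0] exI[of _ f] exI[of _ f']) auto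
  next
    case False
    define k where "k = degree f - degree m"
    define c where "c = coeff f (degree f) * inverse (coeff m (degree m))"
    define c' where "c' = coeff f' (degree f) * inverse (coeff m' (degree m))"
    have cf: "(coeff f n, coeff f' n) \<in> R" and cm: "(coeff m n, coeff m' n) \<in> R" for n
      using less.prems m(1) by (simp_all add: coeff_related_def)
    have "(c, c') \<in> R" unfolding c_def c'_def
      by (rule pe_mult[OF cf pe_inverse(2)[OF cm]]) (use m(2) in simp)
    then have cc: "coeff_related R (monom c k) (monom c' k)" by (rule related_monom)
    define g where "g = f - monom c k * m"
    define g' where "g' = f' - monom c' k * m'"
    have gg: "coeff_related R g g'" unfolding g_def g'_def by (intro related_diff related_mult less.prems cc m)
    have "coeff g (degree f) = 0"
      using False m(2) by (simp add: g_def c_def k_def coeff_monom_mult)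
    moreover have "degree g \<le> degree f"
    proof -
      have "degree (monom c k * m) \<le> k + degree m" by (meson add_mono degree_monom_le degree_mult_le order_refl order_trans)
      then show ?thesis unfolding g_def using False by (intro degree_diff_le) (auto simp: k_def)
    qed
    ultimately have "g = 0 \<or> degree g < degree f"
      by (metis le_neq_implies_less leading_coeff_0_iff)
    then have "(if g = 0 then 0 else Suc (degree g)) < (if f = 0 then 0 else Suc (degree f))"
      using False by auto
    then obtain q q' r r' where *: "coeff_related R q q'" "coeff_related R r r'" "g = q * m + r" "g' = q' * m' + r'"
      "r = 0 \<or> degree r < degree m" using less.hyps gg by metis
    have "f = (q + monom c k) * m + r" "f' = (q' + monom c' k) * m' + r'"
      using *(3,4) by (simp_all add: g_def g'_def algebra_simps)
    moreover have "coeff_related R (q + monom c k) (q' + monom c' k)" by (intro related_add * cc)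
    ultimately show ?thesis using *(2,5) by blast
  qed
qed

text \<open>The extension sends f(a) to f'(b). It is well defined: if f(a) = 0, the remainder of f
  modulo m vanishes by minimality, so f' is a multiple of m' and f'(b) = 0.\<close>

lemma pe_adjoin:
  assumes m: "coeff_related R m m'" "m \<noteq> 0" "poly m a = 0" "poly m' b = 0"
    and min: "\<And>f f'. coeff_related R f f' \<Longrightarrow> f \<noteq> 0 \<Longrightarrow> poly f a = 0 \<Longrightarrow> degree m \<le> degree f"
  shows "\<exists>Q. partial_embedding Q \<and> R \<subseteq> Q \<and> (a, b) \<in> Q"
proof -
  define Q where "Q = {(poly f a, poly f' b) | f f'. coeff_related R f f'}"
  have QI: "(poly f a, poly f' b) \<in> Q" if "coeff_related R f f'" for f f' using that by (auto simp: Q_def)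
  have sub: "(x, y) \<in> Q" if "(x, y) \<in> R" for x y using QI[OF related_const[OF that]] by simp
  have "y = 0" if y: "(0, y) \<in> Q" for y
  proof -
    obtain f f' where f: "coeff_related R f f'" "0 = poly f a" "y = poly f' b" using y by (auto simp: Q_def)
    obtain q q' r r' where *: "coeff_related R q q'" "coeff_related R r r'" "f = q * m + r" "f' = q' * m' + r'"
      "r = 0 \<or> degree r < degree m" using related_divide[OF m(1,2) f(1)] by blast
    have "poly r a = 0" using f(2) m(3) *(3) by simp
    then have "r = 0" using min[OF *(2)] *(5) by (metis not_le)
    then have "r' = 0" using related_zeroD *(2) by simp
    then show ?thesis using f(3) *(4) m(4) by simp
  qed
  moreover have "(x + x', y + y') \<in> Q \<and> (x * x', y * y') \<in> Q" if xy: "(x, y) \<in> Q" "(x', y') \<in> Q" for x y x' y'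
  proof -
    obtain f f' g g' where "coeff_related R f f'" "x = poly f a" "y = poly f' b"
      "coeff_related R g g'" "x' = poly g a" "y' = poly g' b" using xy by (auto simp: Q_def)
    then show ?thesis using QI[OF related_add] QI[OF related_mult] by (metis poly_add poly_mult)
  qed
  ultimately have "partial_embedding Q" unfolding partial_embedding_def using sub[OF pe_const] by blast
  moreover have "(a, b) \<in> Q" using QI[OF related_X] by simp
  ultimately show ?thesis using sub by (intro exI[of _ Q]) auto
qed

lemma pe_minimal_polynomial:
  obtains m m' where "coeff_related R m m'" "m \<noteq> 0" "poly m a = 0" "degree m > 0"
    "\<And>f f'. coeff_related R f f' \<Longrightarrow> f \<noteq> 0 \<Longrightarrow> poly f a = 0 \<Longrightarrow> degree m \<le> degree f"
proof -
  let ?P = "\<lambda>(f, f'). coeff_related R f f' \<and> f \<noteq> 0 \<and> poly f a = 0"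
  obtain g :: "'r poly" where g: "g \<noteq> 0" "ac_poly g a = 0" using alg_closure_algebraic by metis
  have "map_poly to_ac g \<noteq> 0" using g(1) by (simp add: map_poly_eq_0_iff)
  then have "?P (map_poly to_ac g, map_poly to_ac g)" using g related_ac_poly by simp
  from ex_has_least_nat[of ?P, OF this, of "\<lambda>(f, f'). degree f"]
  obtain m m' where m: "coeff_related R m m'" "m \<noteq> 0" "poly m a = 0"
    and min: "\<And>f f'. coeff_related R f f' \<Longrightarrow> f \<noteq> 0 \<Longrightarrow> poly f a = 0 \<Longrightarrow> degree m \<le> degree f" by force
  have "degree m > 0"
  proof (rule ccontr)
    assume "\<not> degree m > 0"
    then obtain c where "m = [:c:]" using degree_eq_zeroE[of m] by auto
    then show False using m by simp
  qed
  then show ?thesis using that m min by blast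
qed

text \<open>The embedding keeps the leading coefficient of the minimal polynomial non-zero, so the
  image m' is not constant and has a root b.\<close>

lemma pe_extend_domain: "\<exists>Q b. partial_embedding Q \<and> R \<subseteq> Q \<and> (a, b) \<in> Q"
proof -
  obtain m m' where m: "coeff_related R m m'" "m \<noteq> 0" "poly m a = 0" "degree m > 0"
    "\<And>f f'. coeff_related R f f' \<Longrightarrow> f \<noteq> 0 \<Longrightarrow> poly f a = 0 \<Longrightarrow> degree m \<le> degree f"
    using pe_minimal_polynomial by metis
  have "(coeff m (degree m), coeff m' (degree m)) \<in> R" using m(1) by (simp add: coeff_related_def)
  then have "coeff m' (degree m) \<noteq> 0" using pe_inverse(1) m(2) by simp
  then have "degree m' > 0" using le_degree[of m' "degree m"] m(4) by simp
  then obtain b where "poly m' b = 0" using alg_closed_imp_poly_has_root by blast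
  then have "\<exists>Q. partial_embedding Q \<and> R \<subseteq> Q \<and> (a, b) \<in> Q"
    by (rule pe_adjoin[OF m(1-3)]) (rule m(5))
  then show ?thesis by blast
qed

end

section \<open>Automorphisms over the base field and the Galois group\<close>

definition ac_endomorphism :: "('r::field alg_closure \<Rightarrow> 'r alg_closure) \<Rightarrow> bool" where
  "ac_endomorphism \<sigma> \<longleftrightarrow> (\<forall>x y. \<sigma> (x + y) = \<sigma> x + \<sigma> y) \<and> (\<forall>x y. \<sigma> (x * y) = \<sigma> x * \<sigma> y) \<and> (\<forall>c. \<sigma> (to_ac c) = to_ac c)"

text \<open>Zorn's lemma; a maximal partial embedding is defined everywhere by
  \<open>pe_extend_domain\<close>.\<close>

lemma partial_embedding_extends:
  assumes "partial_embedding R"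
  shows "\<exists>\<sigma>. ac_endomorphism \<sigma> \<and> (\<forall>(x, y)\<in>R. \<sigma> x = y)"
proof -
  let ?A = "{Q. partial_embedding Q \<and> R \<subseteq> Q}"
  have "\<exists>M\<in>?A. \<forall>X'\<in>?A. M \<subseteq> X' \<longrightarrow> X' = M"
  proof (rule subset_Zorn_nonempty)
    show "?A \<noteq> {}" using assms by auto
  next
    fix C assume C: "C \<noteq> {}" "subset.chain ?A C"
    then have CA: "\<And>Q. Q \<in> C \<Longrightarrow> partial_embedding Q \<and> R \<subseteq> Q"
      and lin: "\<And>Q Q'. Q \<in> C \<Longrightarrow> Q' \<in> C \<Longrightarrow> Q \<subseteq> Q' \<or> Q' \<subseteq> Q"
      by (auto simp: subset_chain_def)
    obtain Q0 where Q0: "Q0 \<in> C" using C(1) by blast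
    have "(x + x', y + y') \<in> \<Union>C \<and> (x * x', y * y') \<in> \<Union>C" if xy: "(x, y) \<in> \<Union>C" "(x', y') \<in> \<Union>C" for x y x' y'
    proof -
      obtain Q Q' where "Q \<in> C" "(x, y) \<in> Q" "Q' \<in> C" "(x', y') \<in> Q'" using xy by blast
      then obtain Q where "Q \<in> C" "(x, y) \<in> Q" "(x', y') \<in> Q" using lin[of Q Q'] by blast
      then show ?thesis using CA pe_add pe_mult by blast
    qed
    moreover have "(to_ac c, to_ac c) \<in> \<Union>C" for c using Q0 CA pe_const by blast
    moreover have "y = 0" if "(0, y) \<in> \<Union>C" for y using that CA pe_zeroD by blast
    ultimately have "partial_embedding (\<Union>C)" unfolding partial_embedding_def by blast
    then show "\<Union>C \<in> ?A" using Q0 CA by blast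
  qed
  then obtain M where M: "partial_embedding M" "R \<subseteq> M"
    and max: "\<And>Q. partial_embedding Q \<Longrightarrow> M \<subseteq> Q \<Longrightarrow> Q = M" by auto
  have "\<exists>y. (x, y) \<in> M" for x using pe_extend_domain[OF M(1), of x] max by blast
  then obtain \<sigma> where \<sigma>: "\<And>x. (x, \<sigma> x) \<in> M" by metis
  have eq: "\<sigma> x = y" if "(x, y) \<in> M" for x y using pe_unique[OF M(1) \<sigma> that] .
  have "ac_endomorphism \<sigma>" unfolding ac_endomorphism_def
    using eq[OF pe_add[OF M(1) \<sigma> \<sigma>]] eq[OF pe_mult[OF M(1) \<sigma> \<sigma>]] eq[OF pe_const[OF M(1)]] by blast
  then show ?thesis using eq M(2) by blast
qed

text \<open>By separability a is a simple root of its minimal polynomial m = (X - a) n over the base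
  field, and n is not constant because a is not in that field. A root b of n is a conjugate
  different from a.\<close>

lemma separable_moved:
  fixes a :: "'r::field alg_closure"
  assumes a: "a \<in> sep_closure" "a \<notin> range to_ac"
  shows "\<exists>\<sigma>. ac_endomorphism \<sigma> \<and> \<sigma> a \<noteq> a"
proof -
  define R where "R = range (\<lambda>c::'r. (to_ac c, to_ac c))"
  have R: "partial_embedding R"
    by (auto simp: partial_embedding_def R_def simp flip: to_ac_add to_ac_mult)
  obtain m m' where m: "coeff_related R m m'" "m \<noteq> 0" "poly m a = 0" "degree m > 0"
    and min: "\<And>f f'. coeff_related R f f' \<Longrightarrow> f \<noteq> 0 \<Longrightarrow> poly f a = 0 \<Longrightarrow> degree m \<le> degree f"
    using pe_minimal_polynomial[OF R] by metis
  have m'm: "m' = m" using m(1) unfolding coeff_related_def R_def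
    by (intro poly_eqI) (metis (no_types, lifting) Pair_inject rangeE)
  obtain f :: "'r poly" where f: "coprime f (pderiv f)" "ac_poly f a = 0" using a(1) by (auto simp: sep_closure_def)
  obtain q q' r r' where qr: "coeff_related R r r'" "map_poly to_ac f = q * m + r" "r = 0 \<or> degree r < degree m"
    using related_divide[OF R m(1,2) related_ac_poly[OF R, of f]] by blast
  have "poly r a = 0" using qr(2) f(2) m(3) by simp
  then have "r = 0" using min[OF qr(1)] qr(3) by (metis not_le)
  then have "poly (pderiv (map_poly to_ac f)) a = poly q a * poly (pderiv m) a"
    using qr(2) m(3) by (simp add: pderiv_mult)
  moreover have "poly (pderiv (map_poly to_ac f)) a \<noteq> 0" using coprime_no_common_root[OF f] by simp
  ultimately have m1: "poly (pderiv m) a \<noteq> 0" by auto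
  obtain n where n: "m = [:- a, 1:] * n" using m(3) by (auto simp: poly_eq_0_iff_dvd elim: dvdE)
  have "poly (pderiv m) a = poly n a"
    unfolding n pderiv_mult by (simp only: poly_add poly_mult) (simp add: pderiv_pCons)
  then have na: "poly n a \<noteq> 0" using m1 by simp
  have "degree n > 0"
  proof (rule ccontr)
    assume "\<not> degree n > 0"
    then obtain c where c: "n = [:c:]" using degree_eq_zeroE[of n] by auto
    have "coeff m 1 \<in> range to_ac" "coeff m 0 \<in> range to_ac" using m(1) by (auto simp: coeff_related_def R_def)
    then have "c \<in> range to_ac" "- (a * c) \<in> range to_ac" by (simp_all add: n c mult.commute)
    then obtain d e where "c = to_ac d" "- (a * c) = to_ac e" by blast
    then have "a * to_ac d = - to_ac e" "to_ac d \<noteq> 0" using na c by (metis minus_minus, auto)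
    then have "a = to_ac (- e / d)" by (simp add: field_simps)
    then show False using a(2) by blast
  qed
  then obtain b where b: "poly n b = 0" using alg_closed_imp_poly_has_root by blast
  then have "poly m' b = 0" "b \<noteq> a" using na m'm n by auto
  have "\<exists>Q. partial_embedding Q \<and> R \<subseteq> Q \<and> (a, b) \<in> Q"
    by (rule pe_adjoin[OF R m(1-3) \<open>poly m' b = 0\<close>]) (rule min)
  then obtain Q where "partial_embedding Q" "(a, b) \<in> Q" by blast
  then obtain \<sigma> where "ac_endomorphism \<sigma>" "\<forall>(x, y)\<in>Q. \<sigma> x = y" using partial_embedding_extends by blast
  then have "ac_endomorphism \<sigma> \<and> \<sigma> a \<noteq> a" using \<open>(a, b) \<in> Q\<close> \<open>b \<noteq> a\<close> by auto
  then show ?thesis by blast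
qed

context
  fixes \<sigma> :: "'r::field alg_closure \<Rightarrow> 'r alg_closure"
  assumes \<sigma>: "ac_endomorphism \<sigma>"
begin

lemma endo_add: "\<sigma> (x + y) = \<sigma> x + \<sigma> y" and endo_mult: "\<sigma> (x * y) = \<sigma> x * \<sigma> y"
  and endo_const: "\<sigma> (to_ac c) = to_ac c"
  using \<sigma> by (auto simp: ac_endomorphism_def)

lemma endo_ac_poly: "\<sigma> (ac_poly f x) = ac_poly f (\<sigma> x)"
  using endo_const[of 0] by (induction f) (auto simp: endo_add endo_mult endo_const)

lemma endo_inj: "inj \<sigma>"
proof (rule injI)
  fix x y assume eq: "\<sigma> x = \<sigma> y"
  have "\<sigma> (x - y) + \<sigma> y = \<sigma> x" by (simp flip: endo_add)
  then have 0: "\<sigma> (x - y) = 0" using eq by simp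
  show "x = y"
  proof (rule ccontr)
    assume "x \<noteq> y"
    then have "\<sigma> ((x - y) * inverse (x - y)) = 1" using endo_const[of 1] by simp
    then show False unfolding endo_mult 0 by simp
  qed
qed

lemma endo_sep_closure: "x \<in> sep_closure \<Longrightarrow> \<sigma> x \<in> sep_closure"
proof -
  assume "x \<in> sep_closure"
  then obtain f :: "'r poly" where f: "f \<noteq> 0" "coprime f (pderiv f)" "ac_poly f x = 0"
    by (auto simp: sep_closure_def)
  then have "ac_poly f (\<sigma> x) = 0" using endo_ac_poly[of f x] endo_const[of 0] by simp
  then show ?thesis using f by (auto simp: sep_closure_def)
qed

text \<open>Surjectivity holds because an injective endomorphism permutes the finitely many roots of
  each separable polynomial over the base field.\<close>

lemma endo_bij_sep_closure: "bij_betw \<sigma> sep_closure sep_closure"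
proof -
  have "x \<in> \<sigma> ` sep_closure" if x: "x \<in> sep_closure" for x
  proof -
    obtain f :: "'r poly" where f: "f \<noteq> 0" "coprime f (pderiv f)" "ac_poly f x = 0"
      using x by (auto simp: sep_closure_def)
    let ?S = "{z. ac_poly f z = 0}"
    have fin: "finite ?S" using f(1) by (intro poly_roots_finite) (simp add: map_poly_eq_0_iff)
    have sub: "\<sigma> ` ?S \<subseteq> ?S"
    proof (rule image_subsetI)
      fix z assume "z \<in> ?S"
      then show "\<sigma> z \<in> ?S" using endo_ac_poly[of f z] endo_const[of 0] by simp
    qed
    have "\<sigma> ` ?S = ?S" by (rule endo_inj_surj[OF fin sub inj_on_subset[OF endo_inj subset_UNIV]])
    then have "x \<in> \<sigma> ` ?S" using f(3) by simp
    then obtain y where "ac_poly f y = 0" "\<sigma> y = x" by auto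
    then show ?thesis using f(1,2) by (auto simp: sep_closure_def)
  qed
  then have "\<sigma> ` sep_closure = sep_closure" using endo_sep_closure by blast
  then show ?thesis using inj_on_subset[OF endo_inj subset_UNIV] by (simp add: bij_betw_def)
qed

end

lemma galois_group_iff:
  "\<sigma> \<in> galois_group \<longleftrightarrow>
     \<sigma> \<in> extensional sep_closure \<and> bij_betw \<sigma> sep_closure sep_closure \<and> (\<forall>c. \<sigma> (to_ac c) = to_ac c) \<and>
     (\<forall>x\<in>sep_closure. \<forall>y\<in>sep_closure. \<sigma> (x + y) = \<sigma> x + \<sigma> y \<and> \<sigma> (x * y) = \<sigma> x * \<sigma> y)"
proof -
  have "\<sigma> 1 = 1" if "\<forall>c. \<sigma> (to_ac c) = to_ac c" using that[rule_format, of 1] by simp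
  then show ?thesis
    using bij_betw_apply[of \<sigma> sep_closure sep_closure]
    by (auto simp: galois_group_def ring_iso_def ring_hom_def sep_closure_ring_def ring_of_type_algebra_def)
qed

context
  fixes T :: "'r::field itself"
  assumes char2: "CHAR('r) = 2"
begin

lemma endo_restrict_galois:
  assumes "ac_endomorphism (\<sigma> :: 'r alg_closure \<Rightarrow> _)"
  shows "restrict \<sigma> sep_closure \<in> galois_group"
  unfolding galois_group_iff
  using endo_bij_sep_closure[OF assms] endo_add[OF assms] endo_mult[OF assms] endo_const[OF assms]
  by (auto simp: to_ac_in_sep_closure[OF char2] sep_closure_add[OF char2] sep_closure_mult[OF char2]
      cong: bij_betw_cong)

lemma galois_fixed:
  fixes a :: "'r alg_closure"
  assumes a: "a \<in> sep_closure" and fixed: "\<And>\<sigma>. \<sigma> \<in> galois_group \<Longrightarrow> \<sigma> a = a"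
  shows "a \<in> range to_ac"
proof (rule ccontr)
  assume "a \<notin> range to_ac"
  then obtain \<sigma> where "ac_endomorphism \<sigma>" "\<sigma> a \<noteq> a" using separable_moved[OF a] by blast
  then show False using fixed[OF endo_restrict_galois] a by fastforce
qed

lemma galois_compose:
  fixes \<sigma> \<tau> :: "'r alg_closure \<Rightarrow> 'r alg_closure"
  assumes "\<sigma> \<in> galois_group" "\<tau> \<in> galois_group"
  shows "compose sep_closure \<sigma> \<tau> \<in> galois_group"
  using assms bij_betw_apply[of \<tau> sep_closure sep_closure] bij_betw_compose[of \<tau> sep_closure sep_closure \<sigma> sep_closure]
  unfolding galois_group_iff
  by (auto simp: compose_def to_ac_in_sep_closure[OF char2] sep_closure_add[OF char2] sep_closure_mult[OF char2])

lemma galois_inverse: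
  fixes \<sigma> :: "'r alg_closure \<Rightarrow> 'r alg_closure"
  assumes \<sigma>: "\<sigma> \<in> galois_group"
  obtains \<tau> where "\<tau> \<in> galois_group" "\<And>x. x \<in> sep_closure \<Longrightarrow> \<tau> (\<sigma> x) = x" "\<And>x. x \<in> sep_closure \<Longrightarrow> \<sigma> (\<tau> x) = x"
proof -
  let ?A = "sep_closure :: 'r alg_closure set"
  have b: "bij_betw \<sigma> ?A ?A" using \<sigma> by (simp add: galois_group_iff)
  define \<tau> where "\<tau> = restrict (inv_into ?A \<sigma>) ?A"
  have l: "\<tau> (\<sigma> x) = x" if "x \<in> ?A" for x
    using that b bij_betw_apply[OF b that] by (simp add: \<tau>_def bij_betw_def)
  have \<tau>A: "\<tau> x \<in> ?A" and r: "\<sigma> (\<tau> x) = x" if "x \<in> ?A" for x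
    using that b by (auto simp: \<tau>_def bij_betw_def inv_into_into f_inv_into_f)
  have "bij_betw \<tau> ?A ?A" using b bij_betw_inv_into[OF b] by (simp add: \<tau>_def cong: bij_betw_cong)
  moreover have "\<tau> (to_ac c) = to_ac c" for c
    using l[OF to_ac_in_sep_closure[OF char2, of c]] \<sigma> by (simp add: galois_group_iff)
  moreover have "\<tau> (x + y) = \<tau> x + \<tau> y \<and> \<tau> (x * y) = \<tau> x * \<tau> y" if xy: "x \<in> ?A" "y \<in> ?A" for x y
  proof -
    have "\<sigma> (\<tau> x + \<tau> y) = x + y" "\<sigma> (\<tau> x * \<tau> y) = x * y"
      using \<sigma> xy \<tau>A r by (auto simp: galois_group_iff)
    then show ?thesis using l sep_closure_add[OF char2 \<tau>A \<tau>A, OF xy] sep_closure_mult[OF char2 \<tau>A \<tau>A, OF xy] by metis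
  qed
  ultimately have "\<tau> \<in> galois_group" unfolding galois_group_iff by (auto simp: \<tau>_def)
  then show ?thesis using that l r by blast
qed

end

section \<open>Logarithmic forms and the norm form\<close>

lemma free_coset_eq_iff:
  assumes N: "subgroup N (free_Abelian_group S)"
    and x: "Poly_Mapping.keys x \<subseteq> S" and y: "Poly_Mapping.keys y \<subseteq> S"
  shows "N #>\<^bsub>free_Abelian_group S\<^esub> x = N #>\<^bsub>free_Abelian_group S\<^esub> y \<longleftrightarrow> x - y \<in> N"
proof
  assume "N #>\<^bsub>free_Abelian_group S\<^esub> x = N #>\<^bsub>free_Abelian_group S\<^esub> y"
  then have "x \<in> N #>\<^bsub>free_Abelian_group S\<^esub> y"
    using group.rcos_self[OF group_free_Abelian_group _ N, of x] x by simp
  then show "x - y \<in> N" unfolding r_coset_def by auto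
next
  assume "x - y \<in> N"
  then have "x \<in> N #>\<^bsub>free_Abelian_group S\<^esub> y" unfolding r_coset_def by (auto intro!: bexI[of _ "x - y"])
  then show "N #>\<^bsub>free_Abelian_group S\<^esub> x = N #>\<^bsub>free_Abelian_group S\<^esub> y"
    using group.repr_independence[OF group_free_Abelian_group _ _ N, of x y] y by simp
qed

section \<open>Kaehler differentials and derivations\<close>

lemma kaehler_relationsE [consumes 1, case_names left right leibniz]:
  assumes "r \<in> kaehler_relations A"
    and "\<And>a a' b. r = frag_of (a + a', b) - frag_of (a, b) - frag_of (a', b) \<Longrightarrow> a \<in> A \<Longrightarrow> a' \<in> A \<Longrightarrow> b \<in> A \<Longrightarrow> thesis"
    and "\<And>a b b'. r = frag_of (a, b + b') - frag_of (a, b) - frag_of (a, b') \<Longrightarrow> a \<in> A \<Longrightarrow> b \<in> A \<Longrightarrow> b' \<in> A \<Longrightarrow> thesis"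
    and "\<And>a b c. r = frag_of (a, b * c) - frag_of (a * b, c) - frag_of (a * c, b) \<Longrightarrow> a \<in> A \<Longrightarrow> b \<in> A \<Longrightarrow> c \<in> A \<Longrightarrow> thesis"
  shows thesis
  using assms unfolding kaehler_relations_def by blast

lemma kaehler_relationsI:
  "a \<in> A \<Longrightarrow> a' \<in> A \<Longrightarrow> b \<in> A \<Longrightarrow> frag_of (a + a', b) - frag_of (a, b) - frag_of (a', b) \<in> kaehler_relations A"
  "a \<in> A \<Longrightarrow> b \<in> A \<Longrightarrow> b' \<in> A \<Longrightarrow> frag_of (a, b + b') - frag_of (a, b) - frag_of (a, b') \<in> kaehler_relations A"
  "a \<in> A \<Longrightarrow> b \<in> A \<Longrightarrow> c \<in> A \<Longrightarrow> frag_of (a, b * c) - frag_of (a * b, c) - frag_of (a * c, b) \<in> kaehler_relations A"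
  unfolding kaehler_relations_def by blast+

context
  fixes A :: "'a::comm_ring_1 set"
  assumes A_add: "\<And>x y. x \<in> A \<Longrightarrow> y \<in> A \<Longrightarrow> x + y \<in> A"
    and A_mult: "\<And>x y. x \<in> A \<Longrightarrow> y \<in> A \<Longrightarrow> x * y \<in> A"
begin

lemma kaehler_relations_subset: "kaehler_relations A \<subseteq> carrier (free_Abelian_group (A \<times> A))"
proof
  fix r assume r: "r \<in> kaehler_relations A"
  have *: "r \<in> carrier (free_Abelian_group (A \<times> A))"
    if eq: "r = frag_of k - frag_of l - frag_of m" and k: "k \<in> A \<times> A" "l \<in> A \<times> A" "m \<in> A \<times> A" for k l m
  proof -
    have "Poly_Mapping.keys r \<subseteq> Poly_Mapping.keys (frag_of k - frag_of l) \<union> {m}"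
      unfolding eq using keys_diff[of "frag_of k - frag_of l" "frag_of m"] by simp
    also have "\<dots> \<subseteq> {k, l, m}" using keys_diff[of "frag_of k" "frag_of l"] by auto
    finally show ?thesis using k by auto
  qed
  show "r \<in> carrier (free_Abelian_group (A \<times> A))"
    using r
  proof (cases rule: kaehler_relationsE)
    case (left a a' b)
    show ?thesis by (rule *[OF left(1)]) (use left A_add in simp_all)
  next
    case (right a b b')
    show ?thesis by (rule *[OF right(1)]) (use right A_add in simp_all)
  next
    case (leibniz a b c)
    show ?thesis by (rule *[OF leibniz(1)]) (use leibniz A_mult in simp_all)
  qed
qed

lemma subgroup_kaehler: "subgroup (kaehler_relation_group A) (free_Abelian_group (A \<times> A))"
  unfolding kaehler_relation_group_def
  by (rule group.generate_is_subgroup[OF group_free_Abelian_group kaehler_relations_subset])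

lemma normal_kaehler: "kaehler_relation_group A \<lhd> free_Abelian_group (A \<times> A)"
  by (rule comm_group.subgroup_imp_normal[OF abelian_free_Abelian_group subgroup_kaehler])

lemma comm_group_kaehler: "comm_group (kaehler A)"
  unfolding kaehler_def by (rule comm_group.abelian_FactGroup[OF abelian_free_Abelian_group subgroup_kaehler])

lemma kaehler_form_in: "a \<in> A \<Longrightarrow> b \<in> A \<Longrightarrow> kaehler_form A a b \<in> carrier (kaehler A)"
  by (auto simp: kaehler_form_def kaehler_def carrier_FactGroup)

lemma kaehler_relationI: "r \<in> kaehler_relations A \<Longrightarrow> r \<in> kaehler_relation_group A"
  unfolding kaehler_relation_group_def by (rule generate.incl)

lemma kaehler_form_eq_iff:
  assumes "a \<in> A" "b \<in> A" "a' \<in> A" "b' \<in> A"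
  shows "kaehler_form A a b = kaehler_form A a' b' \<longleftrightarrow> frag_of (a, b) - frag_of (a', b') \<in> kaehler_relation_group A"
  unfolding kaehler_form_def using assms by (intro free_coset_eq_iff subgroup_kaehler) auto

lemma kaehler_form_leibniz:
  assumes "a \<in> A" "x \<in> A" "y \<in> A"
  shows "kaehler_form A (a * x) y \<otimes>\<^bsub>kaehler A\<^esub> kaehler_form A (a * y) x = kaehler_form A a (x * y)"
proof -
  let ?N = "kaehler_relation_group A" and ?F = "free_Abelian_group (A \<times> A)"
  have "?N #>\<^bsub>?F\<^esub> (frag_of (a * x, y) + frag_of (a * y, x)) = ?N #>\<^bsub>?F\<^esub> frag_of (a, x * y)"
  proof -
    have "frag_of (a, x * y) - frag_of (a * x, y) - frag_of (a * y, x) \<in> ?N"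
      using assms by (intro kaehler_relationI kaehler_relationsI)
    then have "frag_of (a, x * y) - (frag_of (a * x, y) + frag_of (a * y, x)) \<in> ?N" by (simp add: diff_diff_eq)
    moreover have "Poly_Mapping.keys (frag_of (a * x, y) + frag_of (a * y, x)) \<subseteq> A \<times> A"
      using keys_add[of "frag_of (a * x, y)" "frag_of (a * y, x)"] assms A_mult by auto
    moreover have "Poly_Mapping.keys (frag_of (a, x * y)) \<subseteq> A \<times> A" using assms A_mult by auto
    ultimately show ?thesis using free_coset_eq_iff[OF subgroup_kaehler] by metis
  qed
  moreover have "(?N #>\<^bsub>?F\<^esub> frag_of (a * x, y)) \<otimes>\<^bsub>kaehler A\<^esub> (?N #>\<^bsub>?F\<^esub> frag_of (a * y, x))
    = ?N #>\<^bsub>?F\<^esub> (frag_of (a * x, y) + frag_of (a * y, x))"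
    using normal.rcos_sum[OF normal_kaehler, of "frag_of (a * x, y)" "frag_of (a * y, x)"] assms A_mult
    by (simp add: kaehler_def FactGroup_def)
  ultimately show ?thesis by (simp add: kaehler_form_def)
qed

text \<open>a d(y^2) = a y dy + a y dy = (a y + a y) dy = 0 dy, and the additivity relation for 0 +
  0 kills 0 dy.\<close>

lemma kaehler_form_square:
  assumes A0: "0 \<in> A" and two: "\<And>x. x \<in> A \<Longrightarrow> x + x = 0" and a: "a \<in> A" "y \<in> A"
  shows "kaehler_form A a (y * y) = \<one>\<^bsub>kaehler A\<^esub>"
proof -
  let ?N = "kaehler_relation_group A" and ?F = "free_Abelian_group (A \<times> A)"
  define b where "b = a * y"
  have b: "b \<in> A" "b + b = 0" using a A_mult two by (simp_all add: b_def)
  have r1: "frag_of (a, y * y) - frag_of (b, y) - frag_of (b, y) \<in> ?N"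
    unfolding b_def using a by (intro kaehler_relationI kaehler_relationsI)
  have r2: "frag_of (b + b, y) - frag_of (b, y) - frag_of (b, y) \<in> ?N"
    using a b by (intro kaehler_relationI kaehler_relationsI)
  have r3: "frag_of (0 + 0, y) - frag_of (0, y) - frag_of (0, y) \<in> ?N"
    using a A0 by (intro kaehler_relationI kaehler_relationsI)
  have closed: "r - s \<in> ?N" if "r \<in> ?N" "s \<in> ?N" for r s
  proof -
    have "inv\<^bsub>?F\<^esub> s = - s" using subgroup.mem_carrier[OF subgroup_kaehler that(2)] by simp
    then have "- s \<in> ?N" using subgroup.m_inv_closed[OF subgroup_kaehler that(2)] by simp
    from subgroup.m_closed[OF subgroup_kaehler that(1) this] show ?thesis by simp
  qed
  have "frag_of (a, y * y) = (frag_of (a, y * y) - frag_of (b, y) - frag_of (b, y))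
    - (frag_of (b + b, y) - frag_of (b, y) - frag_of (b, y)) - (frag_of (0 + 0, y) - frag_of (0, y) - frag_of (0, y))"
    by (simp add: b(2))
  then have "frag_of (a, y * y) \<in> ?N" using closed[OF closed[OF r1 r2] r3] by simp
  then have "?N #>\<^bsub>?F\<^esub> frag_of (a, y * y) = ?N"
    by (rule subgroup.rcos_const[OF subgroup_kaehler group_free_Abelian_group])
  then show ?thesis by (simp add: kaehler_form_def kaehler_def FactGroup_def)
qed

lemma kaehler_map_form:
  assumes s: "\<And>x. x \<in> A \<Longrightarrow> \<sigma> x \<in> A" "\<And>x y. x \<in> A \<Longrightarrow> y \<in> A \<Longrightarrow> \<sigma> (x + y) = \<sigma> x + \<sigma> y"
    "\<And>x y. x \<in> A \<Longrightarrow> y \<in> A \<Longrightarrow> \<sigma> (x * y) = \<sigma> x * \<sigma> y"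
    and ab: "a \<in> A" "b \<in> A"
  shows "kaehler_map A \<sigma> (kaehler_form A a b) = kaehler_form A (\<sigma> a) (\<sigma> b)"
proof -
  let ?N = "kaehler_relation_group A" and ?F = "free_Abelian_group (A \<times> A)"
  define h where "h = frag_extend (\<lambda>(a, b). frag_of (\<sigma> a, \<sigma> b))"
  have h_of: "h (frag_of (a, b)) = frag_of (\<sigma> a, \<sigma> b)" and h_diff: "h (r - t) = h r - h t" for a b r t
    by (simp_all add: h_def frag_extend_diff)
  have hom: "h \<in> hom ?F ?F" unfolding h_def by (rule frag_extend_hom) (use s(1) in auto)
  have h_relation: "h r \<in> ?N" if r: "r \<in> kaehler_relations A" for r
  proof (rule kaehler_relationI)
    show "h r \<in> kaehler_relations A"
      using r
    proof (cases rule: kaehler_relationsE)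
      case (left a a' b)
      then show ?thesis using kaehler_relationsI(1)[of "\<sigma> a" A "\<sigma> a'" "\<sigma> b"] s by (simp add: h_diff h_of)
    next
      case (right a b b')
      then show ?thesis using kaehler_relationsI(2)[of "\<sigma> a" A "\<sigma> b" "\<sigma> b'"] s by (simp add: h_diff h_of)
    next
      case (leibniz a b c)
      then show ?thesis using kaehler_relationsI(3)[of "\<sigma> a" A "\<sigma> b" "\<sigma> c"] s by (simp add: h_diff h_of)
    qed
  qed
  have h_rel: "h ` ?N \<subseteq> ?N"
    using hom_generate_subset[OF group_free_Abelian_group hom subgroup_kaehler group_free_Abelian_group
        kaehler_relations_subset h_relation] by (simp add: kaehler_relation_group_def)
  have "kaehler_map A \<sigma> (?N #>\<^bsub>?F\<^esub> frag_of (a, b)) = ?N #>\<^bsub>?F\<^esub> h (frag_of (a, b))"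
    unfolding kaehler_map_def h_def[symmetric]
    by (rule quotient_map_coset[OF hom normal_kaehler normal_kaehler h_rel]) (use ab in simp)
  then show ?thesis by (simp add: kaehler_form_def h_of)
qed

text \<open>The universal property of differentials: a db -> a D(b) respects all relations. It
  serves to tell forms apart by means of a derivation.\<close>

lemma kaehler_form_derivation:
  fixes D :: "'a \<Rightarrow> 'a"
  assumes D: "\<And>x y. x \<in> A \<Longrightarrow> y \<in> A \<Longrightarrow> D (x + y) = D x + D y"
    "\<And>x y. x \<in> A \<Longrightarrow> y \<in> A \<Longrightarrow> D (x * y) = x * D y + y * D x"
    and eq: "kaehler_form A a b = kaehler_form A a' b'" and ab: "a \<in> A" "b \<in> A" "a' \<in> A" "b' \<in> A"
  shows "a * D b = a' * D b'"
proof -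
  let ?N = "kaehler_relation_group A" and ?F = "free_Abelian_group (A \<times> A)"
  let ?G = "\<lparr>carrier = UNIV, monoid.mult = (+), one = 0\<rparr> :: 'a monoid"
  have "comm_group ?G"
    by (rule comm_groupI) (auto simp: algebra_simps intro: exI[of _ "- _"])
  then interpret G: comm_group ?G .
  obtain h where h: "h \<in> hom ?F ?G" "\<And>k. k \<in> A \<times> A \<Longrightarrow> h (frag_of k) = (case k of (a, b) \<Rightarrow> a * D b)"
    using G.free_Abelian_group_universal[of "\<lambda>(a, b). a * D b" "A \<times> A"] by auto
  have h_of: "h (frag_of (a, b)) = a * D b" if "a \<in> A" "b \<in> A" for a b using h(2)[of "(a, b)"] that by simp
  have h_add: "h (r + s) = h r + h s" if "Poly_Mapping.keys r \<subseteq> A \<times> A" "Poly_Mapping.keys s \<subseteq> A \<times> A" for r s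
    using hom_mult[OF h(1), of r s] that by simp
  have h_diff: "h (r - s) = h r - h s" if rs: "Poly_Mapping.keys r \<subseteq> A \<times> A" "Poly_Mapping.keys s \<subseteq> A \<times> A" for r s
  proof -
    have "Poly_Mapping.keys (r - s) \<subseteq> A \<times> A" using rs by (meson keys_diff order_trans Un_least)
    from h_add[OF this rs(2)] show ?thesis by simp
  qed
  have three: "h (frag_of k - frag_of l - frag_of m) = h (frag_of k) - h (frag_of l) - h (frag_of m)"
    if k: "k \<in> A \<times> A" "l \<in> A \<times> A" "m \<in> A \<times> A" for k l m
  proof -
    have "Poly_Mapping.keys (frag_of k - frag_of l) \<subseteq> A \<times> A" using k keys_diff[of "frag_of k" "frag_of l"] by auto
    then show ?thesis using k by (simp add: h_diff)
  qed
  have h_relation: "h r = 0" if r: "r \<in> kaehler_relations A" for r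
  proof -
    show ?thesis
      using r
    proof (cases rule: kaehler_relationsE)
      case (left a a' b)
      then show ?thesis unfolding left(1) by (simp add: three h_of A_add distrib_right)
    next
      case (right a b b')
      then show ?thesis unfolding right(1) by (simp add: three h_of A_add D distrib_left)
    next
      case (leibniz a b c)
      then show ?thesis unfolding leibniz(1) by (simp add: three h_of A_mult D distrib_left mult_ac)
    qed
  qed
  have "h ` ?N \<subseteq> {\<one>\<^bsub>?G\<^esub>}"
    unfolding kaehler_relation_group_def
    by (rule hom_generate_subset[OF group_free_Abelian_group h(1) G.triv_subgroup G.is_group kaehler_relations_subset])
      (simp add: h_relation)
  then have h_rel: "h r = 0" if "r \<in> ?N" for r using that by auto
  have "frag_of (a, b) - frag_of (a', b') \<in> ?N" using eq kaehler_form_eq_iff[OF ab] by simp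
  then have "h (frag_of (a, b) - frag_of (a', b')) = 0" by (rule h_rel)
  moreover have "h (frag_of (a, b) - frag_of (a', b')) = h (frag_of (a, b)) - h (frag_of (a', b'))"
    using ab by (intro h_diff) simp_all
  ultimately have "h (frag_of (a, b)) - h (frag_of (a', b')) = 0" by simp
  then show ?thesis using ab by (simp add: h_of)
qed

end

text \<open>
  For a subfield \<open>F\<close> containing all squares and maximal among those without \<open>u\<close>, one has
  \<open>A = F + F u\<close>, and \<open>f + g u \<mapsto> g\<close> is a derivation because \<open>2 = 0\<close>.
\<close>

lemma char2_derivation:
  fixes A :: "'a::field set"
  assumes two: "\<And>x::'a. x + x = 0"
    and A: "\<And>x y. x \<in> A \<Longrightarrow> y \<in> A \<Longrightarrow> x + y \<in> A" "\<And>x y. x \<in> A \<Longrightarrow> y \<in> A \<Longrightarrow> x * y \<in> A"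
      "0 \<in> A" "1 \<in> A" "\<And>x. x \<in> A \<Longrightarrow> inverse x \<in> A"
    and u: "u \<in> A" "\<And>w. w \<in> A \<Longrightarrow> u \<noteq> w * w"
  shows "\<exists>D :: 'a \<Rightarrow> 'a. (\<forall>x\<in>A. \<forall>y\<in>A. D (x + y) = D x + D y \<and> D (x * y) = x * D y + y * D x) \<and> D u = 1"
proof -
  have minus: "- x = x" for x :: 'a using two[of x] by (simp add: neg_eq_iff_add_eq_0)
  have diff: "x - y = x + y" for x y :: 'a using minus[of y] by (metis diff_conv_add_uminus)
  define subf where "subf F \<longleftrightarrow> F \<subseteq> A \<and> (\<forall>x\<in>F. \<forall>y\<in>F. x + y \<in> F \<and> x * y \<in> F) \<and> (\<forall>x\<in>A. x * x \<in> F) \<and> u \<notin> F" for F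
  have "\<exists>M\<in>Collect subf. \<forall>X'\<in>Collect subf. M \<subseteq> X' \<longrightarrow> X' = M"
  proof (rule subset_Zorn_nonempty)
    have "subf ((\<lambda>x. x * x) ` A)"
      unfolding subf_def
    proof (intro conjI ballI)
      fix x y assume "x \<in> (\<lambda>x. x * x) ` A" "y \<in> (\<lambda>x. x * x) ` A"
      then obtain s t where st: "s \<in> A" "t \<in> A" "x = s * s" "y = t * t" by auto
      have "(s + t) * (s + t) = s * s + t * t + (s * t + s * t)" by (simp add: algebra_simps)
      then have "x + y = (s + t) * (s + t)" unfolding two st by simp
      then show "x + y \<in> (\<lambda>x. x * x) ` A" using A st by blast
      have "x * y = (s * t) * (s * t)" by (simp add: st mult_ac)
      then show "x * y \<in> (\<lambda>x. x * x) ` A" using A st by blast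
    next
      show "u \<notin> (\<lambda>x. x * x) ` A" using u(2) by blast
    qed (use A in auto)
    then show "Collect subf \<noteq> {}" by blast
  next
    fix C assume C: "C \<noteq> {}" "subset.chain (Collect subf) C"
    then have CA: "\<And>Q. Q \<in> C \<Longrightarrow> subf Q"
      and lin: "\<And>Q Q'. Q \<in> C \<Longrightarrow> Q' \<in> C \<Longrightarrow> Q \<subseteq> Q' \<or> Q' \<subseteq> Q"
      by (auto simp: subset_chain_def)
    have "x + y \<in> \<Union>C \<and> x * y \<in> \<Union>C" if xy: "x \<in> \<Union>C" "y \<in> \<Union>C" for x y
    proof -
      obtain Q Q' where "Q \<in> C" "x \<in> Q" "Q' \<in> C" "y \<in> Q'" using xy by blast
      then obtain Q where "Q \<in> C" "x \<in> Q" "y \<in> Q" using lin[of Q Q'] by blast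
      then show ?thesis using CA[of Q] unfolding subf_def by blast
    qed
    moreover obtain Q0 where "Q0 \<in> C" using C(1) by blast
    ultimately show "\<Union>C \<in> Collect subf" using CA unfolding subf_def by blast
  qed
  then obtain F where F: "subf F" and max: "\<And>Q. subf Q \<Longrightarrow> F \<subseteq> Q \<Longrightarrow> Q = F" by auto
  have FA: "F \<subseteq> A" and F_add: "\<And>x y. x \<in> F \<Longrightarrow> y \<in> F \<Longrightarrow> x + y \<in> F" and F_mult: "\<And>x y. x \<in> F \<Longrightarrow> y \<in> F \<Longrightarrow> x * y \<in> F"
    and F_sq: "\<And>x. x \<in> A \<Longrightarrow> x * x \<in> F" and uF: "u \<notin> F"
    using F unfolding subf_def by blast+
  have F0: "0 \<in> F" and F1: "1 \<in> F" using F_sq[OF A(3)] F_sq[OF A(4)] by simp_all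
  have F_inv: "inverse x \<in> F" if "x \<in> F" for x
  proof (cases "x = 0")
    case False
    have "inverse x = x * (inverse x * inverse x)" using False by simp
    then show ?thesis using F_mult[OF that F_sq[OF A(5)]] that FA by (metis subsetD)
  qed (simp add: F0)
  have decomp: "\<exists>f\<in>F. \<exists>g\<in>F. t = f + g * u" if t: "t \<in> A" for t
  proof (cases "t \<in> F")
    case True
    then show ?thesis using F0 by (intro bexI[of _ t] bexI[of _ 0]) auto
  next
    case False
    \<comment> \<open>Q is closed under products because t^2 lies in F. As Q is larger than F,
      maximality puts u into Q, and the resulting equation is solved for t.\<close>
    define Q where "Q = {f + g * t | f g. f \<in> F \<and> g \<in> F}"
    have QI: "f + g * t \<in> Q" if "f \<in> F" "g \<in> F" for f g using that by (auto simp: Q_def)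
    have FQ: "F \<subseteq> Q" using QI[OF _ F0] by auto
    have tQ: "t \<in> Q" using QI[OF F0 F1] by simp
    have "u \<in> Q"
    proof (rule ccontr)
      assume "u \<notin> Q"
      have "x + y \<in> Q \<and> x * y \<in> Q" if xy: "x \<in> Q" "y \<in> Q" for x y
      proof -
        obtain f g f' g' where *: "x = f + g * t" "y = f' + g' * t" "f \<in> F" "g \<in> F" "f' \<in> F" "g' \<in> F"
          using xy by (auto simp: Q_def)
        have e: "x + y = (f + f') + (g + g') * t" "x * y = (f * f' + (g * g') * (t * t)) + (f * g' + f' * g) * t"
          by (simp_all add: * algebra_simps)
        have "(g * g') * (t * t) \<in> F" by (intro F_mult[OF F_mult F_sq] * t)
        then show ?thesis unfolding e
          by (intro conjI QI F_add F_mult[OF *(3) *(5)] F_mult[OF *(3) *(6)] F_mult[OF *(5) *(4)] *)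
      qed
      moreover have "Q \<subseteq> A" unfolding Q_def using FA A(1,2) t by blast
      ultimately have "subf Q" using FQ F_sq \<open>u \<notin> Q\<close> unfolding subf_def by blast
      then have "Q = F" using max FQ by blast
      then show False using tQ False by simp
    qed
    then obtain f g where fg: "u = f + g * t" "f \<in> F" "g \<in> F" by (auto simp: Q_def)
    have g0: "g \<noteq> 0" using fg uF by auto
    have "f + u = (f + f) + g * t" unfolding fg(1) by (rule add.assoc[symmetric])
    then have gt: "g * t = f + u" unfolding two by simp
    have "t = inverse g * (g * t)" using g0 by simp
    also have "\<dots> = inverse g * f + inverse g * u" unfolding gt by (rule distrib_left)
    finally have "t = inverse g * f + inverse g * u" .
    then show ?thesis using F_mult[OF F_inv[OF fg(3)] fg(2)] F_inv[OF fg(3)] by blast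
  qed
  define D where "D t = (SOME g. g \<in> F \<and> (\<exists>f\<in>F. t = f + g * u))" for t
  have D_eq: "D t = g" if fg: "f \<in> F" "g \<in> F" "t = f + g * u" for t f g
  proof -
    have "D t \<in> F \<and> (\<exists>f\<in>F. t = f + D t * u)" unfolding D_def by (rule someI[of _ g]) (use fg in blast)
    then obtain f' where f': "D t \<in> F" "f' \<in> F" "t = f' + D t * u" by blast
    show ?thesis
    proof (rule ccontr)
      \<comment> \<open>Two different coefficients would express u as a quotient of elements of
        F.\<close>
      assume ne: "D t \<noteq> g"
      have "(D t + g) * u = f + f'"
      proof -
        have "f + g * u = f' + D t * u" using fg(3) f'(3) by simp
        then have "D t * u - g * u = f - f'" by (simp add: algebra_simps)
        then show ?thesis by (simp add: diff distrib_right)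
      qed
      moreover have nz: "D t + g \<noteq> 0" using ne diff[of "D t" g] by (metis right_minus_eq)
      ultimately have "u = inverse (D t + g) * (f + f')" by (simp add: field_simps)
      then show False using uF F_mult[OF F_inv[OF F_add[OF f'(1) fg(2)]] F_add[OF fg(1) f'(2)]] by simp
    qed
  qed
  have "D (x + y) = D x + D y \<and> D (x * y) = x * D y + y * D x" if "x \<in> A" "y \<in> A" for x y
  proof -
    obtain f g f' g' where *: "x = f + g * u" "y = f' + g' * u" "f \<in> F" "g \<in> F" "f' \<in> F" "g' \<in> F"
      using decomp \<open>x \<in> A\<close> \<open>y \<in> A\<close> by metis
    have Dx: "D x = g" and Dy: "D y = g'" using D_eq * by blast+
    have "x + y = (f + f') + (g + g') * u" by (simp add: * algebra_simps)
    then have "D (x + y) = g + g'" by (rule D_eq[rotated 2]) (intro F_add *)+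
    then have sum: "D (x + y) = D x + D y" using Dx Dy by simp
    have "x * y = (f * f' + (g * g') * (u * u)) + (f * g' + f' * g) * u" by (simp add: * algebra_simps)
    then have "D (x * y) = f * g' + f' * g"
    proof (rule D_eq[rotated 2])
      show "f * f' + (g * g') * (u * u) \<in> F"
        by (intro F_add F_mult[OF *(3) *(5)] F_mult[OF F_mult[OF *(4) *(6)] F_sq[OF u(1)]])
      show "f * g' + f' * g \<in> F" by (intro F_add F_mult *)
    qed
    moreover have "x * D y + y * D x = f * g' + f' * g + (g * g' * u + g * g' * u)"
      unfolding Dx Dy unfolding *(1,2) by (simp only: algebra_simps)
    ultimately have "D (x * y) = x * D y + y * D x" unfolding two by simp
    then show ?thesis using sum by blast
  qed
  moreover have "D u = 1" using D_eq[OF F0 F1] by simp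
  ultimately show ?thesis by blast
qed

section \<open>Logarithmic forms as a Galois module\<close>

definition dlog :: "'a::field set \<Rightarrow> 'a \<Rightarrow> ('a \<times> 'a \<Rightarrow>\<^sub>0 int) set" where
  "dlog A z = kaehler_form A (inverse z) z"

context
  fixes T :: "'r::field itself"
  assumes char2: "CHAR('r) = 2"
begin

abbreviation "sep \<equiv> sep_closure :: 'r alg_closure set"

lemmas sep_closed = sep_closure_add[OF char2] sep_closure_mult[OF char2] sep_closure_zero[OF char2]
  sep_closure_one[OF char2] sep_closure_inverse[OF char2] sep_closure_power[OF char2] to_ac_in_sep_closure[OF char2]

lemma dlog_mult:
  assumes "x \<in> sep" "y \<in> sep" "x \<noteq> 0" "y \<noteq> 0"
  shows "dlog sep x \<otimes>\<^bsub>kaehler sep\<^esub> dlog sep y = dlog sep (y * x)"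
proof -
  have e: "inverse (y * x) * y = inverse x" "inverse (y * x) * x = inverse y" using assms by (simp_all add: field_simps)
  have "inverse (y * x) \<in> sep" using assms by (intro sep_closed)
  from kaehler_form_leibniz[OF sep_closed(1,2) this assms(2,1)] show ?thesis
    unfolding e dlog_def .
qed

lemma dlog_square: "x \<in> sep \<Longrightarrow> dlog sep (x * x) = \<one>\<^bsub>kaehler sep\<^esub>"
  unfolding dlog_def
  by (rule kaehler_form_square[OF sep_closed(1-3) ac_two[OF char2]]) (simp_all add: sep_closed)

lemma dlog_one: "dlog sep 1 = \<one>\<^bsub>kaehler sep\<^esub>"
  using dlog_square[OF sep_closed(4)] by simp

text \<open>Equality of the logarithmic forms gives D(u) / u = 0 for u = y / x and every derivation
  D, whereas \<open>char2_derivation\<close> provides one with D(u) = 1 as soon as u is not a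
  square.\<close>

lemma dlog_eq_imp_square:
  assumes x: "x \<in> sep" "x \<noteq> 0" and y: "y \<in> sep" "y \<noteq> 0" and eq: "dlog sep x = dlog sep y"
  shows "\<exists>w\<in>sep. y = x * w ^ 2"
proof (rule ccontr)
  assume no: "\<not> (\<exists>w\<in>sep. y = x * w ^ 2)"
  define u where "u = y * inverse x"
  have uA: "u \<in> sep" unfolding u_def using x y by (intro sep_closed)
  have yu: "y = x * u" using x by (simp add: u_def)
  have u0: "u \<noteq> 0" using y yu by auto
  have nsq: "u \<noteq> w * w" if "w \<in> sep" for w using no yu that by (auto simp: power2_eq_square)
  obtain D where D': "\<forall>s\<in>sep. \<forall>t\<in>sep. D (s + t) = D s + D t \<and> D (s * t) = s * D t + t * D s" "D u = 1"
    using char2_derivation[OF ac_two[OF char2] sep_closed(1-5) uA nsq] by blast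
  have D: "D (s + t) = D s + D t" "D (s * t) = s * D t + t * D s" if "s \<in> sep" "t \<in> sep" for s t
    using D'(1) that by blast+
  have "inverse x * D x = inverse y * D y"
    using kaehler_form_derivation[OF sep_closed(1,2) D(1,2), of "inverse x" x "inverse y" y] eq x y sep_closed(5)
    by (simp add: dlog_def)
  also have "D y = x + u * D x" unfolding yu using D(2)[OF x(1) uA] D'(2) by simp
  also have "inverse y * (x + u * D x) = (inverse y * x) + (inverse y * u) * D x"
    by (simp only: distrib_left mult.assoc)
  also have "inverse y * x = inverse u" using x u0 by (simp add: yu field_simps)
  also have "inverse y * u = inverse x" using x u0 by (simp add: yu field_simps)
  finally have "inverse u = 0" by simp
  then show False using u0 by simp
qed

lemma galois_simps:
  assumes "\<sigma> \<in> (galois_group :: ('r alg_closure \<Rightarrow> _) set)"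
  shows "x \<in> sep \<Longrightarrow> \<sigma> x \<in> sep" "x \<in> sep \<Longrightarrow> y \<in> sep \<Longrightarrow> \<sigma> (x + y) = \<sigma> x + \<sigma> y"
    "x \<in> sep \<Longrightarrow> y \<in> sep \<Longrightarrow> \<sigma> (x * y) = \<sigma> x * \<sigma> y" "\<sigma> (to_ac c) = to_ac c"
    "\<sigma> 0 = 0" "\<sigma> 1 = 1" "x \<in> sep \<Longrightarrow> x \<noteq> 0 \<Longrightarrow> \<sigma> x \<noteq> 0" "x \<in> sep \<Longrightarrow> \<sigma> (inverse x) = inverse (\<sigma> x)"
    "x \<in> sep \<Longrightarrow> \<sigma> (x ^ 2) = \<sigma> x ^ 2"
proof -
  have b: "bij_betw \<sigma> sep sep" and c: "\<And>c. \<sigma> (to_ac c) = to_ac c"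
    and m: "\<And>x y. x \<in> sep \<Longrightarrow> y \<in> sep \<Longrightarrow> \<sigma> (x * y) = \<sigma> x * \<sigma> y" using assms by (auto simp: galois_group_iff)
  show "x \<in> sep \<Longrightarrow> \<sigma> x \<in> sep" using bij_betw_apply[OF b] by blast
  show "x \<in> sep \<Longrightarrow> y \<in> sep \<Longrightarrow> \<sigma> (x + y) = \<sigma> x + \<sigma> y" "x \<in> sep \<Longrightarrow> y \<in> sep \<Longrightarrow> \<sigma> (x * y) = \<sigma> x * \<sigma> y"
    "\<sigma> (to_ac c) = to_ac c" using assms by (auto simp: galois_group_iff)
  show 0: "\<sigma> 0 = 0" and 1: "\<sigma> 1 = 1" using c[of 0] c[of 1] by simp_all
  show nz: "\<sigma> x \<noteq> 0" if "x \<in> sep" "x \<noteq> 0"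
    using m[OF that(1) sep_closed(5)[OF that(1)]] that(2) 1 by auto
  show "\<sigma> (inverse x) = inverse (\<sigma> x)" if "x \<in> sep"
  proof (cases "x = 0")
    case False
    then have "\<sigma> x * \<sigma> (inverse x) = 1" using m[OF that sep_closed(5)[OF that]] 1 by simp
    then show ?thesis by (metis inverse_unique)
  qed (simp add: 0)
  show "x \<in> sep \<Longrightarrow> \<sigma> (x ^ 2) = \<sigma> x ^ 2" using m by (simp add: power2_eq_square)
qed

lemma galois_dlog:
  assumes "\<sigma> \<in> (galois_group :: ('r alg_closure \<Rightarrow> _) set)" "z \<in> sep"
  shows "kaehler_map sep \<sigma> (dlog sep z) = dlog sep (\<sigma> z)"
proof -
  have "kaehler_map sep \<sigma> (kaehler_form sep (inverse z) z) = kaehler_form sep (\<sigma> (inverse z)) (\<sigma> z)"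
    by (rule kaehler_map_form) (simp_all add: sep_closed galois_simps(1-3)[OF assms(1)] assms(2))
  then show ?thesis by (simp add: dlog_def galois_simps(8)[OF assms])
qed

text \<open>dlog turns products into the group operation, so its values already form a subgroup:
  every logarithmic form is a single dlog.\<close>

lemma log_forms_carrier:
  "carrier (log_forms :: ('r alg_closure \<times> 'r alg_closure \<Rightarrow>\<^sub>0 int) set monoid) = dlog sep ` (sep - {0})"
proof -
  interpret K: comm_group "kaehler sep" by (rule comm_group_kaehler[OF sep_closed(1,2)])
  let ?S = "{kaehler_form sep (inverse x) x |x. x \<in> sep \<and> x \<noteq> 0}"
  have S: "carrier (kaehler sep) \<inter> ?S = dlog sep ` (sep - {0})"
    using kaehler_form_in[OF sep_closed(1,2)] sep_closed(5) by (auto simp: dlog_def)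
  have "generate (kaehler sep) (dlog sep ` (sep - {0})) = dlog sep ` (sep - {0})"
  proof (rule equalityI)
    show "generate (kaehler sep) (dlog sep ` (sep - {0})) \<subseteq> dlog sep ` (sep - {0})"
    proof
      fix m assume "m \<in> generate (kaehler sep) (dlog sep ` (sep - {0}))"
      then show "m \<in> dlog sep ` (sep - {0})"
      proof (induction rule: generate.induct)
        case one
        show ?case using dlog_one sep_closed(4) by (metis DiffI image_eqI singletonD zero_neq_one)
      next
        case (inv h)
        then obtain x where x: "x \<in> sep" "x \<noteq> 0" "h = dlog sep x" by blast
        have "dlog sep (inverse x) \<otimes>\<^bsub>kaehler sep\<^esub> dlog sep x = \<one>\<^bsub>kaehler sep\<^esub>"
          using dlog_mult[of "inverse x" x] x sep_closed(5) dlog_one by simp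
        moreover have "dlog sep x \<in> carrier (kaehler sep)" "dlog sep (inverse x) \<in> carrier (kaehler sep)"
          using x sep_closed(5) by (auto simp: dlog_def intro!: kaehler_form_in sep_closed)
        ultimately have "inv\<^bsub>kaehler sep\<^esub> h = dlog sep (inverse x)" using x(3) K.inv_equality by simp
        then show ?case using x sep_closed(5) by auto
      next
        case (eng h1 h2)
        then obtain x y where "x \<in> sep" "x \<noteq> 0" "h1 = dlog sep x" "y \<in> sep" "y \<noteq> 0" "h2 = dlog sep y" by blast
        then show ?case using dlog_mult sep_closed(2) by (intro image_eqI[of _ _ "y * x"]) auto
      qed auto
    qed
  qed (auto intro: generate.incl)
  then show ?thesis unfolding log_forms_def carrier_subgroup_generated S .
qed

lemma log_forms_group:
  "Group.group (log_forms :: ('r alg_closure \<times> 'r alg_closure \<Rightarrow>\<^sub>0 int) set monoid)"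
proof -
  interpret K: comm_group "kaehler sep" by (rule comm_group_kaehler[OF sep_closed(1,2)])
  show ?thesis unfolding log_forms_def by (rule K.group_subgroup_generated)
qed

lemma log_forms_mult: "x \<otimes>\<^bsub>log_forms\<^esub> y = x \<otimes>\<^bsub>kaehler sep\<^esub> y"
  and log_forms_one: "\<one>\<^bsub>log_forms\<^esub> = \<one>\<^bsub>kaehler sep\<^esub>"
  by (simp_all add: log_forms_def)

text \<open>Both \<alpha> and its image solve X^2 + X = d, and two solutions differ by 0 or
  1.\<close>

lemma galois_artin_schreier:
  assumes \<sigma>: "\<sigma> \<in> (galois_group :: ('r alg_closure \<Rightarrow> _) set)" and \<alpha>: "\<alpha> \<in> sep" "\<alpha> * \<alpha> + \<alpha> \<in> range to_ac"
  shows "\<sigma> \<alpha> = \<alpha> \<or> \<sigma> \<alpha> = \<alpha> + 1"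
proof -
  obtain d where d: "\<alpha> * \<alpha> + \<alpha> = to_ac d" using \<alpha>(2) by blast
  have "\<sigma> (\<alpha> * \<alpha> + \<alpha>) = \<alpha> * \<alpha> + \<alpha>" unfolding d by (rule galois_simps(4)[OF \<sigma>])
  then have "\<sigma> \<alpha> * \<sigma> \<alpha> + \<sigma> \<alpha> = \<alpha> * \<alpha> + \<alpha>"
    using galois_simps(2,3)[OF \<sigma>] \<alpha>(1) sep_closed(2) by simp
  then have "(\<sigma> \<alpha> + \<alpha>) * (\<sigma> \<alpha> + \<alpha> + 1) = (\<alpha> * \<alpha> + \<alpha>) + (\<alpha> * \<alpha> + \<alpha>) + (\<sigma> \<alpha> * \<alpha> + \<sigma> \<alpha> * \<alpha>)"
    by (simp add: algebra_simps)
  then have "(\<sigma> \<alpha> + \<alpha>) * (\<sigma> \<alpha> + \<alpha> + 1) = 0" unfolding ac_two[OF char2] by simp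
  then have "\<sigma> \<alpha> + \<alpha> = 0 \<or> \<sigma> \<alpha> + (\<alpha> + 1) = 0" by (simp add: add.assoc)
  then show ?thesis using ac_minus[OF char2] by (metis add_eq_0_iff2)
qed

lemma coboundary_of_dlog:
  assumes triv: "trivial_group (etale_H2_Zmodp1 TYPE('r))"
    and \<alpha>: "\<alpha> \<in> sep" "\<alpha> * \<alpha> + \<alpha> \<in> range to_ac" and y: "(y :: 'r) \<noteq> 0"
  shows "\<exists>z\<in>sep. z \<noteq> 0 \<and> (\<forall>\<sigma>\<in>galois_group. \<exists>w\<in>sep. \<sigma> z = (if \<sigma> \<alpha> = \<alpha> then 1 else to_ac y) * z * w ^ 2)"
proof -
  let ?M = "log_forms :: ('r alg_closure \<times> 'r alg_closure \<Rightarrow>\<^sub>0 int) set monoid"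
  let ?G = "galois_group :: ('r alg_closure \<Rightarrow> 'r alg_closure) set"
  let ?act = "kaehler_map sep"
  interpret M: Group.group ?M by (rule log_forms_group)
  \<comment> \<open>Y \<sigma> is y to the power chi(\<sigma>), where chi(\<sigma>) in {0, 1}
    records whether \<sigma> moves \<alpha>.\<close>
  define Y :: "('r alg_closure \<Rightarrow> 'r alg_closure) \<Rightarrow> 'r alg_closure"
    where "Y \<sigma> = (if \<sigma> \<alpha> = \<alpha> then 1 else to_ac y)" for \<sigma>
  define c where "c = (\<lambda>\<sigma>\<in>?G. dlog sep (Y \<sigma>))"
  have yA: "Y \<sigma> \<in> sep" "Y \<sigma> \<noteq> 0" for \<sigma> using y sep_closed by (auto simp: Y_def)
  have in_M: "dlog sep z \<in> carrier ?M" if "z \<in> sep" "z \<noteq> 0" for z using that log_forms_carrier by auto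
  note move = galois_artin_schreier[OF _ \<alpha>]
  have comp_app: "compose sep \<sigma> \<tau> x = \<sigma> (\<tau> x)" if "x \<in> sep" for \<sigma> \<tau> :: "'r alg_closure \<Rightarrow> 'r alg_closure" and x
    using that by (simp add: compose_def)
  \<comment> \<open>chi is additive only modulo 2: if both automorphisms move \<alpha>, the
    composite has Y = 1 while the product is y^2. The discrepancy is a square, which dlog does not
    see.\<close>
  have move_compose: "Y (compose sep \<sigma> \<tau>) = Y \<tau> * Y \<sigma> \<or> (Y (compose sep \<sigma> \<tau>) = 1 \<and> Y \<sigma> = Y \<tau>)"
    if st: "\<sigma> \<in> ?G" "\<tau> \<in> ?G" for \<sigma> \<tau>
  proof -
    have "\<sigma> (\<alpha> + 1) = \<sigma> \<alpha> + 1" using galois_simps(2,6)[OF st(1)] \<alpha>(1) sep_closed(4) by simp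
    moreover have "\<alpha> + 1 + 1 = \<alpha>" using ac_two[OF char2, of 1] by (simp add: add.assoc)
    moreover have "\<alpha> + 1 \<noteq> \<alpha>" by simp
    ultimately show ?thesis using move[OF st(1)] move[OF st(2)] comp_app[OF \<alpha>(1), of \<sigma> \<tau>] by (auto simp: Y_def)
  qed
  have dlog_compose: "dlog sep (Y (compose sep \<sigma> \<tau>)) = dlog sep (Y \<sigma>) \<otimes>\<^bsub>?M\<^esub> dlog sep (Y \<tau>)"
    if st: "\<sigma> \<in> ?G" "\<tau> \<in> ?G" for \<sigma> \<tau>
  proof -
    have "dlog sep (Y \<sigma>) \<otimes>\<^bsub>?M\<^esub> dlog sep (Y \<tau>) = dlog sep (Y \<tau> * Y \<sigma>)"
      unfolding log_forms_mult by (rule dlog_mult) (rule yA)+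
    moreover have "dlog sep (Y \<sigma> * Y \<sigma>) = dlog sep 1" using dlog_square[OF yA(1)] dlog_one by simp
    ultimately show ?thesis using move_compose[OF st] by auto
  qed
  have fixed_y: "\<sigma> (Y \<tau>) = Y \<tau>" if "\<sigma> \<in> ?G" for \<sigma> \<tau> using galois_simps(4,6)[OF that] by (simp add: Y_def)
  have cocycle: "c \<in> galois_cocycles ?M ?act"
    unfolding galois_cocycles_def
  proof (intro CollectI conjI ballI)
    show "c \<in> ?G \<rightarrow>\<^sub>E carrier ?M" unfolding c_def using in_M[OF yA] by auto
  next
    fix \<sigma> \<tau> assume st: "\<sigma> \<in> ?G" "\<tau> \<in> ?G"
    have "?act \<sigma> (dlog sep (Y \<tau>)) = dlog sep (Y \<tau>)" using galois_dlog[OF st(1) yA(1)] fixed_y[OF st(1)] by simp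
    then show "c (compose sep \<sigma> \<tau>) = c \<sigma> \<otimes>\<^bsub>?M\<^esub> ?act \<sigma> (c \<tau>)"
      using st galois_compose[OF char2 st] dlog_compose[OF st] by (simp add: c_def)
  next
    fix \<sigma> assume "\<sigma> \<in> ?G"
    \<comment> \<open>Continuity: the cocycle depends on \<sigma> only through \<sigma>
      \<alpha>.\<close>
    then show "\<exists>F. finite F \<and> F \<subseteq> sep \<and> (\<forall>\<tau>\<in>?G. (\<forall>x\<in>F. \<tau> x = \<sigma> x) \<longrightarrow> c \<tau> = c \<sigma>)"
      using \<alpha>(1) by (intro exI[of _ "{\<alpha>}"]) (auto simp: c_def Y_def)
  qed
  have one_M: "dlog sep 1 = \<one>\<^bsub>?M\<^esub>" by (simp add: dlog_one log_forms_one)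
  let ?B = "galois_coboundaries ?M ?act"
  let ?H = "\<lparr>carrier = galois_cocycles ?M ?act,
      monoid.mult = (\<lambda>c d. \<lambda>\<sigma>\<in>?G. c \<sigma> \<otimes>\<^bsub>?M\<^esub> d \<sigma>),
      one = (\<lambda>\<sigma>\<in>?G. \<one>\<^bsub>?M\<^esub>)\<rparr>"
  have "carrier (?H Mod ?B) = {?B}"
    using triv by (simp add: trivial_group_def etale_H2_Zmodp1_def galois_H1_def FactGroup_def)
  moreover have "?B #>\<^bsub>?H\<^esub> c \<in> carrier (?H Mod ?B)" using cocycle by (auto simp: carrier_FactGroup)
  ultimately have Bc: "?B #>\<^bsub>?H\<^esub> c = ?B" by simp
  have act_one: "?act \<sigma> \<one>\<^bsub>?M\<^esub> = \<one>\<^bsub>?M\<^esub>" if "\<sigma> \<in> ?G" for \<sigma>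
    using galois_dlog[OF that sep_closed(4)] galois_simps(6)[OF that] one_M by simp
  \<comment> \<open>The coset of c equals the set of coboundaries. That c lies in its own coset uses
    that the identity cocycle is a coboundary.\<close>
  have B1: "(\<lambda>\<sigma>\<in>?G. \<one>\<^bsub>?M\<^esub>) \<in> ?B"
    unfolding galois_coboundaries_def
    by (rule CollectI, rule exI[of _ "\<one>\<^bsub>?M\<^esub>"]) (auto simp: act_one intro!: restrict_ext)
  have "(\<lambda>\<sigma>\<in>?G. (\<lambda>\<sigma>\<in>?G. \<one>\<^bsub>?M\<^esub>) \<sigma> \<otimes>\<^bsub>?M\<^esub> c \<sigma>) = c"
    using in_M[OF yA] by (auto simp: c_def fun_eq_iff)
  then have "c \<in> ?B #>\<^bsub>?H\<^esub> c" unfolding r_coset_def by (intro UN_I[OF B1]) simp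
  then have "c \<in> ?B" using Bc by simp
  then obtain m where m: "m \<in> carrier ?M" "c = (\<lambda>\<sigma>\<in>?G. ?act \<sigma> m \<otimes>\<^bsub>?M\<^esub> inv\<^bsub>?M\<^esub> m)"
    unfolding galois_coboundaries_def by blast
  obtain z where z: "z \<in> sep" "z \<noteq> 0" "m = dlog sep z" using m(1) log_forms_carrier by auto
  have "\<exists>w\<in>sep. \<sigma> z = Y \<sigma> * z * w ^ 2" if \<sigma>: "\<sigma> \<in> ?G" for \<sigma>
  proof -
    have "dlog sep (Y \<sigma>) = ?act \<sigma> m \<otimes>\<^bsub>?M\<^esub> inv\<^bsub>?M\<^esub> m"
      using fun_cong[OF m(2), of \<sigma>] \<sigma> by (simp add: c_def)
    then have "dlog sep (Y \<sigma>) \<otimes>\<^bsub>?M\<^esub> m = ?act \<sigma> m \<otimes>\<^bsub>?M\<^esub> inv\<^bsub>?M\<^esub> m \<otimes>\<^bsub>?M\<^esub> m" by simp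
    also have am: "?act \<sigma> m = dlog sep (\<sigma> z)" unfolding z(3) by (rule galois_dlog[OF \<sigma> z(1)])
    have amM: "dlog sep (\<sigma> z) \<in> carrier ?M" using galois_simps(1,7)[OF \<sigma>] z by (intro in_M) auto
    have "?act \<sigma> m \<otimes>\<^bsub>?M\<^esub> inv\<^bsub>?M\<^esub> m \<otimes>\<^bsub>?M\<^esub> m = dlog sep (\<sigma> z)"
      unfolding am using amM m(1) by (simp add: M.m_assoc)
    finally have "dlog sep (Y \<sigma>) \<otimes>\<^bsub>?M\<^esub> dlog sep z = dlog sep (\<sigma> z)" using z(3) by simp
    then have "dlog sep (z * Y \<sigma>) = dlog sep (\<sigma> z)"
      using dlog_mult[OF yA(1) z(1) yA(2) z(2)] by (simp add: log_forms_mult)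
    then have "\<exists>w\<in>sep. \<sigma> z = z * Y \<sigma> * w ^ 2"
      using z yA galois_simps(1,7)[OF \<sigma>] sep_closed(2) by (intro dlog_eq_imp_square) auto
    then show ?thesis by (simp add: mult.commute)
  qed
  then show ?thesis using z unfolding Y_def by blast
qed

text \<open>
  In a shortest expression \<open>z = \<Sum> c\<^sub>i\<^sup>2 \<beta>\<^sub>i\<close> the \<open>\<beta>\<^sub>i\<close> are independent over the squares, so that
  \<open>\<sigma> z = z w\<^sup>2\<close> forces \<open>\<sigma> c\<^sub>i = w c\<^sub>i\<close>.
\<close>

lemma fixed_up_to_square:
  fixes z :: "'r alg_closure"
  assumes z: "z \<in> sep" "z \<noteq> 0"
    and G: "\<And>\<sigma>. \<sigma> \<in> galois_group \<Longrightarrow> P \<sigma> \<Longrightarrow> \<exists>w\<in>sep. \<sigma> z = z * w ^ 2"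
  shows "\<exists>c\<in>sep. c \<noteq> 0 \<and> (\<forall>\<sigma>\<in>galois_group. P \<sigma> \<longrightarrow> \<sigma> (z * inverse c ^ 2) = z * inverse c ^ 2)"
proof -
  define rep where "rep I c \<beta> \<longleftrightarrow> finite I \<and> (\<forall>i. c i \<in> sep) \<and> z = (\<Sum>i\<in>I. c i ^ 2 * to_ac (\<beta> i))"
    for I :: "nat set" and c and \<beta> :: "nat \<Rightarrow> 'r"
  define n where "n = (LEAST n. \<exists>I c \<beta>. rep I c \<beta> \<and> card I = n)"
  \<comment> \<open>Separability of z supplies a representation: in z = q(z^2) the powers of z^2 are
    squares and the coefficients lie in the base field.\<close>
  obtain q :: "'r poly" where q: "z = ac_poly q (z ^ 2)" using z(1) sep_closure_iff[OF char2] by blast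
  have "ac_poly q (z ^ 2) = (\<Sum>i\<le>degree q. (z ^ i) ^ 2 * to_ac (coeff q i))"
    by (simp add: poly_altdef coeff_map_poly degree_map_poly mult.commute flip: power_mult)
  then have "rep {..degree q} (\<lambda>i. z ^ i) (coeff q)" using q z(1) sep_closed(6) by (simp add: rep_def)
  then have "\<exists>n I c \<beta>. rep I c \<beta> \<and> card I = n" by blast
  then have "\<exists>I c \<beta>. rep I c \<beta> \<and> card I = n" unfolding n_def by (rule LeastI_ex)
  then obtain I c \<beta> where rep: "rep I c \<beta>" "card I = n" by blast
  then have I: "finite I" "\<And>i. c i \<in> sep" "z = (\<Sum>i\<in>I. c i ^ 2 * to_ac (\<beta> i))" by (simp_all add: rep_def)
  have min: "card I \<le> card J"
    if "finite J" "\<And>i. d i \<in> sep" "z = (\<Sum>i\<in>J. d i ^ 2 * to_ac (\<gamma> i))" for J :: "nat set" and d \<gamma>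
  proof -
    have "rep J d \<gamma>" using that by (simp add: rep_def)
    then show ?thesis unfolding rep(2) n_def by (intro Least_le) blast
  qed
  have indep: "d i = 0" if d: "\<And>i. d i \<in> sep" "(\<Sum>i\<in>I. d i ^ 2 * to_ac (\<beta> i)) = 0" and i: "i \<in> I" for d i
  proof (rule ccontr)
    assume nz: "d i \<noteq> 0"
    \<comment> \<open>In characteristic 2, adding the multiple of the relation that cancels the
      coefficient at i leaves z unchanged and shortens its representation.\<close>
    define e where "e k = c k + c i * d k * inverse (d i)" for k
    have eA: "e k \<in> sep" for k unfolding e_def by (intro sep_closed I d)
    have ei: "e i = 0" using nz ac_two[OF char2, of "c i"] by (simp only: e_def mult.assoc right_inverse[OF nz] mult_1_right)
    have "(\<Sum>k\<in>I. e k ^ 2 * to_ac (\<beta> k)) = z + (c i * inverse (d i)) ^ 2 * (\<Sum>k\<in>I. d k ^ 2 * to_ac (\<beta> k))"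
      unfolding I(3) e_def ac_square_add[OF char2]
      by (simp add: sum_distrib_left sum.distrib distrib_left power_mult_distrib mult_ac)
    then have "z = (\<Sum>k\<in>I. e k ^ 2 * to_ac (\<beta> k))" unfolding d(2) by simp
    also have "\<dots> = (\<Sum>k\<in>I - {i}. e k ^ 2 * to_ac (\<beta> k))" using I(1) i ei by (simp add: sum.remove)
    finally have "card I \<le> card (I - {i})" using I(1) eA by (intro min[of "I - {i}" e]) simp_all
    then show False using I(1) i by (metis card_Diff1_less not_less)
  qed
  \<comment> \<open>Any index j serves: a zero coefficient at j could be dropped, against
    minimality.\<close>
  have "I \<noteq> {}" using I(3) z(2) by auto
  then obtain j where j: "j \<in> I" by blast
  have cj: "c j \<noteq> 0"
  proof
    assume "c j = 0"
    then have "z = (\<Sum>k\<in>I - {j}. c k ^ 2 * to_ac (\<beta> k))" using I(1,3) j by (simp add: sum.remove)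
    then have "card I \<le> card (I - {j})" using I(1,2) by (intro min[of "I - {j}" c]) simp_all
    then show False using I(1) j by (metis card_Diff1_less not_less)
  qed
  have "\<sigma> (z * inverse (c j) ^ 2) = z * inverse (c j) ^ 2" if \<sigma>: "\<sigma> \<in> galois_group" "P \<sigma>" for \<sigma>
  proof -
    note g = galois_simps[OF \<sigma>(1)]
    obtain w where w: "w \<in> sep" "\<sigma> z = z * w ^ 2" using G[OF \<sigma>] by blast
    have sum_A: "(\<Sum>i\<in>J. c i ^ 2 * to_ac (\<beta> i)) \<in> sep \<and> \<sigma> (\<Sum>i\<in>J. c i ^ 2 * to_ac (\<beta> i)) = (\<Sum>i\<in>J. \<sigma> (c i) ^ 2 * to_ac (\<beta> i))"
      if "finite J" for J
      using that
    proof (induction J rule: finite_induct)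
      case (insert k J)
      have "c k ^ 2 \<in> sep" "c k ^ 2 * to_ac (\<beta> k) \<in> sep" by (intro sep_closed I)+
      then show ?case using insert g I(2) sep_closed(1,7) by simp
    qed (simp add: sep_closed g)
    have "(\<Sum>i\<in>I. \<sigma> (c i) ^ 2 * to_ac (\<beta> i)) = z * w ^ 2" using sum_A[OF I(1)] w(2) I(3) by simp
    also have "\<dots> = (\<Sum>i\<in>I. (w * c i) ^ 2 * to_ac (\<beta> i))"
      unfolding I(3) by (simp add: sum_distrib_left sum_distrib_right power_mult_distrib mult_ac)
    finally have eq: "(\<Sum>i\<in>I. \<sigma> (c i) ^ 2 * to_ac (\<beta> i)) = (\<Sum>i\<in>I. (w * c i) ^ 2 * to_ac (\<beta> i))" .
    have "(\<Sum>i\<in>I. (\<sigma> (c i) + w * c i) ^ 2 * to_ac (\<beta> i)) = 0"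
      unfolding ac_square_add[OF char2] distrib_right sum.distrib eq by (rule ac_two[OF char2])
    then have "\<sigma> (c j) + w * c j = 0" using indep[of "\<lambda>i. \<sigma> (c i) + w * c i" j] j g(1) I(2) w(1) sep_closed(1,2) by simp
    then have wc: "\<sigma> (c j) = w * c j" using ac_minus[OF char2] by (metis add_eq_0_iff2)
    have w0: "w \<noteq> 0" using wc g(7)[OF I(2) cj] by auto
    have "\<sigma> (z * inverse (c j) ^ 2) = \<sigma> z * inverse (\<sigma> (c j)) ^ 2"
      using g(3,8,9) z(1) I(2) sep_closed(5,6) by simp
    then show ?thesis unfolding w(2) wc using w0 by (simp add: power_mult_distrib power_inverse)
  qed
  then show ?thesis using cj I(2) by blast
qed

text \<open>The norm of \<open>s\<close> from the quadratic extension generated by \<open>\<alpha>\<close> is the inverse of \<open>y\<close>.\<close>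

lemma norm_form_of_twisted_element:
  fixes x y :: 'r and \<alpha> z \<sigma> s
  assumes \<alpha>: "\<alpha> \<in> sep" "\<alpha> * \<alpha> + \<alpha> = to_ac x"
    and z: "z \<in> sep" "z \<noteq> 0" "\<And>\<rho>. \<rho> \<in> galois_group \<Longrightarrow> \<rho> \<alpha> = \<alpha> \<Longrightarrow> \<rho> z = z"
    and \<sigma>: "\<sigma> \<in> galois_group" "\<sigma> \<alpha> \<noteq> \<alpha>"
    and s: "s \<in> sep" "\<sigma> z = to_ac y * z * s ^ 2"
  shows "\<exists>a b. y = a ^ 2 + a * b + x * b ^ 2"
proof -
  \<comment> \<open>Membership in the quadratic extension generated by \<alpha>, expressed as
    invariance under the stabiliser of \<alpha>.\<close>
  define fixH where "fixH u \<longleftrightarrow> u \<in> sep \<and> (\<forall>\<rho>\<in>galois_group. \<rho> \<alpha> = \<alpha> \<longrightarrow> \<rho> u = u)" for u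
  note g = galois_simps[OF \<sigma>(1)]
  have range: "\<alpha> * \<alpha> + \<alpha> \<in> range to_ac" using \<alpha>(2) by simp
  have \<alpha>1: "\<alpha> + 1 \<in> sep" using \<alpha>(1) sep_closed by simp
  have \<sigma>\<alpha>: "\<sigma> \<alpha> = \<alpha> + 1" using galois_artin_schreier[OF \<sigma>(1) \<alpha>(1) range] \<sigma>(2) by simp
  obtain \<tau> where \<tau>: "\<tau> \<in> galois_group" "\<And>x. x \<in> sep \<Longrightarrow> \<tau> (\<sigma> x) = x" "\<And>x. x \<in> sep \<Longrightarrow> \<sigma> (\<tau> x) = x"
    using galois_inverse[OF char2 \<sigma>(1)] by metis
  have \<tau>\<alpha>: "\<tau> (\<alpha> + 1) = \<alpha>" using \<tau>(2)[OF \<alpha>(1)] \<sigma>\<alpha> by simp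
  have fix_\<sigma>: "fixH (\<sigma> u)" if u: "fixH u" for u
    unfolding fixH_def
  proof (intro conjI ballI impI)
    show "\<sigma> u \<in> sep" using u g(1) by (simp add: fixH_def)
    fix \<rho> assume \<rho>: "\<rho> \<in> galois_group" "\<rho> \<alpha> = \<alpha>"
    \<comment> \<open>The stabiliser of \<alpha> is normal: the conjugate of \<rho> by \<sigma>
      fixes \<alpha> again.\<close>
    let ?\<theta> = "compose sep \<tau> (compose sep \<rho> \<sigma>)"
    have "\<rho> (\<alpha> + 1) = \<alpha> + 1" using galois_simps(2,6)[OF \<rho>(1)] \<alpha>(1) sep_closed(4) \<rho>(2) by simp
    then have "?\<theta> \<alpha> = \<alpha>" using \<alpha>(1) \<sigma>\<alpha> \<tau>\<alpha> by (simp add: compose_def)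
    moreover have "?\<theta> \<in> galois_group" by (intro galois_compose[OF char2] \<tau> \<rho> \<sigma>)
    ultimately have "?\<theta> u = u" using u by (simp add: fixH_def)
    then have "\<tau> (\<rho> (\<sigma> u)) = u" using u by (simp add: fixH_def compose_def)
    then show "\<rho> (\<sigma> u) = \<sigma> u"
      using \<tau>(3) galois_simps(1)[OF \<rho>(1)] g(1) u by (metis fixH_def)
  qed
  have \<sigma>\<sigma>: "\<sigma> (\<sigma> u) = u" if u: "fixH u" for u
  proof -
    have "\<sigma> (\<alpha> + 1) = \<alpha> + (1 + 1)" using g(2,6) \<alpha>(1) sep_closed(4) \<sigma>\<alpha> by (simp add: add.assoc)
    then have "\<sigma> (\<sigma> \<alpha>) = \<alpha>" unfolding \<sigma>\<alpha> ac_two[OF char2] by simp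
    then have "compose sep \<sigma> \<sigma> \<alpha> = \<alpha>" using \<alpha>(1) by (simp add: compose_def)
    then have "compose sep \<sigma> \<sigma> u = u" using u galois_compose[OF char2 \<sigma>(1) \<sigma>(1)] by (simp add: fixH_def)
    then show ?thesis using u by (simp add: compose_def fixH_def)
  qed
  have base: "u \<in> range to_ac" if u: "fixH u" "\<sigma> u = u" for u
  proof (rule galois_fixed[OF char2])
    show uA: "u \<in> sep" using u by (simp add: fixH_def)
    fix \<rho> :: "'r alg_closure \<Rightarrow> 'r alg_closure" assume \<rho>: "\<rho> \<in> galois_group"
    show "\<rho> u = u"
    proof (cases "\<rho> \<alpha> = \<alpha>")
      case True
      then show ?thesis using u(1) \<rho> by (simp add: fixH_def)
    next
      case False
      then have "\<rho> \<alpha> = \<alpha> + 1" using galois_artin_schreier[OF \<rho> \<alpha>(1) range] by simp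
      then have "compose sep \<tau> \<rho> \<alpha> = \<alpha>" using \<alpha>(1) \<tau>\<alpha> by (simp add: compose_def)
      then have "compose sep \<tau> \<rho> u = u" using u(1) galois_compose[OF char2 \<tau>(1) \<rho>] by (simp add: fixH_def)
      then have "\<tau> (\<rho> u) = u" using uA by (simp add: compose_def)
      then show ?thesis using \<tau>(3)[OF galois_simps(1)[OF \<rho> uA]] u(2) by simp
    qed
  qed
  have fz: "fixH z" using z by (simp add: fixH_def)
  have y0: "to_ac y \<noteq> 0" using s(2) g(7)[OF z(1,2)] by auto
  \<comment> \<open>The equation for \<sigma> z determines s^2 from elements that \<rho> fixes, and
    square roots are unique in characteristic 2.\<close>
  have fs: "fixH s"
    unfolding fixH_def
  proof (intro conjI ballI impI s(1))
    fix \<rho> assume \<rho>: "\<rho> \<in> galois_group" "\<rho> \<alpha> = \<alpha>"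
    note r = galois_simps[OF \<rho>(1)]
    have "\<rho> (\<sigma> z) = \<sigma> z" using fix_\<sigma>[OF fz] \<rho> by (simp add: fixH_def)
    moreover have "\<rho> (to_ac y * z * s ^ 2) = to_ac y * z * \<rho> s ^ 2"
      using r(3,4,9) z(1) z(3)[OF \<rho>] s(1) sep_closed(2,6,7) by simp
    ultimately have "to_ac y * z * \<rho> s ^ 2 = to_ac y * z * s ^ 2" using s(2) by simp
    then have "\<rho> s ^ 2 = s ^ 2" using y0 z(2) by simp
    then show "\<rho> s = s" using ac_square_eq_iff[OF char2] by blast
  qed
  have sA: "\<sigma> s \<in> sep" using g(1) s(1) by simp
  have e1: "\<sigma> (to_ac y * z * s ^ 2) = to_ac y * \<sigma> z * \<sigma> s ^ 2"
  proof -
    have "\<sigma> (to_ac y * z * s ^ 2) = \<sigma> (to_ac y * z) * \<sigma> (s ^ 2)"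
      by (rule g(3)[OF sep_closed(2)[OF sep_closed(7) z(1)] sep_closed(6)[OF s(1)]])
    then show ?thesis unfolding g(3)[OF sep_closed(7) z(1)] g(4) g(9)[OF s(1)] .
  qed
  \<comment> \<open>Applying \<sigma> twice gives z = z (y s \<sigma>(s))^2, so that y times the
    norm of s is 1.\<close>
  have e2: "z = \<sigma> (to_ac y * z * s ^ 2)" using \<sigma>\<sigma>[OF fz] unfolding s(2) by (rule sym)
  have e3: "z * 1 ^ 2 = to_ac y * (to_ac y * z * s ^ 2) * \<sigma> s ^ 2"
    using e2 unfolding e1 s(2) by (simp only: power_one mult_1_right)
  have "z * 1 ^ 2 = z * (to_ac y * (s * \<sigma> s)) ^ 2" unfolding e3 by (simp only: power_mult_distrib power2_eq_square mult_ac)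
  then have "(to_ac y * (s * \<sigma> s)) ^ 2 = 1 ^ 2" using z(2) by (metis mult_left_cancel)
  then have norm1: "to_ac y * (s * \<sigma> s) = 1" using ac_square_eq_iff[OF char2] by blast
  \<comment> \<open>The coordinates of s with respect to 1 and \<alpha>: since \<sigma> \<alpha> =
    \<alpha> + 1, the coefficient of \<alpha> is the trace of s.\<close>
  define b where "b = s + \<sigma> s"
  define a where "a = s + b * \<alpha>"
  have fix_add: "fixH (u + w)" and fix_mult: "fixH (u * w)" if uw: "fixH u" "fixH w" for u w
  proof -
    have uwA: "u \<in> sep" "w \<in> sep" using uw by (simp_all add: fixH_def)
    have "\<rho> (u + w) = u + w \<and> \<rho> (u * w) = u * w" if \<rho>: "\<rho> \<in> galois_group" "\<rho> \<alpha> = \<alpha>" for \<rho>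
    proof -
      have "\<rho> u = u" "\<rho> w = w" using uw \<rho> unfolding fixH_def by blast+
      then show ?thesis using galois_simps(2,3)[OF \<rho>(1) uwA] by simp
    qed
    then show "fixH (u + w)" "fixH (u * w)" using sep_closed(1,2)[OF uwA] by (simp_all add: fixH_def)
  qed
  have f\<alpha>: "fixH \<alpha>" using \<alpha>(1) by (simp add: fixH_def)
  have fb: "fixH b" unfolding b_def by (intro fix_add fs fix_\<sigma>)
  have \<sigma>b: "\<sigma> b = b" using g(2)[OF s(1) sA] \<sigma>\<sigma>[OF fs] by (simp add: b_def add.commute)
  have fa: "fixH a" unfolding a_def by (intro fix_add fix_mult fs fb f\<alpha>)
  have sb: "\<sigma> s + b = s"
  proof -
    have "\<sigma> s + b = s + (\<sigma> s + \<sigma> s)" by (simp only: b_def add_ac)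
    then show ?thesis unfolding ac_two[OF char2] by simp
  qed
  have bA: "b \<in> sep" using fb by (simp add: fixH_def)
  have "\<sigma> a = \<sigma> s + b * (\<alpha> + 1)"
    using g(2)[OF s(1) sep_closed(2)[OF bA \<alpha>(1)]] g(3)[OF bA \<alpha>(1)] \<sigma>b \<sigma>\<alpha> by (simp add: a_def)
  also have "\<dots> = (\<sigma> s + b) + b * \<alpha>" by (simp add: algebra_simps)
  finally have \<sigma>a: "\<sigma> a = a" unfolding sb by (simp add: a_def)
  obtain b0 where b0: "b = to_ac b0" using base[OF fb \<sigma>b] by blast
  obtain a0 where a0: "a = to_ac a0" using base[OF fa \<sigma>a] by blast
  have sa: "s = a + b * \<alpha>"
  proof -
    have "a + b * \<alpha> = s + (b * \<alpha> + b * \<alpha>)" by (simp only: a_def add.assoc)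
    then show ?thesis unfolding ac_two[OF char2] by simp
  qed
  have \<sigma>s: "\<sigma> s = s + b"
  proof -
    have "s + b = \<sigma> s + (s + s)" by (simp only: b_def add_ac)
    then show ?thesis unfolding ac_two[OF char2] by simp
  qed
  have "s * \<sigma> s = a ^ 2 + a * b + (\<alpha> * \<alpha> + \<alpha>) * b ^ 2 + (a * b * \<alpha> + a * b * \<alpha>)"
    unfolding \<sigma>s unfolding sa by (simp add: power2_eq_square algebra_simps)
  also have "\<dots> = to_ac (a0 ^ 2 + a0 * b0 + x * b0 ^ 2)" unfolding ac_two[OF char2] \<alpha>(2) a0 b0 by simp
  finally have "to_ac (y * (a0 ^ 2 + a0 * b0 + x * b0 ^ 2)) = to_ac 1" using norm1 by simp
  then have "y * (a0 ^ 2 + a0 * b0 + x * b0 ^ 2) = 1" by (simp only: to_ac_eq_iff)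
  \<comment> \<open>The form is quadratic, so scaling both coordinates by y turns its value 1/y into
    y.\<close>
  then have "y = y * (y * (a0 ^ 2 + a0 * b0 + x * b0 ^ 2))" by simp
  also have "\<dots> = (y * a0) ^ 2 + (y * a0) * (y * b0) + x * (y * b0) ^ 2"
    by (simp add: power2_eq_square algebra_simps)
  finally show ?thesis by blast
qed

lemma norm_form_universal:
  fixes x y :: 'r
  assumes triv: "trivial_group (etale_H2_Zmodp1 TYPE('r))"
  shows "\<exists>a b. y = a ^ 2 + a * b + x * b ^ 2"
proof (cases "y = 0")
  case True
  then show ?thesis by (intro exI[of _ 0]) simp
next
  case y: False
  have "degree [:to_ac x, 1, 1:] > 0" by simp
  then obtain \<alpha> where "poly [:to_ac x, 1, 1:] \<alpha> = 0" using alg_closed_imp_poly_has_root by blast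
  then have "to_ac x + (\<alpha> * \<alpha> + \<alpha>) = 0" by (simp add: algebra_simps)
  then have \<alpha>: "\<alpha> * \<alpha> + \<alpha> = to_ac x" using ac_minus[OF char2] by (metis add_eq_0_iff)
  \<comment> \<open>\<alpha> = x + \<alpha>^2 is a polynomial in \<alpha>^2, which is the
    separability criterion of \<open>sep_closure_iff\<close>.\<close>
  have "\<alpha> = ac_poly [:x, 1:] (\<alpha> ^ 2)"
  proof -
    have "ac_poly [:x, 1:] (\<alpha> ^ 2) = \<alpha> + (\<alpha> * \<alpha> + \<alpha> * \<alpha>)"
      by (simp add: \<alpha>[symmetric] power2_eq_square algebra_simps)
    then show ?thesis unfolding ac_two[OF char2] by simp
  qed
  then have \<alpha>sep: "\<alpha> \<in> sep" using sep_closure_iff[OF char2] by blast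
  show ?thesis
  proof (cases "\<alpha> \<in> range to_ac")
    case True
    then obtain d where d: "\<alpha> = to_ac d" by blast
    have x: "x = d * d + d" using \<alpha> unfolding d by (simp flip: to_ac_mult to_ac_add)
    note two = base_two[OF char2]
    \<comment> \<open>The form splits as (a + d b) (a + d b + b); a and b are chosen such that the
      two factors are y and 1.\<close>
    define b where "b = y + 1"
    define a where "a = y + d * b"
    have ay: "a + d * b = y" unfolding a_def add.assoc two by simp
    have "a ^ 2 + a * b + x * b ^ 2 + (a * d * b + a * d * b) = (a + d * b) * ((a + d * b) + b)"
      unfolding x by (simp add: power2_eq_square algebra_simps)
    also have "(a + d * b) + b = (y + y) + 1" unfolding ay unfolding b_def by (simp only: add.assoc)
    finally have "y = a ^ 2 + a * b + x * b ^ 2" unfolding two ay by simp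
    then show ?thesis by blast
  next
    case False
    then obtain \<sigma> where \<sigma>: "\<sigma> \<in> galois_group" "\<sigma> \<alpha> \<noteq> \<alpha>" using galois_fixed[OF char2 \<alpha>sep] by blast
    have "\<alpha> * \<alpha> + \<alpha> \<in> range to_ac" using \<alpha> by simp
    from coboundary_of_dlog[OF triv \<alpha>sep this y] obtain z where z: "z \<in> sep" "z \<noteq> 0"
      "\<And>\<sigma>. \<sigma> \<in> galois_group \<Longrightarrow> \<exists>w\<in>sep. \<sigma> z = (if \<sigma> \<alpha> = \<alpha> then 1 else to_ac y) * z * w ^ 2" by blast
    have "\<exists>w\<in>sep. \<rho> z = z * w ^ 2" if "\<rho> \<in> galois_group" "\<rho> \<alpha> = \<alpha>" for \<rho>
      using z(3)[OF that(1)] that(2) by simp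
    then obtain c where c: "c \<in> sep" "c \<noteq> 0"
      "\<forall>\<rho>\<in>galois_group. \<rho> \<alpha> = \<alpha> \<longrightarrow> \<rho> (z * inverse c ^ 2) = z * inverse c ^ 2"
      using fixed_up_to_square[OF z(1,2), of "\<lambda>\<rho>. \<rho> \<alpha> = \<alpha>"] by blast
    note g = galois_simps[OF \<sigma>(1)]
    obtain w where w: "w \<in> sep" "\<sigma> z = to_ac y * z * w ^ 2" using z(3)[OF \<sigma>(1)] \<sigma>(2) by auto
    show ?thesis
    proof (rule norm_form_of_twisted_element[OF \<alpha>sep \<alpha> _ _ _ \<sigma>])
      show "z * inverse c ^ 2 \<in> sep" by (intro sep_closed z c)
      show "z * inverse c ^ 2 \<noteq> 0" using z c by simp
      \<comment> \<open>Dividing z by c^2 replaces w by w c / \<sigma>(c) in the equation for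
        \<sigma> z.\<close>
      show "w * c * inverse (\<sigma> c) \<in> sep" by (intro sep_closed w c g)
      show "\<rho> (z * inverse c ^ 2) = z * inverse c ^ 2" if "\<rho> \<in> galois_group" "\<rho> \<alpha> = \<alpha>" for \<rho>
        using c(3) that by blast
      have "\<sigma> (z * inverse c ^ 2) = \<sigma> z * inverse (\<sigma> c) ^ 2"
        using g(3,8,9) z(1) c(1) sep_closed(5,6) by simp
      then show "\<sigma> (z * inverse c ^ 2) = to_ac y * (z * inverse c ^ 2) * (w * c * inverse (\<sigma> c)) ^ 2"
        unfolding w(2) using c(2) by (simp add: power_mult_distrib power_inverse)
    qed
  qed
qed

end

section \<open>The restriction map\<close>

theorem theorem4p1:
  fixes v :: "'k::field_char_0 \<Rightarrow> int"
    and res :: "'k \<Rightarrow> 'r::field"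
    and emb :: "'k \<Rightarrow> 'l::field"
    and p :: nat
  assumes "complete_discretely_valued_field v"
    and "residue_map v res"
    and "CHAR('r) = p" and "p > 0"
    and "finite_p_rank p TYPE('r)"
    and "pseudo_perfect_extension p v res emb"
  shows "(\<forall>i\<ge>3. \<forall>x\<in>carrier (milnor_K_mod p i).
            milnor_res_mod emb p i x = \<one>\<^bsub>milnor_K_mod p i\<^esub>) \<and>
         (p \<noteq> 2 \<or> trivial_group (etale_H2_Zmodp1 TYPE('r)) \<longrightarrow>
            (\<forall>x\<in>carrier (milnor_K_mod p 2).
               milnor_res_mod emb p 2 x = \<one>\<^bsub>milnor_K_mod p 2\<^esub>))"
proof -
  have "emb \<in> ring_hom ring_of_type_algebra ring_of_type_algebra"
    using assms(6) by (simp add: pseudo_perfect_extension_def)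
  then interpret embedded_complete_field v emb
    using assms(1) by (simp add: embedded_complete_field_def embedded_complete_field_axioms_def)
  have res_trivial: "milnor_res_mod emb p i x = \<one>\<^bsub>milnor_K_mod p i\<^esub>"
    if "i \<ge> 3 \<or> i = 2 \<and> (p = 2 \<longrightarrow> (\<forall>x y :: 'r. \<exists>a b. y = a ^ 2 + a * b + x * b ^ 2))"
      and "x \<in> carrier (milnor_K_mod p i)" for i x
    using that(2)
    by (intro milnor_res_mod_eq_one milnor_tuple_null[OF assms(1-4,6) that(1)]) simp_all
  show ?thesis
  proof (intro conjI allI impI ballI)
    fix x :: "('k list \<Rightarrow>\<^sub>0 int) set set"
    assume "p \<noteq> 2 \<or> trivial_group (etale_H2_Zmodp1 TYPE('r))" "x \<in> carrier (milnor_K_mod p 2)"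
    moreover have "\<exists>a b. y = a ^ 2 + a * b + x * b ^ 2"
      if "p = 2" "trivial_group (etale_H2_Zmodp1 TYPE('r))" for x y :: 'r
      using norm_form_universal that assms(3) by blast
    ultimately show "milnor_res_mod emb p 2 x = \<one>\<^bsub>milnor_K_mod p 2\<^esub>"
      by (intro res_trivial) auto
  qed (simp add: res_trivial)
qed

end
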